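(* Optimal Linear Arrangement parameterized by vertex cover has a $(1+\epsilon)$-approximate kernel of size ${\cal O}(\frac{1}{\epsilon}2^kk^4)$.
   Context: In Optimal Linear Arrangement the input is a graph $G$ on $n$ vertices and the task is to find a bijection $\sigma:V(G)\to\{1,\ldots,n\}$ minimizing $val(\sigma,G)=\sum_{uv\in E(G)}|\sigma(u)-\sigma(v)|$. Parameterized by vertex cover it is the parameterized minimization problem $OLA((G,C),k,\sigma)=-\infty$ if $C$ is not a vertex cover of $G$ of size at most $k$, $\infty$ if $\sigma$ is not a linear layout, and $val(\sigma,G)$ otherwise. A $(1+\epsilon)$-approximate kernel is a polynomial-time reduction algorithm producing an instance of size bounded by a function of $k$, together with a polynomial-time solution lifting algorithm such that for every $c\ge1$ a $c$-approximate solution to the reduced instance is lifted to a $c(1+\epsilon)$-approximate solution to the original instance. *)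

theory Defs
  imports
    Complex_Main
    "HOL-Library.Extended_Real"
    "HOL-Library.Log_Nat"
    "HOL-Computational_Algebra.Polynomial"
begin

section \<open>Machine model: a structured random access machine\<close>

text \<open>
  Programs are finite while-programs over numbered registers and numbered one-dimensional arrays
  of natural numbers, with unit cost per executed command.  The arithmetic is restricted to
  addition and truncated subtraction.  This restriction matters: after \<open>t\<close> steps all numbers have
  only \<open>O(t)\<close> more bits than the input, so that the unit-cost model is polynomially equivalent to
  Turing machines (which would fail with multiplication as a primitive).
\<close>

datatype aexp =
    Const nat
  | Reg nat
  | Cell nat aexp
  | Plus aexp aexp
  | Minus aexp aexp

datatype bexp =
    Less aexp aexp
  | Equal aexp aexp
  | Not bexp
  | And bexp bexp

datatype com =
    Skip
  | Assign nat aexp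
  | Store nat aexp aexp
  | Seq com com
  | If bexp com com
  | While bexp com

record store =
  reg :: "nat \<Rightarrow> nat"
  arr :: "nat \<Rightarrow> nat \<Rightarrow> nat"

fun aval :: "aexp \<Rightarrow> store \<Rightarrow> nat" where
  "aval (Const n) s = n"
| "aval (Reg x) s = reg s x"
| "aval (Cell a i) s = arr s a (aval i s)"
| "aval (Plus d e) s = aval d s + aval e s"
| "aval (Minus d e) s = aval d s - aval e s"

fun bval :: "bexp \<Rightarrow> store \<Rightarrow> bool" where
  "bval (Less d e) s \<longleftrightarrow> aval d s < aval e s"
| "bval (Equal d e) s \<longleftrightarrow> aval d s = aval e s"
| "bval (Not b) s \<longleftrightarrow> \<not> bval b s"
| "bval (And b b') s \<longleftrightarrow> bval b s \<and> bval b' s"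

text \<open>\<open>exec P s t s'\<close>: started in \<open>s\<close>, program \<open>P\<close> halts in \<open>s'\<close> after exactly \<open>t\<close> steps.\<close>

inductive exec :: "com \<Rightarrow> store \<Rightarrow> nat \<Rightarrow> store \<Rightarrow> bool" where
  Skip: "exec Skip s 1 s"
| Assign: "exec (Assign x e) s 1 (s\<lparr>reg := (reg s)(x := aval e s)\<rparr>)"
| Store: "exec (Store a i e) s 1
    (s\<lparr>arr := (arr s)(a := (arr s a)(aval i s := aval e s))\<rparr>)"
| Seq: "exec P s t s' \<Longrightarrow> exec Q s' t' s'' \<Longrightarrow> exec (Seq P Q) s (1 + t + t') s''"
| IfTrue: "bval b s \<Longrightarrow> exec P s t s' \<Longrightarrow> exec (If b P Q) s (1 + t) s'"
| IfFalse: "\<not> bval b s \<Longrightarrow> exec Q s t s' \<Longrightarrow> exec (If b P Q) s (1 + t) s'"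
| WhileFalse: "\<not> bval b s \<Longrightarrow> exec (While b P) s 1 s"
| WhileTrue: "bval b s \<Longrightarrow> exec P s t s' \<Longrightarrow> exec (While b P) s' t' s'' \<Longrightarrow>
    exec (While b P) s (1 + t + t') s''"

text \<open>
  Strings are finite sequences of natural numbers.  Their size is a bit length: a sequence is
  thought of as written down in binary, with one terminating symbol after each number.
\<close>

type_synonym word = "nat list"

definition word_size :: "word \<Rightarrow> nat" where
  "word_size w = (\<Sum>x\<leftarrow>w. floorlog 2 x + 1)"

text \<open>
  The \<open>j\<close>-th argument of a program is supplied in array \<open>j\<close>, its number of entries in register
  \<open>j\<close>; everything else is initially 0.  Results are returned in the same format.
\<close>

definition init_store :: "word list \<Rightarrow> store" where
  "init_store ws = \<lparr>
     reg = (\<lambda>j. if j < length ws then length (ws ! j) else 0),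
     arr = (\<lambda>j i. if j < length ws \<and> i < length (ws ! j) then ws ! j ! i else 0)\<rparr>"

definition output_word :: "store \<Rightarrow> nat \<Rightarrow> word" where
  "output_word s j = map (arr s j) [0..<reg s j]"

definition computes_within :: "com \<Rightarrow> word list \<Rightarrow> word list \<Rightarrow> nat \<Rightarrow> bool" where
  "computes_within P ws vs T \<longleftrightarrow>
     (\<exists>t s. exec P (init_store ws) t s \<and> t \<le> T \<and> map (output_word s) [0..<length vs] = vs)"

lemma exec_deterministic:
  "exec P s t u \<Longrightarrow> exec P s t' u' \<Longrightarrow> t' = t \<and> u' = u"
proof (induction arbitrary: t' u' rule: exec.induct)
  case (Seq P s t s' Q r s'')
  from Seq.prems show ?case by cases (use Seq.IH in blast)
next
  case (IfTrue b s P t s' Q)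
  from IfTrue.prems show ?case by cases (use IfTrue in blast)+
next
  case (IfFalse b s Q t s' P)
  from IfFalse.prems show ?case by cases (use IfFalse in blast)+
next
  case (WhileTrue b s P t s' r s'')
  from WhileTrue.prems show ?case by cases (use WhileTrue in blast)+
qed (auto elim: exec.cases)


section \<open>Parameterized minimization problems and approximate kernels\<close>

text \<open>
  \<open>cost \<Pi> I k s\<close> is the value of the solution string \<open>s\<close> for the instance \<open>(I, k)\<close>.
  The instances proper \<open>I\<close> are abstract objects; \<open>encode \<Pi>\<close> writes them as strings.
\<close>

record 'i min_problem =
  instances :: "'i set"
  encode :: "'i \<Rightarrow> word"
  cost :: "'i \<Rightarrow> nat \<Rightarrow> word \<Rightarrow> ereal"

definition opt :: "'i min_problem \<Rightarrow> 'i \<Rightarrow> nat \<Rightarrow> ereal" where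
  "opt \<Pi> I k = (INF s. cost \<Pi> I k s)"

definition approx_solution :: "'i min_problem \<Rightarrow> real \<Rightarrow> 'i \<Rightarrow> nat \<Rightarrow> word \<Rightarrow> bool" where
  "approx_solution \<Pi> c I k s \<longleftrightarrow> cost \<Pi> I k s \<le> ereal c * opt \<Pi> I k"

abbreviation inst_size :: "'i min_problem \<Rightarrow> 'i \<Rightarrow> nat" where
  "inst_size \<Pi> I \<equiv> word_size (encode \<Pi> I)"

text \<open>
  \<open>approx_kernel \<Pi> \<alpha> g R L\<close>: the programs \<open>R\<close> (reduction) and \<open>L\<close> (solution lifting) form an
  \<open>\<alpha>\<close>-approximate kernel for \<open>\<Pi>\<close> whose reduced instances \<open>(I', k')\<close> satisfy
  \<open>\<bar>I'\<bar> + k' \<le> g k\<close>.  The parameter is passed to the programs as a one-element string, but enters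
  the running times by its value.
\<close>

definition approx_kernel ::
  "'i min_problem \<Rightarrow> real \<Rightarrow> (nat \<Rightarrow> real) \<Rightarrow> com \<Rightarrow> com \<Rightarrow> bool" where
  "approx_kernel \<Pi> \<alpha> g R L \<longleftrightarrow>
     (\<exists>p q :: nat poly. \<forall>I\<in>instances \<Pi>. \<forall>k. \<exists>I'\<in>instances \<Pi>. \<exists>k'.
        computes_within R
          [encode \<Pi> I, [k]]
          [encode \<Pi> I', [k']]
          (poly p (inst_size \<Pi> I + k)) \<and>
        real (inst_size \<Pi> I' + k') \<le> g k \<and>
        (\<forall>s'. \<exists>s.
           computes_within L
             [encode \<Pi> I, [k], encode \<Pi> I', [k'], s']
             [s]
             (poly q (inst_size \<Pi> I + k + inst_size \<Pi> I' + k' + word_size s')) \<and>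
           (\<forall>c\<ge>1. approx_solution \<Pi> c I' k' s' \<longrightarrow> approx_solution \<Pi> (c * \<alpha>) I k s)))"

definition has_approx_kernel :: "'i min_problem \<Rightarrow> real \<Rightarrow> (nat \<Rightarrow> real) \<Rightarrow> bool" where
  "has_approx_kernel \<Pi> \<alpha> g \<longleftrightarrow> (\<exists>R L. approx_kernel \<Pi> \<alpha> g R L)"


section \<open>Optimal Linear Arrangement parameterized by vertex cover\<close>

text \<open>A pair \<open>(n, E)\<close> stands for the graph with vertex set \<open>{..<n}\<close> and edge set \<open>E\<close>.\<close>

type_synonym graph = "nat \<times> nat set set"

definition simple_graph :: "graph \<Rightarrow> bool" where
  "simple_graph = (\<lambda>(n, E). \<forall>e\<in>E. e \<subseteq> {..<n} \<and> card e = 2)"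

definition vertex_cover :: "graph \<Rightarrow> nat set \<Rightarrow> bool" where
  "vertex_cover = (\<lambda>(n, E) C. C \<subseteq> {..<n} \<and> (\<forall>e\<in>E. e \<inter> C \<noteq> {}))"

text \<open>A string \<open>\<sigma>\<close> is read as the map taking the vertex \<open>v\<close> to the entry \<open>\<sigma> ! v\<close>.\<close>

definition linear_layout :: "graph \<Rightarrow> word \<Rightarrow> bool" where
  "linear_layout = (\<lambda>(n, E) \<sigma>. length \<sigma> = n \<and> bij_betw (\<lambda>v. \<sigma> ! v) {..<n} {1..n})"

text \<open>Each edge is counted once, through its representation with \<open>u < v\<close>.\<close>

definition layout_val :: "word \<Rightarrow> graph \<Rightarrow> real" where
  "layout_val \<sigma> = (\<lambda>(n, E).
     \<Sum>(u, v)\<in>{(u, v). u < v \<and> {u, v} \<in> E}. \<bar>real (\<sigma> ! u) - real (\<sigma> ! v)\<bar>)"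

definition ola_cost :: "graph \<times> nat set \<Rightarrow> nat \<Rightarrow> word \<Rightarrow> ereal" where
  "ola_cost = (\<lambda>(G, C) k \<sigma>.
     if \<not> (vertex_cover G C \<and> card C \<le> k) then -\<infinity>
     else if \<not> linear_layout G \<sigma> then \<infinity>
     else ereal (layout_val \<sigma> G))"

text \<open>
  \<open>(G, C)\<close> is written down as the number of vertices, the list of the elements of \<open>C\<close>, and the
  adjacency lists; an edge is stored once, in the list of its larger endpoint.  Every list is
  increasing and is preceded by its length.
\<close>

definition encode_set :: "nat set \<Rightarrow> word" where
  "encode_set A = card A # sorted_list_of_set A"

definition encode_ola :: "graph \<times> nat set \<Rightarrow> word" where
  "encode_ola = (\<lambda>((n, E), C).
     n # encode_set C @ concat (map (\<lambda>v. encode_set {u. u < v \<and> {u, v} \<in> E}) [0..<n]))"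

definition OLA :: "(graph \<times> nat set) min_problem" where
  "OLA = \<lparr>
     instances = {((n, E), C). simple_graph (n, E) \<and> C \<subseteq> {..<n}},
     encode = encode_ola,
     cost = ola_cost\<rparr>"

end

(*
  Let C be the vertex cover, kappa = |C|. Non-isolated vertices outside C with the same
  neighbourhood are collected in groups of size at most m, with at most one non-full group per
  neighbourhood, and each group is contracted to one of its vertices. Replacing a vertex of a
  layout of the contracted graph by its group multiplies edge lengths by at most m, hence values
  by at most m^2. Conversely, a layout of G induces one of the contracted graph through
  representatives of the groups; for random representatives the expected value is at most
  1/m^2 times the value for G, up to an error of order kappa 2^kappa n / m. As every layout of G
  has value at least of order n^2 / kappa, some m of order eps n / (kappa^2 2^kappa) makes the
  error a factor 1 + eps, while O(kappa^2 2^kappa / eps) vertices remain. For eps of order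
  kappa^2 or more every layout that puts the isolated vertices last is good enough.
*)
theory Submission
  imports Defs "HOL-Analysis.Convex"
begin

text \<open>The random layout is never computed. It only shows that the optimum of the contracted
  graph is small, so existence is enough. The gain is m^2 and not m because two things must happen:
  an end x of an edge xc and a vertex y between x and c, both in full groups, must be chosen as
  representatives, each with probability 1/m. Groups that are not full escape this count and go into
  the error, which is why there may be only one of them per neighbourhood.

  The lower bound on the value comes from the degrees of the cover vertices, whose neighbours occupy
  distinct positions. This is also why isolated vertices have to be set aside: no edge length sees
  them.

  The solution lifting is not told the groups. It repeats the preprocessing, and determinism of the
  machine guarantees that it finds the same groups as the reduction did.

  The machine knows natural numbers, addition and truncated subtraction only. Hence \<epsilon> is
  replaced by a rational A/D below it, with A and D built into the programs as constants, and m is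
  found by repeated addition.\<close>

section \<open>Structured programs: total correctness with a static step bound\<close>

text \<open>Weakest preconditions of programs in which every loop runs at most \<open>B\<close> times; such a program
  takes at most \<open>steps B\<close> steps, which is a polynomial in \<open>B\<close>.\<close>

primrec wp :: "nat \<Rightarrow> com \<Rightarrow> (store \<Rightarrow> bool) \<Rightarrow> store \<Rightarrow> bool" where
  "wp B Skip Q s = Q s"
| "wp B (Assign x e) Q s = Q (s\<lparr>reg := (reg s)(x := aval e s)\<rparr>)"
| "wp B (Store a i e) Q s = Q (s\<lparr>arr := (arr s)(a := (arr s a)(aval i s := aval e s))\<rparr>)"
| "wp B (Seq c d) Q s = wp B c (wp B d Q) s"
| "wp B (If b c d) Q s = (if bval b s then wp B c Q s else wp B d Q s)"
| "wp B (While b c) Q s =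
     (\<exists>N\<le>B. ((\<lambda>R s. bval b s \<and> wp B c R s) ^^ N) (\<lambda>s. \<not> bval b s \<and> Q s) s)"

abbreviation "set_reg s x v \<equiv> s\<lparr>reg := (reg s)(x := v)\<rparr>"

text \<open>The branches of a conditional are added instead of taking their maximum, which keeps the
  bound a polynomial in \<open>B\<close>.\<close>

primrec steps :: "nat \<Rightarrow> com \<Rightarrow> nat" where
  "steps B Skip = 1"
| "steps B (Assign x e) = 1"
| "steps B (Store a i e) = 1"
| "steps B (Seq c d) = 1 + steps B c + steps B d"
| "steps B (If b c d) = 1 + steps B c + steps B d"
| "steps B (While b c) = 1 + B * (1 + steps B c)"

lemma wp_sound: "wp B c Q s \<Longrightarrow> \<exists>t s'. exec c s t s' \<and> t \<le> steps B c \<and> Q s'"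
proof (induction c arbitrary: Q s)
  case Skip
  then show ?case by (auto intro!: exec.Skip exI)
next
  case (Assign x e)
  then show ?case by (auto intro!: exec.Assign exI)
next
  case (Store a i e)
  then show ?case by (auto intro!: exec.Store exI)
next
  case (Seq c d)
  from Seq.IH(1)[OF Seq.prems[unfolded wp.simps]]
  obtain t s' where 1: "exec c s t s'" "t \<le> steps B c" "wp B d Q s'" by blast
  from Seq.IH(2)[OF 1(3)] obtain t' s'' where 2: "exec d s' t' s''" "t' \<le> steps B d" "Q s''" by blast
  show ?case
    by (rule exI, rule exI, rule conjI, rule exec.Seq[OF 1(1) 2(1)]) (use 1 2 in auto)
next
  case (If b c d)
  show ?case
  proof (cases "bval b s")
    case True
    with If.prems have "wp B c Q s" by simp
    from If.IH(1)[OF this] obtain t s' where 1: "exec c s t s'" "t \<le> steps B c" "Q s'" by blast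
    show ?thesis
      by (rule exI, rule exI, rule conjI, rule exec.IfTrue[OF True 1(1)]) (use 1 in auto)
  next
    case False
    with If.prems have "wp B d Q s" by simp
    from If.IH(2)[OF this] obtain t s' where 1: "exec d s t s'" "t \<le> steps B d" "Q s'" by blast
    show ?thesis
      by (rule exI, rule exI, rule conjI, rule exec.IfFalse[OF False 1(1)]) (use 1 in auto)
  qed
next
  case (While b c)
  \<comment> \<open>\<open>N\<close> is the exact number of iterations, so the induction runs on
    \<open>N\<close>; \<open>N \<le> B\<close> enters only at the end.\<close>
  have *: "\<exists>t s'. exec (While b c) s t s' \<and> t \<le> 1 + N * (1 + steps B c) \<and> Q s'"
    if "((\<lambda>R s. bval b s \<and> wp B c R s) ^^ N) (\<lambda>s. \<not> bval b s \<and> Q s) s" for N s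
    using that
  proof (induction N arbitrary: s)
    case 0
    then have "exec (While b c) s 1 s" "Q s" using exec.WhileFalse[of b s c] by simp_all
    then show ?case by force
  next
    case (Suc N)
    from Suc.prems have b: "bval b s"
      and w: "wp B c (((\<lambda>R s. bval b s \<and> wp B c R s) ^^ N) (\<lambda>s. \<not> bval b s \<and> Q s)) s"
      by simp_all
    from While.IH[OF w] obtain t s' where 1: "exec c s t s'" "t \<le> steps B c"
      "((\<lambda>R s. bval b s \<and> wp B c R s) ^^ N) (\<lambda>s. \<not> bval b s \<and> Q s) s'" by blast
    from Suc.IH[OF 1(3)] obtain t' s'' where
      2: "exec (While b c) s' t' s''" "t' \<le> 1 + N * (1 + steps B c)" "Q s''" by blast
    show ?case
      by (rule exI, rule exI, rule conjI, rule exec.WhileTrue[OF b 1(1) 2(1)]) (use 1 2 in auto)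
  qed
  from While.prems obtain N where N: "N \<le> B"
    "((\<lambda>R s. bval b s \<and> wp B c R s) ^^ N) (\<lambda>s. \<not> bval b s \<and> Q s) s" by auto
  from *[OF N(2)] obtain t s' where 1: "exec (While b c) s t s'"
    "t \<le> 1 + N * (1 + steps B c)" "Q s'" by blast
  have "N * (1 + steps B c) \<le> B * (1 + steps B c)" using N(1) by (rule mult_le_mono1)
  with 1 show ?case by (metis add_left_mono le_trans steps.simps(6))
qed

lemma steps_poly: "\<exists>p. \<forall>B. steps B c = poly p B"
proof (induction c)
  case Skip
  show ?case by (rule exI[of _ "[:1:]"]) simp
next
  case (Assign x1 x2)
  show ?case by (rule exI[of _ "[:1:]"]) simp
next
  case (Store x1 x2 x3)
  show ?case by (rule exI[of _ "[:1:]"]) simp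
next
  case (Seq c d)
  then obtain p q where "\<forall>B. steps B c = poly p B" "\<forall>B. steps B d = poly q B" by blast
  then show ?case by (intro exI[of _ "[:1:] + p + q"]) simp
next
  case (If b c d)
  then obtain p q where "\<forall>B. steps B c = poly p B" "\<forall>B. steps B d = poly q B" by blast
  then show ?case by (intro exI[of _ "[:1:] + p + q"]) simp
next
  case (While b c)
  then obtain p where "\<forall>B. steps B c = poly p B" by blast
  then show ?case by (intro exI[of _ "[:1:] + [:0, 1:] * ([:1:] + p)"]) simp
qed

section \<open>Frame conditions: what a program leaves unchanged\<close>

primrec mod_regs :: "com \<Rightarrow> nat set" where
  "mod_regs Skip = {}"
| "mod_regs (Assign x e) = {x}"
| "mod_regs (Store a i e) = {}"
| "mod_regs (Seq c d) = mod_regs c \<union> mod_regs d"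
| "mod_regs (If b c d) = mod_regs c \<union> mod_regs d"
| "mod_regs (While b c) = mod_regs c"

primrec mod_arrs :: "com \<Rightarrow> nat set" where
  "mod_arrs Skip = {}"
| "mod_arrs (Assign x e) = {}"
| "mod_arrs (Store a i e) = {a}"
| "mod_arrs (Seq c d) = mod_arrs c \<union> mod_arrs d"
| "mod_arrs (If b c d) = mod_arrs c \<union> mod_arrs d"
| "mod_arrs (While b c) = mod_arrs c"

definition agree :: "com \<Rightarrow> store \<Rightarrow> store \<Rightarrow> bool" where
  "agree c s s' \<longleftrightarrow> (\<forall>x. x \<notin> mod_regs c \<longrightarrow> reg s' x = reg s x) \<and>
     (\<forall>a. a \<notin> mod_arrs c \<longrightarrow> arr s' a = arr s a)"

lemma agree_regD: "agree c s s' \<Longrightarrow> x \<notin> mod_regs c \<Longrightarrow> reg s' x = reg s x"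
  and agree_arrD: "agree c s s' \<Longrightarrow> a \<notin> mod_arrs c \<Longrightarrow> arr s' a = arr s a"
  by (simp_all add: agree_def)

text \<open>The frame rule. Postconditions mention only what a program changes; everything else is
  recovered from \<open>agree\<close>, whose modified registers and arrays are read off from the
  syntax.\<close>

lemma wp_agree_mono:
  "wp B c Q s \<Longrightarrow> (\<And>s'. Q s' \<Longrightarrow> agree c s s' \<Longrightarrow> Q' s') \<Longrightarrow> wp B c Q' s"
proof (induction c arbitrary: Q Q' s)
  case (Seq c d)
  show ?case unfolding wp.simps
  proof (rule Seq.IH(1)[OF Seq.prems(1)[unfolded wp.simps]])
    fix s' assume d: "wp B d Q s'" and c: "agree c s s'"
    show "wp B d Q' s'"
    proof (rule Seq.IH(2)[OF d])
      fix s'' assume "Q s''" "agree d s' s''"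
      with c show "Q' s''" by (intro Seq.prems(2)) (auto simp: agree_def)
    qed
  qed
next
  case (If b c d)
  show ?case
  proof (cases "bval b s")
    case True
    with If.prems(1) have "wp B c Q s" by simp
    from If.IH(1)[OF this, of Q'] If.prems(2) True show ?thesis by (simp add: agree_def)
  next
    case False
    with If.prems(1) have "wp B d Q s" by simp
    from If.IH(2)[OF this, of Q'] If.prems(2) False show ?thesis by (simp add: agree_def)
  qed
next
  case (While b c)
  let ?F = "\<lambda>R s. bval b s \<and> wp B c R s"
  have *: "(?F ^^ N) (\<lambda>s. \<not> bval b s \<and> Q s) s1 \<Longrightarrow> agree c s s1 \<Longrightarrow>
    (?F ^^ N) (\<lambda>s. \<not> bval b s \<and> Q' s) s1" for N s1
  proof (induction N arbitrary: s1)
    case 0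
    then show ?case using While.prems(2) by (auto simp: agree_def)
  next
    case (Suc N)
    from Suc.prems have b: "bval b s1" and w: "wp B c ((?F ^^ N) (\<lambda>s. \<not> bval b s \<and> Q s)) s1"
      by simp_all
    have "wp B c ((?F ^^ N) (\<lambda>s. \<not> bval b s \<and> Q' s)) s1"
      by (rule While.IH[OF w], rule Suc.IH) (use Suc.prems(2) in \<open>auto simp: agree_def\<close>)
    with b show ?case by simp
  qed
  from While.prems(1) obtain N where "N \<le> B" "(?F ^^ N) (\<lambda>s. \<not> bval b s \<and> Q s) s" by auto
  with *[of N s] show ?case by (auto simp: agree_def)
qed (auto simp: agree_def)

section \<open>Counting loops\<close>

definition For :: "nat \<Rightarrow> nat \<Rightarrow> com \<Rightarrow> com" where
  "For x r c = Seq (Assign x (Const 0))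
     (While (Less (Reg x) (Reg r)) (Seq c (Assign x (Plus (Reg x) (Const 1)))))"

lemma mod_regs_For [simp]: "mod_regs (For x r c) = insert x (mod_regs c)"
  and mod_arrs_For [simp]: "mod_arrs (For x r c) = mod_arrs c"
  by (auto simp: For_def)

text \<open>\<open>step\<close> may use agreement with the store before the loop, so
  \<open>Inv\<close> need not repeat what the loop leaves alone. \<open>Inv (Suc i)\<close> is
  demanded after the counter update, that is, for the store seen by the next loop test.\<close>

lemma wp_For:
  assumes N: "reg s r = N" "N \<le> B"
    and x: "r \<noteq> x" "x \<notin> mod_regs c" "r \<notin> mod_regs c"
    and init: "Inv 0 (set_reg s x 0)"
    and step: "\<And>i s'. i < N \<Longrightarrow> agree (For x r c) s s' \<Longrightarrow> reg s' x = i \<Longrightarrow> Inv i s' \<Longrightarrow>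
      wp B c (\<lambda>s''. Inv (Suc i) (set_reg s'' x (Suc i))) s'"
  shows "wp B (For x r c) (Inv N) s"
proof -
  let ?b = "Less (Reg x) (Reg r)"
  let ?d = "Seq c (Assign x (Plus (Reg x) (Const 1)))"
  let ?F = "\<lambda>R s. bval ?b s \<and> wp B ?d R s"
  have *: "(?F ^^ M) (\<lambda>s. \<not> bval ?b s \<and> Inv N s) s'"
    if "agree (For x r c) s s'" "reg s' x + M = N" "Inv (reg s' x) s'" for M s'
    using that
  proof (induction M arbitrary: s')
    case 0
    have "reg s' r = N" using 0(1) N x by (simp add: agree_def)
    with 0 show ?case by simp
  next
    case (Suc M)
    have r: "reg s' r = N" using Suc.prems(1) N x by (simp add: agree_def)
    have "wp B c (\<lambda>s''. Inv (Suc (reg s' x)) (set_reg s'' x (Suc (reg s' x)))) s'"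
      by (rule step) (use Suc.prems in auto)
    then have "wp B c (wp B (Assign x (Plus (Reg x) (Const 1)))
      ((?F ^^ M) (\<lambda>s. \<not> bval ?b s \<and> Inv N s))) s'"
    proof (rule wp_agree_mono)
      fix s'' assume s'': "Inv (Suc (reg s' x)) (set_reg s'' x (Suc (reg s' x)))"
        and a: "agree c s' s''"
      have e: "reg s'' x = reg s' x" using a x by (simp add: agree_def)
      have "agree (For x r c) s (set_reg s'' x (Suc (reg s' x)))"
        using a Suc.prems(1) by (auto simp: agree_def)
      with Suc.IH[OF this] s'' Suc.prems(2) show "wp B (Assign x (Plus (Reg x) (Const 1)))
        ((?F ^^ M) (\<lambda>s. \<not> bval ?b s \<and> Inv N s)) s''" by (simp add: e)
    qed
    with r Suc.prems(2) show ?case by simp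
  qed
  have "(?F ^^ N) (\<lambda>s. \<not> bval ?b s \<and> Inv N s) (set_reg s x 0)"
    by (rule *) (use init in \<open>auto simp: agree_def\<close>)
  with N(2) show ?thesis by (auto simp: For_def)
qed

section \<open>Independence of a program from data that it does not read\<close>

text \<open>The lifting program repeats the preprocessing of the reduction, but receives additional inputs.
  Since the preprocessing does not look at them, it forms the same groups.\<close>

primrec avoids_a :: "nat set \<Rightarrow> aexp \<Rightarrow> bool" where
  "avoids_a V (Const n) \<longleftrightarrow> True"
| "avoids_a V (Reg x) \<longleftrightarrow> x \<notin> V"
| "avoids_a V (Cell a i) \<longleftrightarrow> a \<notin> V \<and> avoids_a V i"
| "avoids_a V (Plus d e) \<longleftrightarrow> avoids_a V d \<and> avoids_a V e"
| "avoids_a V (Minus d e) \<longleftrightarrow> avoids_a V d \<and> avoids_a V e"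

primrec avoids_b :: "nat set \<Rightarrow> bexp \<Rightarrow> bool" where
  "avoids_b V (Less d e) \<longleftrightarrow> avoids_a V d \<and> avoids_a V e"
| "avoids_b V (Equal d e) \<longleftrightarrow> avoids_a V d \<and> avoids_a V e"
| "avoids_b V (Not b) \<longleftrightarrow> avoids_b V b"
| "avoids_b V (And b c) \<longleftrightarrow> avoids_b V b \<and> avoids_b V c"

primrec avoids :: "nat set \<Rightarrow> com \<Rightarrow> bool" where
  "avoids V Skip \<longleftrightarrow> True"
| "avoids V (Assign x e) \<longleftrightarrow> avoids_a V e"
| "avoids V (Store a i e) \<longleftrightarrow> avoids_a V i \<and> avoids_a V e"
| "avoids V (Seq c d) \<longleftrightarrow> avoids V c \<and> avoids V d"
| "avoids V (If b c d) \<longleftrightarrow> avoids_b V b \<and> avoids V c \<and> avoids V d"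
| "avoids V (While b c) \<longleftrightarrow> avoids_b V b \<and> avoids V c"

definition eq_off :: "nat set \<Rightarrow> store \<Rightarrow> store \<Rightarrow> bool" where
  "eq_off V s u \<longleftrightarrow> (\<forall>x. x \<notin> V \<longrightarrow> reg s x = reg u x \<and> arr s x = arr u x)"

lemma eq_off_aval: "eq_off V s u \<Longrightarrow> avoids_a V e \<Longrightarrow> aval e s = aval e u"
  by (induction e) (simp_all add: eq_off_def)

lemma eq_off_bval: "eq_off V s u \<Longrightarrow> avoids_b V b \<Longrightarrow> bval b s = bval b u"
  by (induction b) (simp_all add: eq_off_aval[of V s u])

text \<open>Writing into \<open>V\<close> is permitted, only reading is not. Then all tests and
  addresses agree in both runs, hence also the control flow. The step count is preserved as well, so
  that a time bound for one run carries over to the other.\<close>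

lemma exec_eq_off:
  "exec c s t s' \<Longrightarrow> eq_off V s u \<Longrightarrow> avoids V c \<Longrightarrow> \<exists>u'. exec c u t u' \<and> eq_off V s' u'"
proof (induction arbitrary: u rule: exec.induct)
  case (Skip s)
  then show ?case using exec.Skip by blast
next
  case (Assign x e s)
  then have "eq_off V (set_reg s x (aval e s)) (set_reg u x (aval e u))"
    using eq_off_aval[of V s u e] by (simp add: eq_off_def)
  then show ?case using exec.Assign by blast
next
  case (Store a i e s)
  then have "eq_off V (s\<lparr>arr := (arr s)(a := (arr s a)(aval i s := aval e s))\<rparr>)
    (u\<lparr>arr := (arr u)(a := (arr u a)(aval i u := aval e u))\<rparr>)" if "a \<notin> V"
    using eq_off_aval[of V s u e] eq_off_aval[of V s u i] that by (simp add: eq_off_def)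
  moreover have "eq_off V (s\<lparr>arr := (arr s)(a := (arr s a)(aval i s := aval e s))\<rparr>)
    (u\<lparr>arr := (arr u)(a := (arr u a)(aval i u := aval e u))\<rparr>)" if "a \<in> V"
    using Store(1) that by (auto simp: eq_off_def)
  ultimately show ?case using exec.Store by blast
next
  case (Seq P s t s' Q r s'')
  obtain u' where "exec P u t u'" "eq_off V s' u'"
    using Seq.IH(1)[OF Seq.prems(1)] Seq.prems(2) by auto
  moreover obtain u'' where "exec Q u' r u''" "eq_off V s'' u''"
    using Seq.IH(2)[OF \<open>eq_off V s' u'\<close>] Seq.prems(2) by auto
  ultimately show ?case using exec.Seq by blast
next
  case (IfTrue b s P t s' Q)
  have "bval b u" using IfTrue.hyps IfTrue.prems eq_off_bval by simp
  moreover obtain u' where "exec P u t u'" "eq_off V s' u'"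
    using IfTrue.IH[OF IfTrue.prems(1)] IfTrue.prems(2) by auto
  ultimately show ?case using exec.IfTrue by blast
next
  case (IfFalse b s Q t s' P)
  have "\<not> bval b u" using IfFalse.hyps IfFalse.prems eq_off_bval by simp
  moreover obtain u' where "exec Q u t u'" "eq_off V s' u'"
    using IfFalse.IH[OF IfFalse.prems(1)] IfFalse.prems(2) by auto
  ultimately show ?case using exec.IfFalse by blast
next
  case (WhileFalse b s P)
  have "\<not> bval b u" using WhileFalse.hyps WhileFalse.prems eq_off_bval by simp
  then show ?case using exec.WhileFalse WhileFalse.prems(1) by blast
next
  case (WhileTrue b s P t s' r s'')
  have "bval b u" using WhileTrue.hyps WhileTrue.prems eq_off_bval by simp
  moreover obtain u' where "exec P u t u'" "eq_off V s' u'"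
    using WhileTrue.IH(1)[OF WhileTrue.prems(1)] WhileTrue.prems(2) by auto
  moreover obtain u'' where "exec (While b P) u' r u''" "eq_off V s'' u''"
    using WhileTrue.IH(2)[OF \<open>eq_off V s' u'\<close>] WhileTrue.prems(2) by auto
  ultimately show ?case using exec.WhileTrue by blast
qed

lemma avoids_For [simp]: "avoids V (For x r c) \<longleftrightarrow> x \<notin> V \<and> r \<notin> V \<and> avoids V c"
  by (auto simp: For_def)

section \<open>Averaging and ranks\<close>

text \<open>Some choice of representatives is at least as good as the average over all choices; it is found by
  fixing the representatives one by one.\<close>

lemma averaging:
  fixes f :: "'a \<Rightarrow> 'b \<Rightarrow> real" and h :: "'a \<Rightarrow> 'a \<Rightarrow> 'b \<Rightarrow> 'b \<Rightarrow> real"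
  assumes "finite J" "\<And>g. g \<in> J \<Longrightarrow> card (S g) = m" "m > 0"
    and diag: "\<And>g x y. h g g x y = 0"
  shows "\<exists>\<rho>. (\<forall>g\<in>J. \<rho> g \<in> S g) \<and>
    (real m)\<^sup>2 * ((\<Sum>g\<in>J. f g (\<rho> g)) + (\<Sum>g\<in>J. \<Sum>g'\<in>J. h g g' (\<rho> g) (\<rho> g')))
    \<le> real m * (\<Sum>g\<in>J. \<Sum>x\<in>S g. f g x) + (\<Sum>g\<in>J. \<Sum>g'\<in>J. \<Sum>x\<in>S g. \<Sum>y\<in>S g'. h g g' x y)"
  using assms(1,2)
proof (induction J arbitrary: f rule: finite_induct)
  case empty
  show ?case by simp
next
  case (insert a J)
  \<comment> \<open>\<open>\<Phi> x\<close> is \<open>m\<close> times the expected contribution of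
    \<open>a\<close> when its representative is \<open>x\<close> and the others are still random.
    Some \<open>x\<close> does not exceed the mean.\<close>
  define \<Phi> where "\<Phi> x = real m * f a x + (\<Sum>g\<in>J. \<Sum>y\<in>S g. h g a y x + h a g x y)" for x
  have Sa: "card (S a) = m" using insert.prems by simp
  have "\<exists>x\<in>S a. real m * \<Phi> x \<le> sum \<Phi> (S a)"
  proof (rule ccontr)
    assume "\<not> ?thesis"
    then have "(\<Sum>x\<in>S a. sum \<Phi> (S a)) < (\<Sum>x\<in>S a. real m * \<Phi> x)"
      using Sa \<open>m > 0\<close> by (intro sum_strict_mono) (auto simp: not_le intro: card_ge_0_finite)
    then show False by (simp add: Sa sum_distrib_left)
  qed
  then obtain x where x: "x \<in> S a" "real m * \<Phi> x \<le> sum \<Phi> (S a)" by blast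
  \<comment> \<open>Once \<open>x\<close> is fixed, the pairs involving \<open>a\<close> depend on
    one representative only and become unary costs. This is why the induction carries
    \<open>f\<close>, although the application starts from \<open>f = 0\<close>.\<close>
  define f' where "f' g y = f g y + (h g a y x + h a g x y)" for g y
  obtain \<rho> where \<rho>: "\<forall>g\<in>J. \<rho> g \<in> S g"
    "(real m)\<^sup>2 * ((\<Sum>g\<in>J. f' g (\<rho> g)) + (\<Sum>g\<in>J. \<Sum>g'\<in>J. h g g' (\<rho> g) (\<rho> g')))
    \<le> real m * (\<Sum>g\<in>J. \<Sum>x\<in>S g. f' g x) + (\<Sum>g\<in>J. \<Sum>g'\<in>J. \<Sum>x\<in>S g. \<Sum>y\<in>S g'. h g g' x y)"
    using insert.IH[of f'] insert.prems by auto
  let ?r = "\<rho>(a := x)"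
  have r: "?r g = \<rho> g" if "g \<in> J" for g using that insert.hyps by auto
  have L: "(\<Sum>g\<in>insert a J. f g (?r g)) + (\<Sum>g\<in>insert a J. \<Sum>g'\<in>insert a J. h g g' (?r g) (?r g'))
    = f a x + ((\<Sum>g\<in>J. f' g (\<rho> g)) + (\<Sum>g\<in>J. \<Sum>g'\<in>J. h g g' (\<rho> g) (\<rho> g')))"
  proof -
    have "(\<Sum>g\<in>J. F g (?r g)) = (\<Sum>g\<in>J. F g (\<rho> g))" for F :: "'a \<Rightarrow> 'b \<Rightarrow> real"
      by (intro sum.cong refl) (simp only: r)
    moreover have "(\<Sum>g\<in>J. h a g x (?r g)) = (\<Sum>g\<in>J. h a g x (\<rho> g))"
      "(\<Sum>g\<in>J. h g a (?r g) x) = (\<Sum>g\<in>J. h g a (\<rho> g) x)"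
      by (intro sum.cong refl, simp only: r)+
    moreover have "(\<Sum>g\<in>J. \<Sum>g'\<in>J. h g g' (?r g) (?r g')) = (\<Sum>g\<in>J. \<Sum>g'\<in>J. h g g' (\<rho> g) (\<rho> g'))"
      by (intro sum.cong refl) (simp only: r)
    ultimately show ?thesis
      using insert.hyps by (simp add: diag f'_def sum.distrib)
  qed
  have Phi: "sum \<Phi> (S a) = real m * (\<Sum>x\<in>S a. f a x)
      + (\<Sum>g\<in>J. \<Sum>x\<in>S a. \<Sum>y\<in>S g. h g a y x + h a g x y)"
    unfolding \<Phi>_def sum.distrib sum_distrib_left by (subst sum.swap, subst (2) sum.swap) simp
  have R: "real m * (\<Sum>g\<in>insert a J. \<Sum>x\<in>S g. f g x)
      + (\<Sum>g\<in>insert a J. \<Sum>g'\<in>insert a J. \<Sum>x\<in>S g. \<Sum>y\<in>S g'. h g g' x y)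
    = sum \<Phi> (S a) + real m * (\<Sum>g\<in>J. \<Sum>x\<in>S g. f g x)
      + (\<Sum>g\<in>J. \<Sum>g'\<in>J. \<Sum>x\<in>S g. \<Sum>y\<in>S g'. h g g' x y)"
  proof -
    have "(\<Sum>g\<in>J. \<Sum>y\<in>S g. \<Sum>x\<in>S a. h g a y x) = (\<Sum>g\<in>J. \<Sum>x\<in>S a. \<Sum>y\<in>S g. h g a y x)"
      by (intro sum.cong refl sum.swap)
    with insert.hyps show ?thesis unfolding Phi
      by (simp add: diag sum.distrib distrib_left)
  qed
  have f'S: "(\<Sum>g\<in>J. \<Sum>y\<in>S g. f' g y) = (\<Sum>g\<in>J. \<Sum>y\<in>S g. f g y)
      + (\<Phi> x - real m * f a x)"
    by (simp add: f'_def \<Phi>_def sum.distrib)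
  have "(real m)\<^sup>2 * (f a x + ((\<Sum>g\<in>J. f' g (\<rho> g)) + (\<Sum>g\<in>J. \<Sum>g'\<in>J. h g g' (\<rho> g) (\<rho> g'))))
    \<le> (real m)\<^sup>2 * f a x + (real m * (\<Sum>g\<in>J. \<Sum>x\<in>S g. f' g x)
      + (\<Sum>g\<in>J. \<Sum>g'\<in>J. \<Sum>x\<in>S g. \<Sum>y\<in>S g'. h g g' x y))"
    using \<rho>(2) by (simp add: distrib_left)
  also have "\<dots> = real m * \<Phi> x + real m * (\<Sum>g\<in>J. \<Sum>x\<in>S g. f g x)
      + (\<Sum>g\<in>J. \<Sum>g'\<in>J. \<Sum>x\<in>S g. \<Sum>y\<in>S g'. h g g' x y)"
    unfolding f'S by (simp add: power2_eq_square algebra_simps)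
  also have "\<dots> \<le> sum \<Phi> (S a) + real m * (\<Sum>g\<in>J. \<Sum>x\<in>S g. f g x)
      + (\<Sum>g\<in>J. \<Sum>g'\<in>J. \<Sum>x\<in>S g. \<Sum>y\<in>S g'. h g g' x y)"
    using x(2) by simp
  finally have "(real m)\<^sup>2 * ((\<Sum>g\<in>insert a J. f g (?r g))
      + (\<Sum>g\<in>insert a J. \<Sum>g'\<in>insert a J. h g g' (?r g) (?r g')))
    \<le> real m * (\<Sum>g\<in>insert a J. \<Sum>x\<in>S g. f g x)
      + (\<Sum>g\<in>insert a J. \<Sum>g'\<in>insert a J. \<Sum>x\<in>S g. \<Sum>y\<in>S g'. h g g' x y)"
    unfolding L R .
  moreover have "\<forall>g\<in>insert a J. ?r g \<in> S g" using \<rho>(1) x(1) by simp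
  ultimately show ?case by blast
qed

text \<open>Induction removing a point farthest from \<open>p\<close>, say at distance r. All points
  lie within r of \<open>p\<close>, where there are only 2 r integers besides \<open>p\<close>. So r
  is at least half the number of points, which pays for the growth of the square.\<close>

lemma sum_dist_ge:
  assumes "finite U" "p \<notin> U"
  shows "(real (card U))\<^sup>2 / 4 \<le> (\<Sum>x\<in>U. \<bar>real x - real p\<bar>)"
  using assms
proof (induction "card U" arbitrary: U)
  case 0
  then show ?case by simp
next
  case (Suc d)
  then have ne: "U \<noteq> {}" by auto
  let ?D = "\<lambda>x. \<bar>int x - int p\<bar>"
  obtain x where x: "x \<in> U" "\<And>y. y \<in> U \<Longrightarrow> ?D y \<le> ?D x"
  proof -
    have "finite (?D ` U)" "?D ` U \<noteq> {}" using Suc.prems(1) ne by auto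
    from Max_in[OF this] obtain x where "x \<in> U" "Max (?D ` U) = ?D x" by auto
    moreover have "?D y \<le> Max (?D ` U)" if "y \<in> U" for y
      using \<open>finite (?D ` U)\<close> that by (intro Max_ge) auto
    ultimately show ?thesis by (intro that) auto
  qed
  \<comment> \<open>Integers are used because the interval around \<open>p\<close> may reach below
    0.\<close>
  have "int ` U \<subseteq> {int p - ?D x..int p + ?D x} - {int p}"
  proof
    fix z assume "z \<in> int ` U"
    then obtain y where "z = int y" "y \<in> U" by auto
    with x(2)[of y] Suc.prems(2) show "z \<in> {int p - ?D x..int p + ?D x} - {int p}"
      by (auto simp del: of_nat_diff)
  qed
  then have "card (int ` U) \<le> card ({int p - ?D x..int p + ?D x} - {int p})"
    by (intro card_mono) auto
  also have "\<dots> = nat (2 * ?D x)" by (subst card_Diff_singleton) (auto simp: card_atLeastAtMost_int)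
  finally have c: "int (card U) \<le> 2 * ?D x" by (simp add: card_image le_nat_iff)
  then have c': "real (Suc d) \<le> 2 * \<bar>real x - real p\<bar>"
  proof -
    have "real_of_int (int (card U)) \<le> real_of_int (2 * ?D x)" using c by (simp only: of_int_le_iff)
    with Suc.hyps(2) show ?thesis by simp
  qed
  have d: "card (U - {x}) = d" using Suc.hyps(2) Suc.prems(1) x(1) by simp
  have "(real (card U))\<^sup>2 / 4 = (real d)\<^sup>2 / 4 + (2 * real d + 1) / 4"
    unfolding Suc.hyps(2)[symmetric] by (simp add: power2_eq_square field_simps)
  also have "\<dots> \<le> (real d)\<^sup>2 / 4 + \<bar>real x - real p\<bar>"
    using c' by simp
  also have "(real d)\<^sup>2 / 4 \<le> (\<Sum>x\<in>U - {x}. \<bar>real x - real p\<bar>)"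
    using Suc.hyps(1)[of "U - {x}"] d Suc.prems by simp
  also have "(\<Sum>x\<in>U - {x}. \<bar>real x - real p\<bar>) + \<bar>real x - real p\<bar> = (\<Sum>x\<in>U. \<bar>real x - real p\<bar>)"
    by (subst sum.remove[OF Suc.prems(1) x(1)]) (rule add.commute)
  finally show ?case by simp
qed

section \<open>Ranks: layouts from arbitrary keys\<close>

definition rank :: "nat \<Rightarrow> (nat \<Rightarrow> 'a::linorder) \<Rightarrow> nat \<Rightarrow> nat" where
  "rank n f x = card {y \<in> {..<n}. f y \<le> f x}"

lemma rank_mono: "f x \<le> f y \<Longrightarrow> rank n f x \<le> rank n f y"
  unfolding rank_def by (intro card_mono) auto

lemma rank_diff:
  assumes "f x \<le> f y"
  shows "rank n f y - rank n f x = card {z \<in> {..<n}. f x < f z \<and> f z \<le> f y}"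
proof -
  let ?A = "{z \<in> {..<n}. f z \<le> f x}" and ?B = "{z \<in> {..<n}. f x < f z \<and> f z \<le> f y}"
  have "{z \<in> {..<n}. f z \<le> f y} = ?A \<union> ?B"
    using assms order.trans[of _ "f x" "f y"] not_le by blast
  moreover have "card (?A \<union> ?B) = card ?A + card ?B"
    by (rule card_Un_disjoint) auto
  ultimately have "rank n f y = rank n f x + card {z \<in> {..<n}. f x < f z \<and> f z \<le> f y}"
    unfolding rank_def by (simp only:)
  then show ?thesis by simp
qed

lemma rank_dist:
  assumes "f x \<le> f y"
  shows "\<bar>real (rank n f x) - real (rank n f y)\<bar> = card {z \<in> {..<n}. f x < f z \<and> f z \<le> f y}"
  using rank_diff[OF assms, of n] rank_mono[OF assms, of n] by linarith

lemma rank_strict: "y < n \<Longrightarrow> f x < f y \<Longrightarrow> rank n f x < rank n f y"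
proof -
  assume *: "y < n" "f x < f y"
  then have "y \<in> {y \<in> {..<n}. f y \<le> f y}" "y \<notin> {y \<in> {..<n}. f y \<le> f x}"
    "{z \<in> {..<n}. f z \<le> f x} \<subseteq> {z \<in> {..<n}. f z \<le> f y}" by auto
  then have "{z \<in> {..<n}. f z \<le> f x} \<subset> {z \<in> {..<n}. f z \<le> f y}" by blast
  then show ?thesis unfolding rank_def by (intro psubset_card_mono) auto
qed

lemma rank_bij:
  assumes "inj_on f {..<n}"
  shows "bij_betw (rank n f) {..<n} {1..n}"
proof -
  have inj: "inj_on (rank n f) {..<n}"
  proof (rule inj_onI)
    fix x y assume xy: "x \<in> {..<n}" "y \<in> {..<n}" "rank n f x = rank n f y"
    then have "f x = f y"
      using rank_strict[of y n f x] rank_strict[of x n f y] linorder_less_linear[of "f x" "f y"] by auto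
    with assms xy show "x = y" by (auto dest: inj_onD)
  qed
  have "rank n f ` {..<n} \<subseteq> {1..n}"
  proof
    fix r assume "r \<in> rank n f ` {..<n}"
    then obtain x where x: "x < n" "r = rank n f x" by auto
    have "rank n f x \<le> card {..<n}" unfolding rank_def by (intro card_mono) auto
    moreover have "card {x} \<le> rank n f x" unfolding rank_def using x by (intro card_mono) auto
    ultimately show "r \<in> {1..n}" using x by simp
  qed
  moreover have "card (rank n f ` {..<n}) = card {1..n}" using inj by (simp add: card_image)
  ultimately have "rank n f ` {..<n} = {1..n}" by (intro card_subset_eq) auto
  with inj show ?thesis by (simp add: bij_betw_def)
qed

section \<open>Edges as pairs of opposite arcs\<close>

definition arcs :: "nat set set \<Rightarrow> (nat \<times> nat) set" where
  "arcs E = {(u, v). {u, v} \<in> E}"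

definition nbs :: "nat set set \<Rightarrow> nat \<Rightarrow> nat set" where
  "nbs E u = {v. {u, v} \<in> E}"

abbreviation gap :: "(nat \<Rightarrow> nat) \<Rightarrow> nat \<Rightarrow> nat \<Rightarrow> real" where
  "gap f u v \<equiv> \<bar>real (f u) - real (f v)\<bar>"

lemma simple_graphD:
  assumes "simple_graph (n, E)" "{u, v} \<in> E"
  shows "u < n" "v < n" "u \<noteq> v"
proof -
  have "{u, v} \<subseteq> {..<n}" "card {u, v} = 2" using assms by (auto simp: simple_graph_def)
  then show "u < n" "v < n" "u \<noteq> v" by auto
qed

lemma finite_arcs: "simple_graph (n, E) \<Longrightarrow> finite (arcs E)"
  by (rule finite_subset[of _ "{..<n} \<times> {..<n}"]) (auto simp: arcs_def dest: simple_graphD)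

lemma finite_nbs: "simple_graph (n, E) \<Longrightarrow> finite (nbs E u)"
  by (rule finite_subset[of _ "{..<n}"]) (auto simp: nbs_def dest: simple_graphD)

text \<open>Arcs count each edge in both directions. Unlike the pairs with \<open>u < v\<close>,
  they are preserved by maps that do not respect the numbering of the vertices, such as
  contractions.\<close>

lemma layout_val_arcs:
  assumes G: "simple_graph (n, E)"
  shows "2 * layout_val \<sigma> (n, E) = (\<Sum>(u, v)\<in>arcs E. gap ((!) \<sigma>) u v)"
proof -
  let ?A = "{(u, v). u < v \<and> {u, v} \<in> E}"
  have un: "arcs E = ?A \<union> prod.swap ` ?A"
  proof (intro set_eqI iffI)
    fix p assume "p \<in> arcs E"
    then obtain u v where p: "p = (u, v)" "{u, v} \<in> E" by (auto simp: arcs_def)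
    show "p \<in> ?A \<union> prod.swap ` ?A"
    proof (cases "u < v")
      case False
      with simple_graphD(3)[OF G p(2)] have "(v, u) \<in> ?A" using p(2) by (simp add: insert_commute)
      then have "prod.swap (v, u) \<in> prod.swap ` ?A" by (rule imageI)
      then show ?thesis by (simp add: p(1))
    qed (use p in simp)
  next
    fix p assume "p \<in> ?A \<union> prod.swap ` ?A"
    then obtain u v where "u < v" "{u, v} \<in> E" "p = (u, v) \<or> p = (v, u)" by auto
    then show "p \<in> arcs E" by (auto simp: arcs_def doubleton_eq_iff) (metis insert_commute)
  qed
  have fin: "finite ?A" by (rule finite_subset[OF _ finite_arcs[OF G]]) (auto simp: arcs_def)
  have "(\<Sum>(u, v)\<in>prod.swap ` ?A. gap ((!) \<sigma>) u v) = (\<Sum>(u, v)\<in>?A. gap ((!) \<sigma>) u v)"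
    by (subst sum.reindex) (simp_all add: case_prod_beta abs_minus_commute)
  moreover have "(\<Sum>(u, v)\<in>arcs E. gap ((!) \<sigma>) u v)
    = (\<Sum>(u, v)\<in>?A. gap ((!) \<sigma>) u v) + (\<Sum>(u, v)\<in>prod.swap ` ?A. gap ((!) \<sigma>) u v)"
    unfolding un by (rule sum.union_disjoint) (use fin in auto)
  ultimately show ?thesis by (simp add: layout_val_def)
qed

section \<open>Layouts and vertex covers\<close>

lemma arcs_cover_sum:
  fixes F :: "nat \<Rightarrow> nat \<Rightarrow> real"
  assumes G: "simple_graph (n, E)" and fin: "finite A"
  shows "(\<Sum>(u, v)\<in>{p \<in> arcs E. fst p \<in> A}. F u v) = (\<Sum>u\<in>A. \<Sum>v\<in>nbs E u. F u v)"
proof -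
  have "{p \<in> arcs E. fst p \<in> A} = Sigma A (nbs E)" by (auto simp: arcs_def nbs_def)
  then show ?thesis using fin finite_nbs[OF G] by (simp add: sum.Sigma)
qed

lemma arcs_commute: "(u, v) \<in> arcs E \<longleftrightarrow> (v, u) \<in> arcs E"
  by (simp add: arcs_def insert_commute)

lemma sum_arcs_snd:
  fixes F :: "nat \<Rightarrow> nat \<Rightarrow> real"
  assumes sym: "\<And>u v. F u v = F v u"
  shows "(\<Sum>(u, v)\<in>{p \<in> arcs E. P (snd p)}. F u v) = (\<Sum>(u, v)\<in>{p \<in> arcs E. P (fst p)}. F u v)"
  by (rule sum.reindex_bij_witness[of _ prod.swap prod.swap])
    (auto simp: sym arcs_commute case_prod_beta)

text \<open>Every edge has one or two ends in a vertex cover \<open>C\<close>, so that the sum over the arcs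
  leaving \<open>C\<close> is the layout value up to a factor of 2.\<close>

definition cover_val :: "nat set set \<Rightarrow> nat set \<Rightarrow> (nat \<Rightarrow> nat) \<Rightarrow> real" where
  "cover_val E C f = (\<Sum>c\<in>C. \<Sum>u\<in>nbs E c. gap f c u)"

definition cover_deg :: "nat set set \<Rightarrow> nat set \<Rightarrow> nat" where
  "cover_deg E C = (\<Sum>c\<in>C. card (nbs E c))"

text \<open>Isolated vertices are excluded: they are incident with no edge, so no lower bound on the
  value can involve their number.\<close>

definition outer :: "nat \<Rightarrow> nat set set \<Rightarrow> nat set \<Rightarrow> nat set" where
  "outer n E C = {v. v < n \<and> v \<notin> C \<and> v \<in> \<Union>E}"

context
  fixes n :: nat and E :: "nat set set" and C :: "nat set"
  assumes G: "simple_graph (n, E)" and cover: "vertex_cover (n, E) C"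
begin

lemma finite_cover: "finite C"
  using cover by (auto simp: vertex_cover_def intro: finite_subset)

lemma edge_cover: "{u, v} \<in> E \<Longrightarrow> u \<in> C \<or> v \<in> C"
  using cover by (force simp: vertex_cover_def)

lemma edge_ends: "{u, v} \<in> E \<Longrightarrow> u \<in> C \<union> outer n E C"
  using simple_graphD[OF G] by (auto simp: outer_def)

lemma outer_edge:
  assumes "u \<in> outer n E C" obtains v where "{u, v} \<in> E" "v \<in> C"
proof -
  obtain e where e: "e \<in> E" "u \<in> e" using assms by (auto simp: outer_def)
  then obtain x y where "e = {x, y}" using G by (auto simp: simple_graph_def card_2_iff)
  then obtain v where "e = {u, v}" using e(2) by auto
  with e edge_cover[of u v] assms show thesis by (intro that[of v]) (auto simp: outer_def)
qed

lemma nbs_outer: "u \<in> outer n E C \<Longrightarrow> nbs E u \<subseteq> C"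
  using edge_cover by (auto simp: nbs_def outer_def)

lemma finite_outer [simp]: "finite (outer n E C)"
  by (auto simp: outer_def)

lemma layout_val_le_cover_val: "layout_val \<sigma> (n, E) \<le> cover_val E C ((!) \<sigma>)"
proof -
  let ?F = "\<lambda>p. case p of (u, v) \<Rightarrow> gap ((!) \<sigma>) u v"
  have "2 * layout_val \<sigma> (n, E) = sum ?F (arcs E)" by (rule layout_val_arcs[OF G])
  also have "\<dots> \<le> sum ?F ({p \<in> arcs E. fst p \<in> C} \<union> {p \<in> arcs E. snd p \<in> C})"
    by (intro sum_mono2) (auto simp: finite_arcs[OF G], auto simp: arcs_def dest: edge_cover)
  also have "\<dots> \<le> sum ?F {p \<in> arcs E. fst p \<in> C} + sum ?F {p \<in> arcs E. snd p \<in> C}"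
    using finite_arcs[OF G] by (subst sum.union_inter[symmetric]) (auto intro!: sum_nonneg)
  also have "sum ?F {p \<in> arcs E. snd p \<in> C} = sum ?F {p \<in> arcs E. fst p \<in> C}"
    by (rule sum_arcs_snd) simp
  also have "sum ?F {p \<in> arcs E. fst p \<in> C} = cover_val E C ((!) \<sigma>)"
    unfolding cover_val_def by (rule arcs_cover_sum[OF G finite_cover])
  finally show ?thesis by simp
qed

lemma cover_val_le_layout_val: "cover_val E C ((!) \<sigma>) \<le> 2 * layout_val \<sigma> (n, E)"
proof -
  have "cover_val E C ((!) \<sigma>) = (\<Sum>(u, v)\<in>{p \<in> arcs E. fst p \<in> C}. gap ((!) \<sigma>) u v)"
    unfolding cover_val_def by (rule arcs_cover_sum[OF G finite_cover, symmetric])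
  also have "\<dots> \<le> (\<Sum>(u, v)\<in>arcs E. gap ((!) \<sigma>) u v)"
    using finite_arcs[OF G] by (intro sum_mono2) auto
  finally show ?thesis by (simp add: layout_val_arcs[OF G])
qed

text \<open>No edge has both ends outside \<open>C\<close>, so the arcs leaving and the arcs
  entering \<open>outer n E C\<close> are disjoint and together give twice the left-hand side. Hence
  no factor 2 is lost.\<close>

lemma outer_sum_le:
  "(\<Sum>u\<in>outer n E C. \<Sum>c\<in>nbs E u. gap ((!) \<sigma>) u c) \<le> layout_val \<sigma> (n, E)"
proof -
  let ?F = "\<lambda>p. case p of (u, v) \<Rightarrow> gap ((!) \<sigma>) u v"
  let ?A = "\<lambda>f. {p \<in> arcs E. f p \<in> outer n E C}"
  have "sum ?F (?A fst) + sum ?F (?A snd) = sum ?F (?A fst \<union> ?A snd)"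
    by (intro sum.union_disjoint[symmetric])
      (auto simp: finite_arcs[OF G], auto simp: arcs_def outer_def dest: edge_cover)
  also have "\<dots> \<le> sum ?F (arcs E)"
    using finite_arcs[OF G] by (intro sum_mono2) auto
  also have "\<dots> = 2 * layout_val \<sigma> (n, E)" by (rule layout_val_arcs[OF G, symmetric])
  also have "sum ?F (?A snd) = sum ?F (?A fst)" by (rule sum_arcs_snd) simp
  also have "sum ?F (?A fst) = (\<Sum>u\<in>outer n E C. \<Sum>c\<in>nbs E u. gap ((!) \<sigma>) u c)"
    by (rule arcs_cover_sum[OF G]) simp
  finally show ?thesis by simp
qed

lemma card_outer_le: "card (outer n E C) \<le> cover_deg E C"
proof -
  have "outer n E C \<subseteq> (\<Union>c\<in>C. nbs E c)"
    by (auto elim!: outer_edge simp: nbs_def insert_commute)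
  then have "card (outer n E C) \<le> card (\<Union>c\<in>C. nbs E c)"
    using finite_cover finite_nbs[OF G] by (intro card_mono) auto
  also have "\<dots> \<le> cover_deg E C"
    unfolding cover_deg_def by (rule card_UN_le[OF finite_cover])
  finally show ?thesis .
qed

text \<open>By \<open>sum_dist_ge\<close>, every cover vertex pays a quarter of its squared degree.
  The constant 8 is this 4 times the 2 of \<open>cover_val_le_layout_val\<close>; the factor
  \<open>card C\<close> is due to Cauchy-Schwarz.\<close>

lemma layout_val_ge:
  assumes "linear_layout (n, E) \<sigma>"
  shows "(real (cover_deg E C))\<^sup>2 \<le> 8 * real (card C) * layout_val \<sigma> (n, E)"
proof -
  have inj: "inj_on ((!) \<sigma>) {..<n}" using assms by (auto simp: linear_layout_def bij_betw_def)
  have "(\<Sum>c\<in>C. (real (card (nbs E c)))\<^sup>2 / 4) \<le> cover_val E C ((!) \<sigma>)"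
    unfolding cover_val_def
  proof (rule sum_mono)
    fix c assume "c \<in> C"
    have sub: "nbs E c \<subseteq> {..<n}" using simple_graphD[OF G] by (auto simp: nbs_def)
    have cn: "c < n" if "nbs E c \<noteq> {}" using simple_graphD[OF G] that by (auto simp: nbs_def)
    have inj': "inj_on ((!) \<sigma>) (nbs E c)" using inj sub by (rule inj_on_subset)
    have "\<sigma> ! c \<notin> (!) \<sigma> ` nbs E c"
    proof
      assume "\<sigma> ! c \<in> (!) \<sigma> ` nbs E c"
      then obtain u where u: "u \<in> nbs E c" "\<sigma> ! c = \<sigma> ! u" by auto
      then have "c = u" using inj cn sub by (auto dest: inj_onD)
      with u(1) simple_graphD(3)[OF G, of c u] show False by (simp add: nbs_def)
    qed
    from sum_dist_ge[OF _ this] show "(real (card (nbs E c)))\<^sup>2 / 4 \<le> (\<Sum>u\<in>nbs E c. gap ((!) \<sigma>) c u)"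
      using finite_nbs[OF G, of c] inj' by (simp add: card_image sum.reindex abs_minus_commute)
  qed
  also have "\<dots> \<le> 2 * layout_val \<sigma> (n, E)" by (rule cover_val_le_layout_val)
  finally have *: "(\<Sum>c\<in>C. (real (card (nbs E c)))\<^sup>2) \<le> 8 * layout_val \<sigma> (n, E)"
    by (simp add: sum_divide_distrib[symmetric])
  have "(real (cover_deg E C))\<^sup>2 = (\<Sum>c\<in>C. real (card (nbs E c)))\<^sup>2" by (simp add: cover_deg_def)
  also have "\<dots> \<le> (\<Sum>c\<in>C. (real (card (nbs E c)))\<^sup>2) * real (card C)"
    by (rule sum_squared_le_sum_of_squares)
  also have "\<dots> \<le> (8 * layout_val \<sigma> (n, E)) * real (card C)"
    by (rule mult_right_mono[OF *]) simp
  finally show ?thesis by (simp add: mult_ac)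
qed

text \<open>All edges live on the first \<open>card C + cover_deg E C\<close> positions, so each of
  the \<open>cover_deg E C\<close> arcs leaving \<open>C\<close> is at most that long. If both
  numbers are positive, the total is at most \<open>2 * card C * (cover_deg E C)\<^sup>2\<close>,
  and \<open>layout_val_ge\<close> turns the 2 into 16 = 2 * 8.\<close>

lemma layout_val_le:
  assumes \<sigma>: "linear_layout (n, E) \<sigma>"
    and first: "\<And>u. u \<in> C \<union> outer n E C \<Longrightarrow> \<sigma> ! u \<le> card (C \<union> outer n E C)"
    and \<tau>: "linear_layout (n, E) \<tau>"
  shows "layout_val \<sigma> (n, E) \<le> 16 * (real (card C))\<^sup>2 * layout_val \<tau> (n, E)"
proof (cases "cover_deg E C = 0")
  case True
  have "cover_val E C ((!) \<sigma>) = 0"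
    using True finite_cover finite_nbs[OF G] by (simp add: cover_val_def cover_deg_def)
  moreover have "0 \<le> layout_val \<tau> (n, E)"
    unfolding layout_val_def by (auto intro!: sum_nonneg)
  ultimately show ?thesis
    by (intro order.trans[OF layout_val_le_cover_val]) simp
next
  case False
  let ?D = "real (cover_deg E C)" and ?k = "real (card C)"
  have D1: "1 \<le> ?D" using False by linarith
  have k1: "1 \<le> ?k" using False finite_cover by (auto simp: cover_deg_def Suc_le_eq card_gt_0_iff)
  have "card (C \<union> outer n E C) \<le> card C + cover_deg E C"
    using card_Un_le[of C "outer n E C"] card_outer_le by linarith
  then have le: "real (card (C \<union> outer n E C)) \<le> ?k + ?D" by linarith
  have "cover_val E C ((!) \<sigma>) \<le> (\<Sum>c\<in>C. \<Sum>u\<in>nbs E c. ?k + ?D)"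
    unfolding cover_val_def
  proof (intro sum_mono)
    fix c u assume "c \<in> C" "u \<in> nbs E c"
    then have "c \<in> C \<union> outer n E C" "u \<in> C \<union> outer n E C"
      using edge_ends[of u c] by (simp_all add: nbs_def insert_commute)
    then have "\<sigma> ! c \<le> card (C \<union> outer n E C)" "\<sigma> ! u \<le> card (C \<union> outer n E C)"
      by (simp_all only: first)
    with le show "gap ((!) \<sigma>) c u \<le> ?k + ?D" by linarith
  qed
  also have "\<dots> = ?D * (?k + ?D)" by (simp add: cover_deg_def sum_distrib_right)
  also have "\<dots> \<le> ?D * (?k * ?D + ?k * ?D)"
  proof (intro mult_left_mono add_mono)
    show "?k \<le> ?k * ?D" using mult_left_mono[OF D1, of ?k] by simp
    show "?D \<le> ?k * ?D" using mult_right_mono[OF k1, of ?D] by simp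
  qed simp
  also have "\<dots> = 2 * ?k * ?D\<^sup>2" by (simp add: power2_eq_square)
  also have "\<dots> \<le> 2 * ?k * (8 * ?k * layout_val \<tau> (n, E))"
    by (rule mult_left_mono[OF layout_val_ge[OF \<tau>]]) simp
  also have "\<dots> = 16 * ?k\<^sup>2 * layout_val \<tau> (n, E)" by (simp add: power2_eq_square)
  finally show ?thesis by (rule order.trans[OF layout_val_le_cover_val])
qed

end

section \<open>Contracting groups of twins\<close>

lemma linear_layout_rank:
  assumes "inj_on f {..<n}"
  shows "linear_layout (n, E) (map (rank n f) [0..<n])"
proof -
  have "bij_betw (\<lambda>v. map (rank n f) [0..<n] ! v) {..<n} {1..n}
    \<longleftrightarrow> bij_betw (rank n f) {..<n} {1..n}"
    by (rule bij_betw_cong) simp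
  with rank_bij[OF assms] show ?thesis by (simp add: linear_layout_def)
qed

text \<open>\<open>a * n + u\<close> with \<open>u < n\<close> encodes the pair
  \<open>(a, u)\<close> lexicographically. It serves for keys with ties broken by the vertex number,
  and for row-major addresses.\<close>

lemma lex_index_le:
  fixes a b n u v :: nat
  assumes "u < n" "v < n"
  shows "a * n + u < b * n + v \<longleftrightarrow> a < b \<or> a = b \<and> u < v"
proof -
  have "a * n + u < b * n + v" if "a < b" "u < n" for a b u v
  proof -
    have "a * n + u < Suc a * n" using that(2) by simp
    also have "\<dots> \<le> b * n" using that(1) by (intro mult_le_mono1) simp
    finally show ?thesis by simp
  qed
  from this[of a b u v] this[of b a v u] assms show ?thesis
    by (cases a b rule: linorder_cases) auto
qed

lemma inj_lex_index: "inj_on (\<lambda>u. key u * n + u) {..<n :: nat}"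
proof (rule inj_onI)
  fix u v assume "u \<in> {..<n}" "v \<in> {..<n}" "key u * n + u = key v * n + v"
  then show "u = v"
    using lex_index_le[of u n v "key u" "key v"] lex_index_le[of v n u "key v" "key u"]
    by (metis lessThan_iff linorder_neqE_nat nat_less_le)
qed

text \<open>Stated without reference to a program, which separates the combinatorics from the
  verification. The cover comes first, as singleton groups, so that its image is
  \<open>{..<card C}\<close>; the groups of twins follow. \<open>g\<close> is constrained on
  \<open>C\<close> and \<open>outer n E C\<close> only.\<close>

locale grouping =
  fixes n :: nat and E :: "nat set set" and C :: "nat set" and m N :: nat
    and rep g :: "nat \<Rightarrow> nat"
  assumes G: "simple_graph (n, E)" and cover: "vertex_cover (n, E) C"
    and m_pos: "0 < m" and k_le: "card C \<le> N"
    and rep_bij: "bij_betw rep {..<card C} C"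
    and g_C: "\<And>j. j < card C \<Longrightarrow> g (rep j) = j"
    and g_outer: "\<And>u. u \<in> outer n E C \<Longrightarrow> card C \<le> g u \<and> g u < N \<and> nbs E (rep (g u)) = nbs E u"
    and rep_outer: "\<And>h. card C \<le> h \<Longrightarrow> h < N \<Longrightarrow> rep h \<in> outer n E C \<and> g (rep h) = h"
    and size_le: "\<And>h. card C \<le> h \<Longrightarrow> h < N \<Longrightarrow> card {u \<in> outer n E C. g u = h} \<le> m"
    and nonfull: "\<And>h h'. card C \<le> h \<Longrightarrow> h < N \<Longrightarrow> card C \<le> h' \<Longrightarrow> h' < N \<Longrightarrow>
      card {u \<in> outer n E C. g u = h} < m \<Longrightarrow> card {u \<in> outer n E C. g u = h'} < m \<Longrightarrow>
      nbs E (rep h) = nbs E (rep h') \<Longrightarrow> h = h'"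
begin

definition "placed = C \<union> outer n E C"

definition "grp h = {u \<in> placed. g u = h}"

definition "E' = {{h, h'} | h h'. h < N \<and> h' < N \<and> {rep h, rep h'} \<in> E}"

lemma finite_C: "finite C"
  by (rule finite_cover[OF G cover])

lemma placed_less: "u \<in> placed \<Longrightarrow> u < n"
  using cover by (auto simp: placed_def outer_def vertex_cover_def)

lemma edge'_iff: "{h, h'} \<in> E' \<longleftrightarrow> h < N \<and> h' < N \<and> {rep h, rep h'} \<in> E"
  by (auto simp: E'_def doubleton_eq_iff insert_commute)

lemma rep_C: "h < card C \<Longrightarrow> rep h \<in> C"
  using rep_bij by (auto simp: bij_betw_def)

lemma g_cover: assumes "c \<in> C" shows "g c < card C" "rep (g c) = c"
proof -
  obtain j where "j < card C" "c = rep j" using assms rep_bij by (auto simp: bij_betw_def)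
  then show "g c < card C" "rep (g c) = c" by (simp_all add: g_C)
qed

lemma g_less: "u \<in> placed \<Longrightarrow> g u < N"
  using g_cover(1)[of u] g_outer[of u] k_le by (auto simp: placed_def)

lemma g_less_k: "u \<in> placed \<Longrightarrow> g u < card C \<longleftrightarrow> u \<in> C"
  using g_cover(1)[of u] g_outer[of u] by (auto simp: placed_def)

lemma rep_placed: "h < N \<Longrightarrow> rep h \<in> placed"
  using rep_C[of h] rep_outer[of h] by (cases "h < card C") (auto simp: placed_def)

lemma g_rep: "h < N \<Longrightarrow> g (rep h) = h"
  using g_C[of h] rep_outer[of h] by (cases "h < card C") auto

lemma nbs_rep: "u \<in> placed \<Longrightarrow> nbs E (rep (g u)) = nbs E u"
  using g_cover(2)[of u] g_outer[of u] by (auto simp: placed_def)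

lemma rep_C_iff: "h < N \<Longrightarrow> rep h \<in> C \<longleftrightarrow> h < card C"
  using g_less_k[OF rep_placed, of h] g_rep[of h] by simp

text \<open>The ends are replaced by their representatives one after the other: a twin has the same
  neighbours, and adjacency is symmetric. So \<open>E'\<close> does not depend on the choice of
  representatives.\<close>

lemma edge_g:
  assumes "u \<in> placed" "v \<in> placed"
  shows "{g u, g v} \<in> E' \<longleftrightarrow> {u, v} \<in> E"
proof -
  have "{g u, g v} \<in> E' \<longleftrightarrow> rep (g v) \<in> nbs E (rep (g u))"
    using assms g_less by (simp add: edge'_iff nbs_def)
  also have "\<dots> \<longleftrightarrow> u \<in> nbs E (rep (g v))"
    unfolding nbs_rep[OF assms(1)] by (simp add: nbs_def insert_commute)
  also have "\<dots> \<longleftrightarrow> {u, v} \<in> E"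
    unfolding nbs_rep[OF assms(2)] by (simp add: nbs_def insert_commute)
  finally show ?thesis .
qed

lemma edge_placed: "{u, v} \<in> E \<Longrightarrow> u \<in> placed"
  unfolding placed_def by (rule edge_ends[OF G cover])

lemma edge_placed2: "{u, v} \<in> E \<Longrightarrow> v \<in> placed"
  using edge_placed[of v u] by (simp add: insert_commute)

lemma inj_rep: "inj_on rep {..<N}"
  by (rule inj_on_inverseI[of _ g]) (simp add: g_rep)

lemma rep_in_grp: "h < N \<Longrightarrow> rep h \<in> grp h"
  by (simp add: grp_def rep_placed g_rep)

lemma grp_C: "h < card C \<Longrightarrow> grp h = {rep h}"
  using g_less_k g_cover(2) rep_in_grp[of h] k_le by (auto simp: grp_def)

lemma grp_outer: "card C \<le> h \<Longrightarrow> grp h = {u \<in> outer n E C. g u = h}"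
  using g_cover(1) by (fastforce simp: grp_def placed_def)

lemma finite_placed: "finite placed"
  by (rule finite_subset[of _ "{..<n}"]) (auto dest: placed_less)

lemma finite_grp: "finite (grp h)"
  by (simp add: grp_def finite_placed)

lemma card_grp_le: "h < N \<Longrightarrow> card (grp h) \<le> m"
  using grp_C[of h] grp_outer[of h] size_le[of h] m_pos by (cases "h < card C") auto

lemma simple_graph': "simple_graph (N, E')"
proof -
  have "e \<subseteq> {..<N} \<and> card e = 2" if e: "e \<in> E'" for e
  proof -
    from e obtain h h' where h: "e = {h, h'}" "h < N" "h' < N" "{rep h, rep h'} \<in> E"
      by (auto simp: E'_def)
    then have "h \<noteq> h'" using simple_graphD(3)[OF G h(4)] by auto
    with h show ?thesis by simp
  qed
  then show ?thesis by (simp add: simple_graph_def)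
qed

lemma edge'_C: assumes "{h, h'} \<in> E'" shows "h < card C \<or> h' < card C"
proof -
  have "h < N" "h' < N" "{rep h, rep h'} \<in> E" using assms by (simp_all add: edge'_iff)
  with edge_cover[OF G cover this(3)] show ?thesis by (simp add: rep_C_iff)
qed

lemma vertex_cover': "vertex_cover (N, E') {..<card C}"
proof -
  have "e \<inter> {..<card C} \<noteq> {}" if e: "e \<in> E'" for e
  proof -
    from e obtain h h' where h: "e = {h, h'}" by (auto simp: E'_def)
    with e edge'_C[of h h'] show ?thesis by auto
  qed
  then show ?thesis using k_le by (auto simp: vertex_cover_def)
qed

section \<open>Lifting a layout of the contracted graph\<close>

definition "lift_pos \<sigma> u = (if u \<in> placed then \<sigma> ! g u else Suc N) * n + u" for \<sigma> :: "nat list"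

text \<open>Groups follow each other in the order of \<open>\<sigma>\<close>, each as a block.
  Positions in a layout do not exceed \<open>N\<close>, so isolated vertices come last. The result
  is a layout for every word \<open>\<sigma>\<close>.\<close>

definition "lift \<sigma> = map (rank n (lift_pos \<sigma>)) [0..<n]"

lemma inj_lift_pos: "inj_on (lift_pos \<sigma>) {..<n}"
  unfolding lift_pos_def[abs_def] by (rule inj_lex_index)

lemma linear_layout_lift: "linear_layout (n, E) (lift \<sigma>)"
  unfolding lift_def by (rule linear_layout_rank[OF inj_lift_pos])

lemma lift_nth: "u < n \<Longrightarrow> lift \<sigma> ! u = rank n (lift_pos \<sigma>) u"
  by (simp add: lift_def)

text \<open>Between the ends of an edge, each intermediate position of the small layout is blown up to
  at most \<open>m\<close> positions; since one of the ends is not blown up at all, the distance grows by a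
  factor of at most \<open>m\<close>.\<close>

lemma lift_gap1:
  assumes \<sigma>: "linear_layout (N, E') \<sigma>" and uv: "{u, v} \<in> E" and lt: "\<sigma> ! g u < \<sigma> ! g v"
  shows "gap ((!) (lift \<sigma>)) u v \<le> real m * gap ((!) \<sigma>) (g u) (g v)"
proof -
  have pl: "u \<in> placed" "v \<in> placed" using uv edge_placed edge_placed2 by blast+
  have n: "u < n" "v < n" using pl placed_less by blast+
  have inj: "inj_on ((!) \<sigma>) {..<N}" and im: "(!) \<sigma> ` {..<N} = {1..N}"
    using \<sigma> by (auto simp: linear_layout_def bij_betw_def)
  let ?f = "lift_pos \<sigma>"
  have f: "?f u < ?f v" using lt pl lex_index_le[OF n] by (simp add: lift_pos_def)
  define H where "H = {h. h < N \<and> \<sigma> ! g u < \<sigma> ! h \<and> \<sigma> ! h < \<sigma> ! g v}"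
  have vN: "\<sigma> ! g v \<le> N" using im g_less[OF pl(2)] by fastforce
  \<comment> \<open>The rank distance counts the vertices after \<open>u\<close> up to and including
    \<open>v\<close>. Their groups are those of the two ends and those placed strictly
    between.\<close>
  have sub: "{z \<in> {..<n}. ?f u < ?f z \<and> ?f z \<le> ?f v}
    \<subseteq> (grp (g u) - {u}) \<union> grp (g v) \<union> (\<Union>h\<in>H. grp h)"
  proof
    fix z assume "z \<in> {z \<in> {..<n}. ?f u < ?f z \<and> ?f z \<le> ?f v}"
    then have z: "z < n" "?f u < ?f z" "\<not> ?f v < ?f z" by auto
    define key where "key w = (if w \<in> placed then \<sigma> ! g w else Suc N)" for w
    have "key v = key z \<or> key z < key v" "key u = key z \<or> key u < key z" "z \<noteq> u"
      using z lex_index_le[OF n(1) z(1), of "key u" "key z"] lex_index_le[OF n(2) z(1), of "key v" "key z"]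
      by (auto simp: lift_pos_def key_def[symmetric])
    then have kz: "\<sigma> ! g u \<le> key z" "key z \<le> \<sigma> ! g v" "z \<noteq> u" using pl by (auto simp: key_def)
    have zp: "z \<in> placed" using kz(2) vN by (auto simp: key_def split: if_splits)
    with kz have b: "\<sigma> ! g u \<le> \<sigma> ! g z" "\<sigma> ! g z \<le> \<sigma> ! g v" by (simp_all add: key_def)
    have e: "g w = g z" if "\<sigma> ! g w = \<sigma> ! g z" "w \<in> placed" for w
      using inj_onD[OF inj that(1)] g_less zp that(2) by simp
    have zg: "z \<in> grp (g z)" using zp by (simp add: grp_def)
    consider "\<sigma> ! g u = \<sigma> ! g z" | "\<sigma> ! g v = \<sigma> ! g z" | "g z \<in> H"
      using b g_less[OF zp] unfolding H_def by force
    then show "z \<in> (grp (g u) - {u}) \<union> grp (g v) \<union> (\<Union>h\<in>H. grp h)"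
    proof cases
      case 1 with e[OF _ pl(1)] zg kz(3) show ?thesis by simp
    next
      case 2 with e[OF _ pl(2)] zg show ?thesis by simp
    next
      case 3 with zg show ?thesis by blast
    qed
  qed
  have finH: "finite H" by (simp add: H_def)
  have "card H = card ((!) \<sigma> ` H)"
    by (rule card_image[symmetric], rule inj_on_subset[OF inj]) (auto simp: H_def)
  also have "\<dots> \<le> card {\<sigma> ! g u<..<\<sigma> ! g v}" by (intro card_mono) (auto simp: H_def)
  finally have cH: "Suc (card H) \<le> \<sigma> ! g v - \<sigma> ! g u" using lt by simp
  have "card (\<Union>h\<in>H. grp h) \<le> (\<Sum>h\<in>H. card (grp h))" by (rule card_UN_le[OF finH])
  also have "\<dots> \<le> (\<Sum>h\<in>H. m)" by (intro sum_mono card_grp_le) (simp add: H_def)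
  finally have U: "card (\<Union>h\<in>H. grp h) \<le> m * card H" by (simp add: mult.commute)
  have gu: "u \<in> grp (g u)" using pl by (simp add: grp_def)
  \<comment> \<open>One end is in the cover and is its own group. Leaving out \<open>u\<close>
    matters: otherwise the two end groups could contribute \<open>m + 1\<close>.\<close>
  have ends: "card (grp (g u) - {u}) + card (grp (g v)) \<le> m"
  proof (cases "g u < card C")
    case True
    then have "grp (g u) - {u} = {}" using grp_C[OF True] gu by auto
    then have "card (grp (g u) - {u}) = 0" by (simp only: card.empty)
    then show ?thesis using card_grp_le[OF g_less[OF pl(2)]] by linarith
  next
    case False
    have "{g u, g v} \<in> E'" using edge_g[OF pl] uv by simp
    with edge'_C False have "g v < card C" by blast
    then have "card (grp (g v)) = 1" by (simp add: grp_C)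
    moreover have "Suc (card (grp (g u) - {u})) = card (grp (g u))"
      using gu finite_grp by (rule card_Suc_Diff1[rotated])
    ultimately show ?thesis using card_grp_le[OF g_less[OF pl(1)]] by simp
  qed
  have "card {z \<in> {..<n}. ?f u < ?f z \<and> ?f z \<le> ?f v}
    \<le> card ((grp (g u) - {u}) \<union> grp (g v) \<union> (\<Union>h\<in>H. grp h))"
    by (rule card_mono[OF _ sub]) (simp add: finite_grp finH)
  also have "\<dots> \<le> card (grp (g u) - {u}) + card (grp (g v)) + card (\<Union>h\<in>H. grp h)"
    by (intro order.trans[OF card_Un_le] add_mono) simp_all
  also have "\<dots> \<le> m * Suc (card H)" using ends U by simp
  also have "\<dots> \<le> m * (\<sigma> ! g v - \<sigma> ! g u)" using cH by (rule mult_le_mono2)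
  finally have "gap ((!) (lift \<sigma>)) u v \<le> real (m * (\<sigma> ! g v - \<sigma> ! g u))"
    using rank_dist[of ?f u v n] f by (simp only: lift_nth n less_imp_le of_nat_le_iff)
  with lt show ?thesis by (simp add: abs_if)
qed

lemma lift_gap:
  assumes \<sigma>: "linear_layout (N, E') \<sigma>" and uv: "{u, v} \<in> E"
  shows "gap ((!) (lift \<sigma>)) u v \<le> real m * gap ((!) \<sigma>) (g u) (g v)"
proof -
  have "{g u, g v} \<in> E'" using edge_g edge_placed[OF uv] edge_placed2[OF uv] uv by simp
  from simple_graphD[OF simple_graph' this] have "\<sigma> ! g u \<noteq> \<sigma> ! g v"
    using \<sigma> by (auto simp: linear_layout_def bij_betw_def dest: inj_onD)
  then consider "\<sigma> ! g u < \<sigma> ! g v" | "\<sigma> ! g v < \<sigma> ! g u" by linarith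
  then show ?thesis
  proof cases
    case 1 then show ?thesis by (rule lift_gap1[OF \<sigma> uv])
  next
    case 2
    have "{v, u} \<in> E" using uv by (simp add: insert_commute)
    from lift_gap1[OF \<sigma> this 2] show ?thesis by (simp only: abs_minus_commute)
  qed
qed

text \<open>One factor \<open>m\<close> is the stretch of a single edge. The other is the number of
  edges over one contracted edge, which is at most \<open>m\<close> because one of its end groups is
  a singleton of the cover.\<close>

lemma layout_val_lift:
  assumes \<sigma>: "linear_layout (N, E') \<sigma>"
  shows "layout_val (lift \<sigma>) (n, E) \<le> (real m)\<^sup>2 * layout_val \<sigma> (N, E')"
proof -
  let ?T = "\<lambda>q. {p \<in> arcs E. map_prod g g p = q}"
  let ?d = "\<lambda>(h, h'). gap ((!) \<sigma>) h h'"
  have finE: "finite (arcs E)" and finE': "finite (arcs E')"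
    using finite_arcs G simple_graph' by blast+
  have "2 * layout_val (lift \<sigma>) (n, E) = (\<Sum>(u, v)\<in>arcs E. gap ((!) (lift \<sigma>)) u v)"
    by (rule layout_val_arcs[OF G])
  also have "\<dots> \<le> (\<Sum>p\<in>arcs E. real m * ?d (map_prod g g p))"
  proof (rule sum_mono)
    fix p assume "p \<in> arcs E"
    then show "(case p of (u, v) \<Rightarrow> gap ((!) (lift \<sigma>)) u v) \<le> real m * ?d (map_prod g g p)"
      using lift_gap[OF \<sigma>] by (cases p) (simp add: arcs_def)
  qed
  also have "\<dots> = (\<Sum>q\<in>arcs E'. \<Sum>p\<in>?T q. real m * ?d (map_prod g g p))"
  proof (rule sum.group[symmetric, OF finE finE'])
    show "map_prod g g ` arcs E \<subseteq> arcs E'"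
      using edge_g edge_placed edge_placed2 by (auto simp: arcs_def)
  qed
  also have "\<dots> \<le> (\<Sum>q\<in>arcs E'. real m * (real m * ?d q))"
  proof (rule sum_mono)
    fix q assume q: "q \<in> arcs E'"
    obtain h h' where hh: "q = (h, h')" by (cases q)
    have e: "{h, h'} \<in> E'" using q hh by (simp add: arcs_def)
    then have N: "h < N" "h' < N" by (simp_all add: edge'_iff)
    have "?T q \<subseteq> grp h \<times> grp h'"
      using edge_placed edge_placed2 by (auto simp: hh grp_def arcs_def)
    then have "card (?T q) \<le> card (grp h \<times> grp h')"
      by (intro card_mono) (simp_all add: finite_grp)
    also have "\<dots> \<le> m"
      using edge'_C[OF e] grp_C[of h] grp_C[of h'] card_grp_le[OF N(1)] card_grp_le[OF N(2)]
      by (auto simp: card_cartesian_product)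
    finally have c: "card (?T q) \<le> m" .
    have "(\<Sum>p\<in>?T q. real m * ?d (map_prod g g p)) = (\<Sum>p\<in>?T q. real m * ?d q)"
      by (intro sum.cong) simp_all
    also have "\<dots> = real (card (?T q)) * (real m * ?d q)" by simp
    also have "\<dots> \<le> real m * (real m * ?d q)"
      using c by (intro mult_right_mono) (auto simp: hh)
    finally show "(\<Sum>p\<in>?T q. real m * ?d (map_prod g g p)) \<le> real m * (real m * ?d q)" .
  qed
  also have "\<dots> = (real m)\<^sup>2 * (\<Sum>q\<in>arcs E'. ?d q)"
    by (simp add: sum_distrib_left power2_eq_square mult.assoc)
  also have "(\<Sum>q\<in>arcs E'. ?d q) = 2 * layout_val \<sigma> (N, E')"
    by (rule layout_val_arcs[OF simple_graph', symmetric])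
  finally show ?thesis by simp
qed

end

section \<open>Layouts of the contracted graph from layouts of the original graph\<close>

lemma layout_val_cong:
  assumes "simple_graph (N, E)" "\<And>h. h < N \<Longrightarrow> \<sigma> ! h = r h"
  shows "2 * layout_val \<sigma> (N, E) = (\<Sum>(h, h')\<in>arcs E. gap r h h')"
  unfolding layout_val_arcs[OF assms(1)]
proof (rule sum.cong)
  fix p assume "p \<in> arcs E"
  then obtain h h' where "p = (h, h')" "{h, h'} \<in> E" by (auto simp: arcs_def)
  with simple_graphD[OF assms(1), of h h'] assms(2)
  show "(case p of (u, v) \<Rightarrow> gap ((!) \<sigma>) u v) = (case p of (h, h') \<Rightarrow> gap r h h')" by simp
qed simp

context grouping
begin

text \<open>Forgetting vertices only brings the remaining ones closer together.\<close>

lemma rank_gap_le: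
  assumes f: "inj_on f {..<n}" and \<rho>: "\<And>h. h < N \<Longrightarrow> \<rho> h < n" and inj: "inj_on \<rho> {..<N}"
    and h: "h < N" "h' < N"
  shows "gap (rank N (\<lambda>h. f (\<rho> h))) h h' \<le> gap f (\<rho> h) (\<rho> h')"
proof -
  have *: "gap (rank N (\<lambda>h. f (\<rho> h))) h h' \<le> gap f (\<rho> h) (\<rho> h')"
    if le: "f (\<rho> h) \<le> f (\<rho> h')" for h h'
  proof -
    let ?S = "{z \<in> {..<N}. f (\<rho> h) < f (\<rho> z) \<and> f (\<rho> z) \<le> f (\<rho> h')}"
    have "inj_on (f \<circ> \<rho>) {..<N}"
      using inj by (rule comp_inj_on) (rule inj_on_subset[OF f], use \<rho> in auto)
    then have "inj_on (f \<circ> \<rho>) ?S" by (rule inj_on_subset) auto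
    then have "card ?S = card ((f \<circ> \<rho>) ` ?S)" by (rule card_image[symmetric])
    also have "\<dots> \<le> card {f (\<rho> h)<..f (\<rho> h')}" by (rule card_mono) auto
    finally have "card ?S \<le> f (\<rho> h') - f (\<rho> h)" by simp
    with rank_dist[of "\<lambda>h. f (\<rho> h)" h h' N] le show ?thesis by simp
  qed
  show ?thesis
  proof (cases "f (\<rho> h) \<le> f (\<rho> h')")
    case False
    then have "f (\<rho> h') \<le> f (\<rho> h)" by simp
    from *[OF this] show ?thesis by (simp only: abs_minus_commute)
  qed (rule *)
qed

text \<open>The contracted graph is isomorphic to the subgraph induced by the representatives. This
  serves the case \<open>m = 1\<close>, in which lifting does not increase the value and no
  averaging is called for.\<close>

lemma exact_layout:
  assumes \<sigma>: "linear_layout (n, E) \<sigma>"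
  shows "\<exists>\<sigma>'. linear_layout (N, E') \<sigma>' \<and> layout_val \<sigma>' (N, E') \<le> layout_val \<sigma> (n, E)"
proof -
  let ?f = "\<lambda>h. \<sigma> ! rep h"
  let ?s = "map (rank N ?f) [0..<N]"
  have inj: "inj_on ((!) \<sigma>) {..<n}" using \<sigma> by (auto simp: linear_layout_def bij_betw_def)
  have "inj_on ((!) \<sigma> \<circ> rep) {..<N}"
    using inj_rep by (rule comp_inj_on)
      (rule inj_on_subset[OF inj], use rep_placed placed_less in auto)
  then have "linear_layout (N, E') ?s" by (intro linear_layout_rank) (simp add: comp_def)
  moreover have "2 * layout_val ?s (N, E') \<le> 2 * layout_val \<sigma> (n, E)"
  proof -
    have "2 * layout_val ?s (N, E') = (\<Sum>(h, h')\<in>arcs E'. gap (rank N ?f) h h')"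
      by (rule layout_val_cong[OF simple_graph']) simp
    also have "\<dots> \<le> (\<Sum>(h, h')\<in>arcs E'. gap ((!) \<sigma>) (rep h) (rep h'))"
    proof (rule sum_mono)
      fix p assume "p \<in> arcs E'"
      then obtain h h' where p: "p = (h, h')" "h < N" "h' < N" by (auto simp: arcs_def edge'_iff)
      have "gap (rank N ?f) h h' \<le> gap ((!) \<sigma>) (rep h) (rep h')"
        by (rule rank_gap_le[OF inj _ inj_rep]) (use p rep_placed placed_less in auto)
      then show "(case p of (h, h') \<Rightarrow> gap (rank N ?f) h h')
        \<le> (case p of (h, h') \<Rightarrow> gap ((!) \<sigma>) (rep h) (rep h'))" by (simp add: p)
    qed
    also have "\<dots> = (\<Sum>(u, v)\<in>map_prod rep rep ` arcs E'. gap ((!) \<sigma>) u v)"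
    proof (subst sum.reindex)
      have "arcs E' \<subseteq> {..<N} \<times> {..<N}" by (auto simp: arcs_def edge'_iff)
      then show "inj_on (map_prod rep rep) (arcs E')"
        by (rule inj_on_subset[OF map_prod_inj_on[OF inj_rep inj_rep]])
    qed (simp add: case_prod_beta)
    also have "\<dots> \<le> (\<Sum>(u, v)\<in>arcs E. gap ((!) \<sigma>) u v)"
      by (rule sum_mono2[OF finite_arcs[OF G]]) (auto simp: arcs_def edge'_iff)
    finally show ?thesis by (simp add: layout_val_arcs[OF G])
  qed
  ultimately show ?thesis by auto
qed

definition "full = {h. card C \<le> h \<and> h < N \<and> card (grp h) = m}"

definition between :: "nat \<Rightarrow> nat \<Rightarrow> nat \<Rightarrow> bool" where
  "between a b c \<longleftrightarrow> a < b \<and> b < c \<or> c < b \<and> b < a"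

lemma finite_full [simp]: "finite full"
  by (simp add: full_def)

lemma full_less: "h \<in> full \<Longrightarrow> h < N"
  by (simp add: full_def)

lemma grp_full: "h \<in> full \<Longrightarrow> grp h \<subseteq> outer n E C"
  using grp_outer by (auto simp: full_def)

lemma disjoint_grp: "h \<noteq> h' \<Longrightarrow> grp h \<inter> grp h' = {}"
  by (auto simp: grp_def)

text \<open>An edge between a full group and a cover vertex c becomes as long as the number of
  representatives after one end up to the other. Those of full groups are counted by
  \<open>H\<close> and averaged: for each choice x of the end, the vertices y between x and c have
  distinct positions, so that the sum over all x and y is at most the value of
  \<open>\<sigma>\<close>. The other groups add at most \<open>Suc (card ({..<N} - full))\<close>
  per edge. Edges that avoid the full groups are bounded by \<open>N\<close> each.\<close>

lemma random_layout:
  assumes \<sigma>: "linear_layout (n, E) \<sigma>"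
  shows "\<exists>\<sigma>'. linear_layout (N, E') \<sigma>' \<and>
    (real m)\<^sup>2 * layout_val \<sigma>' (N, E')
    \<le> (real m)\<^sup>2 * real (card C * (card ({..<N} - full) * N + card full * Suc (card ({..<N} - full))))
      + layout_val \<sigma> (n, E)"
proof -
  let ?f = "(!) \<sigma>" and ?k = "card C" and ?NF = "{..<N} - full"
  have inj: "inj_on ?f {..<n}" using \<sigma> by (auto simp: linear_layout_def bij_betw_def)
  \<comment> \<open>Zero on the diagonal, as \<open>averaging\<close> requires: a group has only one
    representative and none of its own lies in between.\<close>
  define H :: "nat \<Rightarrow> nat \<Rightarrow> nat \<Rightarrow> nat \<Rightarrow> real" where
    "H h h'' x y = (if h = h'' then 0 else \<Sum>c\<in>nbs E x. of_bool (between (?f x) (?f y) (?f c)))"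
    for h h'' x y
  have "\<exists>\<rho>. (\<forall>h\<in>full. \<rho> h \<in> grp h) \<and> (real m)\<^sup>2 *
      ((\<Sum>h\<in>full. 0) + (\<Sum>h\<in>full. \<Sum>h'\<in>full. H h h' (\<rho> h) (\<rho> h')))
      \<le> real m * (\<Sum>h\<in>full. \<Sum>x\<in>grp h. 0)
        + (\<Sum>h\<in>full. \<Sum>h'\<in>full. \<Sum>x\<in>grp h. \<Sum>y\<in>grp h'. H h h' x y)"
    by (rule averaging) (use m_pos in \<open>simp_all add: H_def full_def\<close>)
  then obtain \<rho>0 where \<rho>0: "\<forall>h\<in>full. \<rho>0 h \<in> grp h"
    "(real m)\<^sup>2 * ((\<Sum>h\<in>full. 0) + (\<Sum>h\<in>full. \<Sum>h'\<in>full. H h h' (\<rho>0 h) (\<rho>0 h')))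
      \<le> real m * (\<Sum>h\<in>full. \<Sum>x\<in>grp h. 0)
        + (\<Sum>h\<in>full. \<Sum>h'\<in>full. \<Sum>x\<in>grp h. \<Sum>y\<in>grp h'. H h h' x y)" by blast
  \<comment> \<open>Only full groups are randomised, since averaging needs groups of equal size; the
    others keep \<open>rep\<close>.\<close>
  define \<rho> where "\<rho> h = (if h \<in> full then \<rho>0 h else rep h)" for h
  have \<rho>: "\<rho> h \<in> grp h" if "h < N" for h using \<rho>0(1) rep_in_grp[OF that] by (simp add: \<rho>_def)
  have g\<rho>: "g (\<rho> h) = h" and pl\<rho>: "\<rho> h \<in> placed" if "h < N" for h
    using \<rho>[OF that] by (simp_all add: grp_def)
  have \<rho>C: "\<rho> h = rep h" if "h < ?k" for h using that by (simp add: \<rho>_def full_def)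
  have \<rho>n: "\<rho> h < n" if "h < N" for h using pl\<rho>[OF that] by (rule placed_less)
  have inj\<rho>: "inj_on \<rho> {..<N}" by (rule inj_on_inverseI[of _ g]) (simp add: g\<rho>)
  let ?F = "\<lambda>h. ?f (\<rho> h)"
  let ?r = "rank N ?F"
  let ?s = "map ?r [0..<N]"
  have injF: "inj_on ?F {..<N}"
  proof (rule inj_onI)
    fix x y assume xy: "x \<in> {..<N}" "y \<in> {..<N}" "?F x = ?F y"
    then have "\<rho> x = \<rho> y" using inj_onD[OF inj, of "\<rho> x" "\<rho> y"] by (simp add: \<rho>n)
    then show "x = y" using xy(1,2) by (rule inj_onD[OF inj\<rho>])
  qed
  then have lin: "linear_layout (N, E') ?s" by (rule linear_layout_rank)
  have gapN: "gap ?r h h' \<le> real N" if "h < N" "h' < N" for h h'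
  proof -
    have "?r h \<le> card {..<N}" "?r h' \<le> card {..<N}" unfolding rank_def by (intro card_mono; auto)+
    then show ?thesis by simp
  qed
  \<comment> \<open>The extra 1 is for an end of the edge: the distance counts one of the two ends,
    besides what lies strictly between them.\<close>
  have gapF: "gap ?r h c \<le> real (Suc (card ?NF)) + (\<Sum>h''\<in>full. of_bool (h \<noteq> h'' \<and> between (?F h) (?F h'') (?F c)))"
    if h: "h \<in> full" "c < N" for h c
  proof -
    let ?B = "{h'' \<in> full. h \<noteq> h'' \<and> between (?F h) (?F h'') (?F c)}"
    let ?S = "\<lambda>a b. {z \<in> {..<N}. ?F a < ?F z \<and> ?F z \<le> ?F b}"
    have FI: "x = y" if "?F x = ?F y" "x < N" "y < N" for x y
      using inj_onD[OF injF that(1)] that by simp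
    have hN: "h < N" using h(1) by (rule full_less)
    have "gap ?r h c \<le> real (card ?B + card (insert c (insert h ?NF) - (if ?F h \<le> ?F c then {h} else {c})))"
    proof (cases "?F h \<le> ?F c")
      case True
      have "?S h c \<subseteq> ?B \<union> (insert c (insert h ?NF) - {h})"
      proof
        fix z assume z: "z \<in> ?S h c"
        then have "z \<noteq> h" by auto
        moreover have "z = c \<or> ?F z < ?F c" using z FI[of z c] h by (cases "?F z = ?F c") auto
        ultimately show "z \<in> ?B \<union> (insert c (insert h ?NF) - {h})" using z by (auto simp: between_def)
      qed
      then have "card (?S h c) \<le> card (?B \<union> (insert c (insert h ?NF) - {h}))"
        by (rule card_mono[rotated]) simp
      also have "\<dots> \<le> card ?B + card (insert c (insert h ?NF) - {h})" by (rule card_Un_le)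
      finally have "card (?S h c) \<le> card ?B + card (insert c (insert h ?NF) - {h})" .
      with rank_dist[of ?F h c N] True show ?thesis by simp
    next
      case False
      have "?S c h \<subseteq> ?B \<union> (insert c (insert h ?NF) - {c})"
      proof
        fix z assume z: "z \<in> ?S c h"
        then have "z \<noteq> c" by auto
        moreover have "z = h \<or> ?F z < ?F h" using z FI[of z h] hN by (cases "?F z = ?F h") auto
        ultimately show "z \<in> ?B \<union> (insert c (insert h ?NF) - {c})" using z by (auto simp: between_def)
      qed
      then have "card (?S c h) \<le> card (?B \<union> (insert c (insert h ?NF) - {c}))"
        by (rule card_mono[rotated]) simp
      also have "\<dots> \<le> card ?B + card (insert c (insert h ?NF) - {c})" by (rule card_Un_le)
      finally have "card (?S c h) \<le> card ?B + card (insert c (insert h ?NF) - {c})" .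
      with rank_dist[of ?F c h N] False show ?thesis by (simp add: abs_minus_commute)
    qed
    moreover have "card (insert c (insert h ?NF) - {x}) \<le> Suc (card ?NF)" if "x = h \<or> x = c" for x
    proof -
      have "card (insert c (insert h ?NF)) \<le> Suc (Suc (card ?NF))"
        using card_insert_le_m1[of "Suc (Suc (card ?NF))"] card_insert_if[of ?NF h] card_insert_if[of "insert h ?NF" c]
        by (simp split: if_splits)
      with that show ?thesis by (subst card_Diff_singleton) auto
    qed
    ultimately have "gap ?r h c \<le> real (card ?B + Suc (card ?NF))"
      by (smt (verit) of_nat_le_iff add_left_mono)
    moreover have "(\<Sum>h''\<in>full. of_bool (h \<noteq> h'' \<and> between (?F h) (?F h'') (?F c))) = real (card ?B)"
      by (simp add: sum.If_cases of_bool_def Int_def)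
    ultimately show ?thesis by simp
  qed
  let ?S = "\<Sum>h\<in>full. \<Sum>h''\<in>full. H h h'' (\<rho>0 h) (\<rho>0 h'')"
  let ?X = "{p \<in> arcs E'. fst p \<in> full}" and ?Y = "{p \<in> arcs E'. snd p \<in> full}"
    and ?Z = "{p \<in> arcs E'. fst p \<notin> full \<and> snd p \<notin> full}"
  let ?d = "\<lambda>(h, h'). gap ?r h h'"
  have finE': "finite (arcs E')" by (rule finite_arcs[OF simple_graph'])
  have full_C: "c < ?k" if "{h, c} \<in> E'" "h \<in> full" for h c
    using edge'_C[OF that(1)] that(2) by (auto simp: full_def)
  \<comment> \<open>An edge has at most one end in a full group, because its other end is then in
    the cover.\<close>
  have parts: "sum ?d (arcs E') = sum ?d ?X + sum ?d ?Y
      + sum ?d ?Z"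
  proof -
    have fin: "finite ?X" "finite ?Y" "finite ?Z" "finite (?X \<union> ?Y)" using finE' by simp_all
    have "?X \<inter> ?Y = {}"
    proof (rule equals0I)
      fix p assume p: "p \<in> ?X \<inter> ?Y"
      then have "{fst p, snd p} \<in> E'" "fst p \<in> full" by (auto simp: arcs_def)
      from full_C[OF this] p show False by (simp add: full_def)
    qed
    then have "sum ?d (?X \<union> ?Y) = sum ?d ?X + sum ?d ?Y" by (rule sum.union_disjoint[OF fin(1,2)])
    moreover have "sum ?d (?X \<union> ?Y \<union> ?Z) = sum ?d (?X \<union> ?Y) + sum ?d ?Z"
      by (rule sum.union_disjoint[OF fin(4,3)]) blast
    moreover have "?X \<union> ?Y \<union> ?Z = arcs E'" by blast
    ultimately show ?thesis by (simp only:)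
  qed
  have "2 * layout_val ?s (N, E') = sum ?d (arcs E')"
    by (rule layout_val_cong[OF simple_graph']) simp
  also note parts
  also have "sum ?d ?Y = sum ?d ?X"
    by (rule sum_arcs_snd) simp
  finally have two: "2 * layout_val ?s (N, E') = sum ?d ?X
      + sum ?d ?X + sum ?d ?Z" .
  have rest: "sum ?d ?Z \<le> 2 * real (?k * (card ?NF * N))"
  proof -
    let ?P = "{..<?k} \<times> ?NF \<union> ?NF \<times> {..<?k}"
    have "?Z \<subseteq> ?P"
    proof
      fix p assume p: "p \<in> ?Z"
      then have e: "{fst p, snd p} \<in> E'" by (auto simp: arcs_def)
      then have "fst p < N" "snd p < N" by (simp_all add: edge'_iff)
      with edge'_C[OF e] p show "p \<in> ?P" by (cases p) auto
    qed
    then have "card ?Z \<le> card ?P"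
      by (rule card_mono[rotated]) simp
    also have "\<dots> \<le> 2 * (?k * card ?NF)"
      by (rule order.trans[OF card_Un_le]) (simp add: card_cartesian_product)
    finally have c: "card ?Z \<le> 2 * (?k * card ?NF)" .
    have "sum ?d ?Z
      \<le> (\<Sum>p\<in>?Z. real N)"
    proof (rule sum_mono)
      fix p assume "p \<in> ?Z"
      then have "{fst p, snd p} \<in> E'" by (auto simp: arcs_def)
      then have "fst p < N" "snd p < N" by (simp_all add: edge'_iff)
      from gapN[OF this] show "?d p \<le> real N" by (simp add: case_prod_beta)
    qed
    also have "\<dots> = real (card ?Z * N)" by simp
    also have "\<dots> \<le> real (2 * (?k * card ?NF) * N)"
      using c by (intro of_nat_mono mult_le_mono1)
    finally show ?thesis by (simp add: mult.assoc)
  qed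
  have halve: "x \<le> a + b" if "2 * x = a + a + c" "c \<le> 2 * b" for x a b c :: real
    using that by simp
  have split: "layout_val ?s (N, E')
    \<le> sum ?d ?X + real (?k * (card ?NF * N))"
    by (rule halve[OF two rest])
  \<comment> \<open>\<open>\<rho>\<close> and \<open>g\<close> are inverse to each other here: all
    neighbours of a full group are cover vertices, whose groups are singletons.\<close>
  have nbs_eq: "(\<Sum>c\<in>nbs E' h. X (\<rho> c)) = (\<Sum>c\<in>nbs E (\<rho> h). X c)"
    if h: "h \<in> full" for h and X :: "nat \<Rightarrow> real"
  proof (rule sum.reindex_bij_witness[of _ g \<rho>])
    have hN: "h < N" using h by (rule full_less)
    fix c assume "c \<in> nbs E' h"
    then have e: "{h, c} \<in> E'" by (simp add: nbs_def)
    then have cN: "c < N" by (simp add: edge'_iff)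
    show "g (\<rho> c) = c" using cN by (rule g\<rho>)
    show "\<rho> c \<in> nbs E (\<rho> h)"
      using edge_g[OF pl\<rho>[OF hN] pl\<rho>[OF cN]] e by (simp add: g\<rho> hN cN nbs_def)
  next
    have hN: "h < N" using h by (rule full_less)
    fix c assume "c \<in> nbs E (\<rho> h)"
    then have e: "{\<rho> h, c} \<in> E" by (simp add: nbs_def)
    have cp: "c \<in> placed" using e by (rule edge_placed2)
    have e': "{h, g c} \<in> E'" using edge_g[OF pl\<rho>[OF hN] cp] e g\<rho>[OF hN] by simp
    then show "g c \<in> nbs E' h" by (simp add: nbs_def)
    have "g c < ?k" using full_C[OF e' h] .
    then show "\<rho> (g c) = c" using \<rho>C g_cover(2) g_less_k[OF cp] by simp
  qed simp
  have "sum ?d ?X = (\<Sum>h\<in>full. \<Sum>c\<in>nbs E' h. gap ?r h c)"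
    by (rule arcs_cover_sum[OF simple_graph' finite_full])
  also have "\<dots> \<le> (\<Sum>h\<in>full. \<Sum>c\<in>nbs E' h. real (Suc (card ?NF))
      + (\<Sum>h''\<in>full. of_bool (h \<noteq> h'' \<and> between (?F h) (?F h'') (?F c))))"
    by (intro sum_mono gapF) (auto simp: nbs_def edge'_iff)
  also have "\<dots> \<le> (\<Sum>h\<in>full. real (?k * Suc (card ?NF)) + (\<Sum>h''\<in>full. H h h'' (\<rho>0 h) (\<rho>0 h'')))"
  proof (rule sum_mono)
    fix h assume h: "h \<in> full"
    have "nbs E' h \<subseteq> {..<?k}" using full_C h by (auto simp: nbs_def)
    then have "card (nbs E' h) \<le> card {..<?k}" by (rule card_mono[rotated]) simp
    then have "(\<Sum>c\<in>nbs E' h. real (Suc (card ?NF))) \<le> real (?k * Suc (card ?NF))"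
      by (simp only: sum_constant of_nat_mult[symmetric] of_nat_le_iff card_lessThan mult_le_mono1)
    moreover have "(\<Sum>c\<in>nbs E' h. \<Sum>h''\<in>full. of_bool (h \<noteq> h'' \<and> between (?F h) (?F h'') (?F c)))
      = (\<Sum>h''\<in>full. H h h'' (\<rho>0 h) (\<rho>0 h''))"
    proof (subst sum.swap, rule sum.cong[OF refl])
      fix h'' assume h'': "h'' \<in> full"
      have "(\<Sum>c\<in>nbs E' h. of_bool (h \<noteq> h'' \<and> between (?F h) (?F h'') (?F c)))
        = (\<Sum>c\<in>nbs E (\<rho> h). of_bool (h \<noteq> h'' \<and> between (?F h) (?F h'') (?f c)) :: real)"
        by (rule nbs_eq[OF h])
      then show "(\<Sum>c\<in>nbs E' h. of_bool (h \<noteq> h'' \<and> between (?F h) (?F h'') (?F c)))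
        = H h h'' (\<rho>0 h) (\<rho>0 h'')"
        using h h'' by (simp add: H_def \<rho>_def)
    qed
    ultimately show "(\<Sum>c\<in>nbs E' h. real (Suc (card ?NF))
      + (\<Sum>h''\<in>full. of_bool (h \<noteq> h'' \<and> between (?F h) (?F h'') (?F c))))
      \<le> real (?k * Suc (card ?NF)) + (\<Sum>h''\<in>full. H h h'' (\<rho>0 h) (\<rho>0 h''))"
      by (simp add: sum.distrib)
  qed
  also have "\<dots> = real (?k * (card full * Suc (card ?NF)))
      + ?S"
    by (simp add: sum.distrib distrib_left mult_ac)
  finally have main: "sum ?d ?X \<le> real (?k * (card full * Suc (card ?NF)))
      + ?S" .
  \<comment> \<open>The vertices between \<open>x\<close> and \<open>c\<close> have distinct
    positions strictly between theirs.\<close>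
  have between_le: "(\<Sum>y\<in>outer n E C. of_bool (between (?f x) (?f y) (?f c))) \<le> gap ?f x c" for x c
  proof -
    let ?S = "{y \<in> outer n E C. between (?f x) (?f y) (?f c)}"
    have "inj_on ?f ?S" by (rule inj_on_subset[OF inj]) (auto simp: outer_def)
    then have "card ?S = card (?f ` ?S)" by (rule card_image[symmetric])
    also have "\<dots> \<le> card ({?f x<..<?f c} \<union> {?f c<..<?f x})"
      by (rule card_mono) (auto simp: between_def)
    also have "\<dots> \<le> (?f c - ?f x) + (?f x - ?f c)"
      by (rule order.trans[OF card_Un_le]) simp
    finally have "real (card ?S) \<le> gap ?f x c" by linarith
    then show ?thesis
      by (simp add: sum_of_bool_eq finite_outer[OF G cover] Int_def del: sum_of_bool_mult_eq)
  qed
  have union: "(\<Sum>h\<in>full. \<Sum>x\<in>grp h. X x) \<le> (\<Sum>x\<in>outer n E C. X x)"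
    if "\<And>x. x \<in> outer n E C \<Longrightarrow> 0 \<le> X x" for X :: "nat \<Rightarrow> real"
  proof -
    have "(\<Sum>h\<in>full. \<Sum>x\<in>grp h. X x) = sum X (\<Union>h\<in>full. grp h)"
      by (rule sum.UNION_disjoint[symmetric]) (auto simp: finite_grp dest: disjoint_grp)
    also have "\<dots> \<le> sum X (outer n E C)"
      using grp_full that by (intro sum_mono2) (auto simp: finite_outer[OF G cover])
    finally show ?thesis .
  qed
  have "(\<Sum>h\<in>full. \<Sum>h'\<in>full. \<Sum>x\<in>grp h. \<Sum>y\<in>grp h'. H h h' x y)
    \<le> (\<Sum>h\<in>full. \<Sum>h'\<in>full. \<Sum>x\<in>grp h. \<Sum>y\<in>grp h'.
        \<Sum>c\<in>nbs E x. of_bool (between (?f x) (?f y) (?f c)))"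
    by (intro sum_mono) (auto simp: H_def intro!: sum_nonneg)
  also have "\<dots> = (\<Sum>h\<in>full. \<Sum>x\<in>grp h. \<Sum>h'\<in>full. \<Sum>y\<in>grp h'.
        \<Sum>c\<in>nbs E x. of_bool (between (?f x) (?f y) (?f c)))"
    by (intro sum.cong refl sum.swap)
  also have "\<dots> \<le> (\<Sum>h\<in>full. \<Sum>x\<in>grp h. \<Sum>y\<in>outer n E C.
        \<Sum>c\<in>nbs E x. of_bool (between (?f x) (?f y) (?f c)))"
    by (intro sum_mono union sum_nonneg) simp
  also have "\<dots> = (\<Sum>h\<in>full. \<Sum>x\<in>grp h. \<Sum>c\<in>nbs E x. \<Sum>y\<in>outer n E C.
        of_bool (between (?f x) (?f y) (?f c)))"
    by (intro sum.cong refl sum.swap)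
  also have "\<dots> \<le> (\<Sum>h\<in>full. \<Sum>x\<in>grp h. \<Sum>c\<in>nbs E x. gap ?f x c)"
    by (intro sum_mono between_le)
  also have "\<dots> \<le> (\<Sum>x\<in>outer n E C. \<Sum>c\<in>nbs E x. gap ?f x c)"
    by (intro union sum_nonneg) simp
  also have "\<dots> \<le> layout_val \<sigma> (n, E)" by (rule outer_sum_le[OF G cover])
  finally have avg: "(real m)\<^sup>2 * ?S \<le> layout_val \<sigma> (n, E)"
    using \<rho>0(2) by simp
  have combine: "M * x \<le> M * (a + b) + v" if "x \<le> s + a" "s \<le> b + S" "M * S \<le> v" "0 \<le> M"
    for M x s a b S v :: real
  proof -
    have "M * x \<le> M * (b + S + a)" using that by (intro mult_left_mono) simp_all
    then show ?thesis using that(3) by (simp add: algebra_simps)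
  qed
  have "(real m)\<^sup>2 * layout_val ?s (N, E') \<le> (real m)\<^sup>2 * (real (?k * (card ?NF * N))
      + real (?k * (card full * Suc (card ?NF)))) + layout_val \<sigma> (n, E)"
    by (rule combine[OF split main avg]) simp
  also have "real (?k * (card ?NF * N)) + real (?k * (card full * Suc (card ?NF)))
    = real (?k * (card ?NF * N + card full * Suc (card ?NF)))"
    by (simp only: of_nat_add[symmetric] distrib_left)
  finally show ?thesis using lin by blast
qed

section \<open>Counting full and non-full groups\<close>

lemma card_full: "card full * m \<le> card (outer n E C)"
proof -
  have "card full * m = (\<Sum>h\<in>full. card (grp h))" by (simp add: full_def)
  also have "\<dots> = card (\<Union>h\<in>full. grp h)"
    by (rule card_UN_disjoint[symmetric]) (auto simp: finite_grp dest: disjoint_grp)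
  also have "\<dots> \<le> card (outer n E C)"
    using grp_full by (intro card_mono) (auto simp: finite_outer[OF G cover])
  finally show ?thesis .
qed

text \<open>Besides the singletons of the cover, there is at most one non-full group for each
  nonempty subset of \<open>C\<close> as its neighbourhood. The empty set is excluded because
  vertices in \<open>outer n E C\<close> are not isolated, whence the strict inequality.\<close>

lemma card_nonfull: "card ({..<N} - full) < card C + 2 ^ card C"
proof -
  let ?P = "{h. card C \<le> h \<and> h < N \<and> card (grp h) < m}"
  let ?t = "\<lambda>h. nbs E (rep h)"
  have inj: "inj_on ?t ?P" by (rule inj_onI) (auto simp: grp_outer intro: nonfull)
  have sub: "?t ` ?P \<subseteq> Pow C - {{}}"
  proof
    fix X assume "X \<in> ?t ` ?P"
    then obtain h where h: "h \<in> ?P" "X = ?t h" by blast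
    then have o: "rep h \<in> outer n E C" using rep_outer by simp
    then obtain v where "{rep h, v} \<in> E" by (rule outer_edge[OF G cover])
    with nbs_outer[OF G cover o] show "X \<in> Pow C - {{}}" by (auto simp: h nbs_def)
  qed
  have "card ?P = card (?t ` ?P)" using inj by (rule card_image[symmetric])
  also have "\<dots> \<le> card (Pow C - {{}})" using sub by (rule card_mono[rotated]) (simp add: finite_C)
  also have "\<dots> < card (Pow C)" by (rule psubset_card_mono) (auto simp: finite_C)
  finally have P: "card ?P < 2 ^ card C" by (simp add: card_Pow finite_C)
  have "card (grp h) < m" if "h < N" "h \<notin> full" "card C \<le> h" for h
    using card_grp_le[OF that(1)] that by (auto simp: full_def)
  then have "{..<N} - full \<subseteq> {..<card C} \<union> ?P" by auto
  then have "card ({..<N} - full) \<le> card ({..<card C} \<union> ?P)" by (rule card_mono[rotated]) simp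
  also have "\<dots> \<le> card C + card ?P" by (rule order.trans[OF card_Un_le]) simp
  finally show ?thesis using P by linarith
qed

lemma N_eq: "N = card ({..<N} - full) + card full"
proof -
  have "full \<subseteq> {..<N}" using full_less by blast
  then show ?thesis using card_mono[of "{..<N}" full] by (simp add: card_Diff_subset)
qed

lemma N_le: "N * m \<le> (card C + 2 ^ card C) * m + card (outer n E C)"
proof -
  have "N * m = card ({..<N} - full) * m + card full * m"
    by (subst N_eq) (rule distrib_right)
  also have "\<dots> \<le> (card C + 2 ^ card C) * m + card (outer n E C)"
    using card_nonfull by (intro add_mono card_full mult_le_mono1) simp
  finally show ?thesis .
qed

text \<open>The constant 64 is 8 * 4 * 2: 8 comes from \<open>layout_val_ge\<close>, 4 from bounding
  the non-full groups by \<open>2 * 2 ^ card C\<close>, and 2 from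
  \<open>(2 ^ card C + card full) * m \<le> 2 * card (outer n E C)\<close>. The last one needs
  \<open>2 ^ card C * m \<le> card (outer n E C)\<close>, and this is where
  \<open>A \<le> 16 * B * (card C)\<^sup>2\<close> enters.\<close>

lemma random_layout_error:
  assumes k: "0 < card C" and A: "A \<le> 16 * B * (card C)\<^sup>2" and B: "0 < B"
    and m: "64 * B * (card C)\<^sup>2 * 2 ^ card C * m \<le> A * card (outer n E C)"
  shows "8 * card C * B * (m\<^sup>2 * (card C * (card ({..<N} - full) * N + card full * Suc (card ({..<N} - full)))))
    \<le> A * (card (outer n E C))\<^sup>2"
proof -
  define k where "k = card C"
  define K where "K = (2::nat) ^ card C"
  define F where "F = card full"
  define nf where "nf = card ({..<N} - full)"
  define n0 where "n0 = card (outer n E C)"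
  have kK: "k < K" unfolding k_def K_def by (rule less_exp)
  have nf: "nf < k + K" using card_nonfull by (simp add: nf_def k_def K_def)
  have NN: "N = nf + F" using N_eq by (simp add: nf_def F_def)
  have Fm: "F * m \<le> n0" using card_full by (simp add: F_def n0_def)
  have "16 * B * k\<^sup>2 * (4 * (K * m)) = 64 * B * k\<^sup>2 * K * m" by (simp add: mult_ac)
  also have "\<dots> \<le> A * n0" using m by (simp add: k_def K_def n0_def)
  also have "\<dots> \<le> 16 * B * k\<^sup>2 * n0" using A by (simp add: k_def)
  finally have "4 * (K * m) \<le> n0" using B \<open>0 < card C\<close> by (simp add: k_def)
  then have Km: "K * m \<le> n0" by simp
  have "nf * N + F * Suc nf \<le> 2 * K * (2 * K + F) + F * (2 * K)"
    using nf kK NN by (intro add_mono mult_le_mono) auto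
  also have "\<dots> = 4 * K * (K + F)" by (simp add: algebra_simps)
  finally have "m\<^sup>2 * (k * (nf * N + F * Suc nf)) \<le> m\<^sup>2 * (k * (4 * K * (K + F)))"
    by (intro mult_le_mono2)
  also have "\<dots> = 4 * k * K * m * (K * m + F * m)"
    by (simp add: power2_eq_square algebra_simps)
  also have "\<dots> \<le> 4 * k * K * m * (n0 + n0)" by (intro mult_le_mono2 add_mono Km Fm)
  finally have "8 * k * B * (m\<^sup>2 * (k * (nf * N + F * Suc nf))) \<le> 8 * k * B * (4 * k * K * m * (n0 + n0))"
    by (rule mult_le_mono2)
  also have "\<dots> = (64 * B * k\<^sup>2 * K * m) * n0" by (simp add: power2_eq_square algebra_simps)
  also have "\<dots> \<le> (A * n0) * n0" using m by (intro mult_le_mono1) (simp add: k_def K_def n0_def)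
  finally show ?thesis by (simp add: power2_eq_square mult.assoc k_def F_def nf_def n0_def)
qed

text \<open>For \<open>m = 1\<close> there is no error at all. Otherwise the error is compared with
  the square of \<open>card (outer n E C)\<close>, which is at most \<open>cover_deg E C\<close>,
  and thus charged to the value of \<open>\<sigma>\<close> by \<open>layout_val_ge\<close>.\<close>

lemma good_layout:
  assumes \<sigma>: "linear_layout (n, E) \<sigma>"
    and k: "0 < card C" and A: "A \<le> 16 * B * (card C)\<^sup>2" and B: "0 < B"
    and m: "m = 1 \<or> 64 * B * (card C)\<^sup>2 * 2 ^ card C * m \<le> A * card (outer n E C)"
  shows "\<exists>\<sigma>'. linear_layout (N, E') \<sigma>' \<and>
    (real m)\<^sup>2 * layout_val \<sigma>' (N, E') \<le> (1 + real A / real B) * layout_val \<sigma> (n, E)"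
  using m
proof
  assume m1: "m = 1"
  obtain \<sigma>' where \<sigma>': "linear_layout (N, E') \<sigma>'" "layout_val \<sigma>' (N, E') \<le> layout_val \<sigma> (n, E)"
    using exact_layout[OF \<sigma>] by blast
  have "0 \<le> layout_val \<sigma> (n, E)" unfolding layout_val_def by (auto intro!: sum_nonneg)
  then have "1 * layout_val \<sigma> (n, E) \<le> (1 + real A / real B) * layout_val \<sigma> (n, E)"
    by (intro mult_right_mono) simp_all
  with \<sigma>' m1 show ?thesis by (intro exI[of _ \<sigma>']) simp
next
  assume mm: "64 * B * (card C)\<^sup>2 * 2 ^ card C * m \<le> A * card (outer n E C)"
  define e where "e = card C * (card ({..<N} - full) * N + card full * Suc (card ({..<N} - full)))"
  define v where "v = layout_val \<sigma> (n, E)"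
  obtain \<sigma>' where \<sigma>': "linear_layout (N, E') \<sigma>'"
    "(real m)\<^sup>2 * layout_val \<sigma>' (N, E') \<le> (real m)\<^sup>2 * real e + v"
    using random_layout[OF \<sigma>] unfolding e_def v_def by blast
  have "8 * card C * B * (m\<^sup>2 * e) \<le> A * (card (outer n E C))\<^sup>2"
    unfolding e_def by (rule random_layout_error[OF k A B mm])
  also have "\<dots> \<le> A * (cover_deg E C)\<^sup>2"
    using card_outer_le[OF G cover] by (intro mult_le_mono2 power_mono) simp_all
  finally have "real (8 * card C * B * (m\<^sup>2 * e)) \<le> real (A * (cover_deg E C)\<^sup>2)"
    by (simp only: of_nat_le_iff)
  also have "\<dots> \<le> real A * (8 * real (card C) * v)"
    using layout_val_ge[OF G cover \<sigma>] by (simp add: v_def mult_left_mono)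
  finally have "real (8 * card C) * (real B * ((real m)\<^sup>2 * real e)) \<le> real (8 * card C) * (real A * v)"
    by (simp add: mult_ac)
  then have "real B * ((real m)\<^sup>2 * real e) \<le> real A * v" using k by simp
  then have "(real m)\<^sup>2 * real e \<le> real A / real B * v" using B by (simp add: field_simps)
  with \<sigma>'(2) have "(real m)\<^sup>2 * layout_val \<sigma>' (N, E') \<le> (1 + real A / real B) * v"
    by (simp add: distrib_right)
  with \<sigma>'(1) show ?thesis by (auto simp: v_def)
qed

end

section \<open>Approximate solutions and the size of the reduced instance\<close>

lemma layout_val_nonneg: "0 \<le> layout_val \<sigma> (n, E)"
  unfolding layout_val_def by (auto intro!: sum_nonneg)

lemma approx_solution_OLA_I:
  assumes cover: "vertex_cover (n, E) C" "card C \<le> k" and r: "0 < r"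
    and s: "linear_layout (n, E) s"
    and le: "\<And>\<sigma>. linear_layout (n, E) \<sigma> \<Longrightarrow> layout_val s (n, E) \<le> r * layout_val \<sigma> (n, E)"
  shows "approx_solution OLA r ((n, E), C) k s"
proof -
  have "ereal (layout_val s (n, E) / r) \<le> opt OLA ((n, E), C) k"
    unfolding opt_def
  proof (rule INF_greatest)
    fix \<sigma>
    show "ereal (layout_val s (n, E) / r) \<le> cost OLA ((n, E), C) k \<sigma>"
      using le[of \<sigma>] r cover by (simp add: OLA_def ola_cost_def divide_le_eq mult.commute)
  qed
  then have "ereal r * ereal (layout_val s (n, E) / r) \<le> ereal r * opt OLA ((n, E), C) k"
    using r by (intro ereal_mult_left_mono) simp_all
  then show ?thesis using r s cover by (simp add: approx_solution_def OLA_def ola_cost_def)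
qed

text \<open>The layout \<open>\<sigma>\<close> makes the optimum less than \<infinity>, so
  \<open>s\<close> cannot have cost \<infinity> and must be a layout itself.\<close>

lemma approx_solution_OLA_D:
  assumes ap: "approx_solution OLA c ((n, E), C) k s" and c: "1 \<le> c"
    and cover: "vertex_cover (n, E) C" "card C \<le> k" and \<sigma>: "linear_layout (n, E) \<sigma>"
  shows "linear_layout (n, E) s \<and> layout_val s (n, E) \<le> c * layout_val \<sigma> (n, E)"
proof -
  have "opt OLA ((n, E), C) k \<le> ereal (layout_val \<sigma> (n, E))"
    unfolding opt_def by (rule INF_lower2[of \<sigma>]) (use cover \<sigma> in \<open>simp_all add: OLA_def ola_cost_def\<close>)
  then have "ereal c * opt OLA ((n, E), C) k \<le> ereal c * ereal (layout_val \<sigma> (n, E))"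
    using c by (intro ereal_mult_left_mono) simp_all
  with ap have "cost OLA ((n, E), C) k s \<le> ereal (c * layout_val \<sigma> (n, E))"
    by (auto simp: approx_solution_def)
  then show ?thesis using cover by (simp add: OLA_def ola_cost_def split: if_splits)
qed

text \<open>Every string costs -\<infinity> then, hence is optimal.\<close>

lemma approx_solution_OLA_no_cover:
  assumes "\<not> (vertex_cover (n, E) C \<and> card C \<le> k)" "0 < r"
  shows "approx_solution OLA r ((n, E), C) k s"
  using assms by (auto simp: approx_solution_def OLA_def ola_cost_def)

text \<open>When \<open>16 B |C|\<^sup>2 \<le> A\<close>, the empty instance is a kernel: any layout in which the isolated
  vertices come last is good enough.\<close>

lemma approx_solution_OLA_trivial:
  assumes G: "simple_graph (n, E)" and cover: "vertex_cover (n, E) C" "card C \<le> k"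
    and A: "16 * B * (card C)\<^sup>2 \<le> A" "0 < B" and c: "1 \<le> c"
  shows "approx_solution OLA (c * (1 + real A / real B)) ((n, E), C) k
    (map (rank n (\<lambda>u. (if u \<in> C \<union> outer n E C then 0 else Suc N) * n + u)) [0..<n])"
    (is "approx_solution _ ?r _ _ ?s")
proof (rule approx_solution_OLA_I[OF cover])
  let ?P = "C \<union> outer n E C"
  let ?f = "\<lambda>u. (if u \<in> ?P then 0 else Suc N) * n + u"
  have a1: "1 \<le> 1 + real A / real B" by simp
  have "1 * 1 \<le> ?r" using c a1 by (intro mult_mono) auto
  then show "0 < ?r" by simp
  show lin: "linear_layout (n, E) ?s"
    by (rule linear_layout_rank[OF inj_lex_index])
  fix \<tau> assume \<tau>: "linear_layout (n, E) \<tau>"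
  have Pn: "u < n" if "u \<in> ?P" for u
    using cover that by (auto simp: vertex_cover_def outer_def)
  have "layout_val ?s (n, E) \<le> 16 * (real (card C))\<^sup>2 * layout_val \<tau> (n, E)"
  proof (rule layout_val_le[OF G cover(1) lin _ \<tau>])
    fix u assume u: "u \<in> ?P"
    have "{y \<in> {..<n}. ?f y \<le> ?f u} \<subseteq> ?P"
    proof
      fix y assume "y \<in> {y \<in> {..<n}. ?f y \<le> ?f u}"
      then have y: "y < n" "\<not> ?f u < ?f y" by auto
      with lex_index_le[OF Pn[OF u] y(1), of 0 "Suc N"] u show "y \<in> ?P"
        by (auto split: if_splits)
    qed
    then have "rank n ?f u \<le> card ?P"
      unfolding rank_def using finite_cover[OF G cover(1)] finite_outer[OF G cover(1)]
      by (intro card_mono) auto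
    then show "?s ! u \<le> card ?P" using Pn[OF u] by simp
  qed
  also have "\<dots> \<le> ?r * layout_val \<tau> (n, E)"
  proof (rule mult_right_mono[OF _ layout_val_nonneg])
    have "real (16 * B * (card C)\<^sup>2) \<le> real A" using A(1) by (simp only: of_nat_le_iff)
    then have "16 * (real (card C))\<^sup>2 \<le> real A / real B" using A(2) by (simp add: field_simps)
    also have "\<dots> \<le> 1 * (1 + real A / real B)" by simp
    also have "\<dots> \<le> ?r" using c a1 by (intro mult_right_mono) auto
    finally show "16 * (real (card C))\<^sup>2 \<le> ?r" .
  qed
  finally show "layout_val ?s (n, E) \<le> ?r * layout_val \<tau> (n, E)" .
qed

context grouping
begin

text \<open>The factor \<open>m\<^sup>2\<close> lost by \<open>lift\<close> is exactly the one
  gained by \<open>good_layout\<close>, so only \<open>c\<close> and \<open>1 + A / B\<close>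
  remain.\<close>

lemma approx_solution_lift:
  assumes k: "0 < card C" "card C \<le> k" and A: "A \<le> 16 * B * (card C)\<^sup>2" and B: "0 < B"
    and m: "m = 1 \<or> 64 * B * (card C)\<^sup>2 * 2 ^ card C * m \<le> A * card (outer n E C)"
    and c: "1 \<le> c" and ap: "approx_solution OLA c ((N, E'), {..<card C}) (card C) s"
  shows "approx_solution OLA (c * (1 + real A / real B)) ((n, E), C) k (lift s)"
    (is "approx_solution _ ?r _ _ _")
proof (rule approx_solution_OLA_I[OF cover k(2)])
  have "1 * 1 \<le> ?r" using c by (intro mult_mono) auto
  then show "0 < ?r" by simp
  show "linear_layout (n, E) (lift s)" by (rule linear_layout_lift)
  fix \<sigma> assume \<sigma>: "linear_layout (n, E) \<sigma>"
  obtain \<sigma>' where \<sigma>': "linear_layout (N, E') \<sigma>'"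
    "(real m)\<^sup>2 * layout_val \<sigma>' (N, E') \<le> (1 + real A / real B) * layout_val \<sigma> (n, E)"
    using good_layout[OF \<sigma> k(1) A B m] by blast
  have s: "linear_layout (N, E') s" "layout_val s (N, E') \<le> c * layout_val \<sigma>' (N, E')"
    using approx_solution_OLA_D[OF ap c vertex_cover' _ \<sigma>'(1)] by simp_all
  have "layout_val (lift s) (n, E) \<le> (real m)\<^sup>2 * layout_val s (N, E')"
    by (rule layout_val_lift[OF s(1)])
  also have "\<dots> \<le> (real m)\<^sup>2 * (c * layout_val \<sigma>' (N, E'))"
    by (rule mult_left_mono[OF s(2)]) simp
  also have "\<dots> = c * ((real m)\<^sup>2 * layout_val \<sigma>' (N, E'))" by (simp add: mult_ac)
  also have "\<dots> \<le> c * ((1 + real A / real B) * layout_val \<sigma> (n, E))"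
    by (rule mult_left_mono[OF \<sigma>'(2)]) (use c in simp)
  finally show "layout_val (lift s) (n, E) \<le> ?r * layout_val \<sigma> (n, E)" by (simp add: mult_ac)
qed

end

section \<open>Bit length of the reduced instance\<close>

lemma floorlog_le: "floorlog 2 x \<le> x"
proof -
  have "x < 2 ^ x" by (rule less_exp)
  then show ?thesis by (simp add: floorlog_leI)
qed

lemma word_size_append [simp]: "word_size (v @ w) = word_size v + word_size w"
  and word_size_Cons [simp]: "word_size (x # w) = floorlog 2 x + 1 + word_size w"
  and word_size_Nil [simp]: "word_size [] = 0"
  by (simp_all add: word_size_def)

lemma word_size_le: "(\<And>x. x \<in> set w \<Longrightarrow> floorlog 2 x + 1 \<le> b) \<Longrightarrow> word_size w \<le> b * length w"
proof (induction w)
  case (Cons a w)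
  have "word_size w \<le> b * length w" by (rule Cons.IH) (use Cons.prems in simp)
  moreover have "floorlog 2 a + 1 \<le> b" by (rule Cons.prems) simp
  ultimately show ?case by simp
qed simp

lemma word_size_encode_set:
  assumes "A \<subseteq> {..<k}"
  shows "word_size (encode_set A) \<le> k + 1 + k * k"
proof -
  have fin: "finite A" using assms by (rule finite_subset) simp
  have c: "card A \<le> k" using card_mono[OF _ assms] by simp
  have "word_size (sorted_list_of_set A) \<le> k * length (sorted_list_of_set A)"
  proof (rule word_size_le)
    fix x assume "x \<in> set (sorted_list_of_set A)"
    then have "x < k" using fin assms by auto
    then show "floorlog 2 x + 1 \<le> k" using floorlog_le[of x] by simp
  qed
  also have "\<dots> \<le> k * k" using c by simp
  finally show ?thesis using floorlog_le[of "card A"] c by (simp add: encode_set_def)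
qed

lemma word_size_concat: "word_size (concat ws) = (\<Sum>w\<leftarrow>ws. word_size w)"
  by (induction ws) simp_all

context grouping
begin

text \<open>An adjacency list stores smaller ends, and the cover has the smallest numbers, so all
  entries are below \<open>card C\<close>. A list therefore has O(|C|^2) bits, even with the crude
  bound of the length of a number by its value.\<close>

lemma word_size_encode_reduced:
  assumes k: "0 < card C"
  shows "word_size (encode_ola ((N, E'), {..<card C})) + card C \<le> 9 * ((card C)\<^sup>2 * N)"
proof -
  let ?k = "card C"
  let ?b = "?k + 1 + ?k * ?k"
  have list: "word_size (encode_set {u. u < h \<and> {u, h} \<in> E'}) \<le> ?b" for h
  proof (rule word_size_encode_set)
    show "{u. u < h \<and> {u, h} \<in> E'} \<subseteq> {..<?k}"
    proof
      fix u assume "u \<in> {u. u < h \<and> {u, h} \<in> E'}"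
      then show "u \<in> {..<?k}" using edge'_C[of u h] by auto
    qed
  qed
  have "(\<Sum>w\<leftarrow>map (\<lambda>v. encode_set {u. u < v \<and> {u, v} \<in> E'}) [0..<N]. word_size w)
    \<le> (\<Sum>v\<leftarrow>[0..<N]. ?b)"
    unfolding map_map by (rule sum_list_mono) (use list in simp)
  also have "\<dots> = N * ?b" by (simp add: sum_list_triv)
  finally have lists: "word_size (concat (map (\<lambda>v. encode_set {u. u < v \<and> {u, v} \<in> E'}) [0..<N])) \<le> N * ?b"
    by (simp add: word_size_concat)
  have "word_size (encode_ola ((N, E'), {..<?k})) + ?k \<le> (N + 1) + ?b + N * ?b + ?k"
    using lists word_size_encode_set[of "{..<?k}" ?k] floorlog_le[of N] by (simp add: encode_ola_def)
  also have "\<dots> \<le> 9 * (?k\<^sup>2 * N)"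
  proof -
    obtain k' where k': "?k = Suc k'" using k gr0_implies_Suc by blast
    obtain N' where N': "N = Suc N'" using k k_le by (cases N) auto
    show ?thesis unfolding k' N' by (simp add: power2_eq_square algebra_simps)
  qed
  finally show ?thesis .
qed

text \<open>The hypothesis on \<open>m\<close> leaves room for a factor 2 lost by rounding. Then
  \<open>A * N\<close> is at most 160 times \<open>B * (card C)\<^sup>2 * 2 ^ card C\<close>, with
  32 from the non-full groups and 128 from the full ones. Every vertex takes
  \<open>9 * (card C)\<^sup>2\<close> bits, and 1440 = 9 * 160.\<close>

lemma reduced_bound:
  assumes k: "0 < card C" and A: "A \<le> 16 * B * (card C)\<^sup>2"
    and m: "A * card (outer n E C) \<le> 2 * (64 * B * (card C)\<^sup>2 * 2 ^ card C) * m"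
  shows "A * (word_size (encode_ola ((N, E'), {..<card C})) + card C)
    \<le> 1440 * (B * 2 ^ card C * (card C) ^ 4)"
proof -
  let ?k = "card C" and ?K = "2 ^ card C :: nat"
  have kK: "?k \<le> ?K" by (rule less_imp_le[OF less_exp])
  have "A * (N * m) \<le> A * ((?k + ?K) * m + card (outer n E C))"
    by (rule mult_le_mono2[OF N_le])
  also have "\<dots> \<le> A * (2 * ?K) * m + 2 * (64 * B * ?k\<^sup>2 * ?K) * m"
    using m kK by (simp add: distrib_left add_mono mult_le_mono mult.assoc)
  also have "\<dots> \<le> 16 * B * ?k\<^sup>2 * (2 * ?K) * m + 2 * (64 * B * ?k\<^sup>2 * ?K) * m"
    using A by (intro add_mono mult_le_mono) simp_all
  also have "\<dots> = 160 * (B * ?k\<^sup>2 * ?K) * m" by simp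
  finally have "A * N * m \<le> 160 * (B * ?k\<^sup>2 * ?K) * m" by (simp add: mult.assoc)
  then have N: "A * N \<le> 160 * (B * ?k\<^sup>2 * ?K)" using m_pos by simp
  have "A * (word_size (encode_ola ((N, E'), {..<?k})) + ?k) \<le> A * (9 * (?k\<^sup>2 * N))"
    by (rule mult_le_mono2[OF word_size_encode_reduced[OF k]])
  also have "\<dots> = 9 * ?k\<^sup>2 * (A * N)" by simp
  also have "\<dots> \<le> 9 * ?k\<^sup>2 * (160 * (B * ?k\<^sup>2 * ?K))" by (rule mult_le_mono2[OF N])
  also have "\<dots> = 1440 * (B * ?K * ?k ^ 4)" by (simp add: power_numeral_reduce)
  finally show ?thesis .
qed

end

section \<open>Programs: reading the input\<close>

text \<open>
  Arrays and registers 0 to 4 are reserved for inputs and outputs.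

  Array 5: start of a row of the adjacency matrix in array 9; 6: vertex representing a vertex of the
  reduced instance; 7: vertex of the reduced instance representing a vertex; 8: membership in \<open>C\<close>;
  10: being non-isolated; 11: size of a group; 12: sort key of a vertex.

  Register 8: read or write position; 10: whether \<open>C\<close> is a vertex cover of size at most \<open>k\<close>;
  11: number of non-isolated vertices outside \<open>C\<close>; 12: \<open>|C|\<^sup>2\<close>; 16: maximal size of a group;
  18: number of vertices of the reduced instance; 19: group found; 22: \<open>n\<close>; 23: \<open>|C|\<close>;
  the others are counters and temporaries.
\<close>

definition prog_rows :: com where
  "prog_rows = Seq (Assign 22 (Cell 0 (Const 0))) (Seq (Assign 23 (Cell 0 (Const 1)))
     (Seq (Assign 9 (Const 0))
       (For 5 22 (Seq (Store 5 (Reg 5) (Reg 9)) (Assign 9 (Plus (Reg 9) (Reg 22)))))))"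

definition prog_cover :: com where
  "prog_cover = For 5 23 (Seq (Assign 24 (Cell 0 (Plus (Reg 5) (Const 2))))
     (Seq (Store 6 (Reg 5) (Reg 24)) (Seq (Store 7 (Reg 24) (Reg 5)) (Store 8 (Reg 24) (Const 1)))))"

definition prog_edge :: com where
  "prog_edge = Seq (Assign 24 (Cell 0 (Reg 8))) (Seq (Assign 8 (Plus (Reg 8) (Const 1)))
     (Seq (Store 9 (Plus (Cell 5 (Reg 5)) (Reg 24)) (Const 1))
     (Seq (Store 9 (Plus (Cell 5 (Reg 24)) (Reg 5)) (Const 1))
     (Seq (Store 10 (Reg 5) (Const 1)) (Seq (Store 10 (Reg 24) (Const 1))
       (If (And (Equal (Cell 8 (Reg 5)) (Const 0)) (Equal (Cell 8 (Reg 24)) (Const 0)))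
         (Assign 10 (Const 0)) Skip))))))"

definition prog_edges :: com where
  "prog_edges = Seq (Assign 8 (Plus (Reg 23) (Const 2))) (Seq (Assign 10 (Const 1))
     (Seq (If (Less (Cell 1 (Const 0)) (Reg 23)) (Assign 10 (Const 0)) Skip)
       (For 5 22 (Seq (Assign 9 (Cell 0 (Reg 8))) (Seq (Assign 8 (Plus (Reg 8) (Const 1)))
         (For 6 9 prog_edge))))))"

definition is_outer :: "nat \<Rightarrow> bexp" where
  "is_outer x = And (Equal (Cell 8 (Reg x)) (Const 0)) (Equal (Cell 10 (Reg x)) (Const 1))"

definition prog_count :: com where
  "prog_count = Seq (Assign 11 (Const 0))
     (For 5 22 (If (is_outer 5) (Assign 11 (Plus (Reg 11) (Const 1))) Skip))"

lemma wp_mono: "wp B c Q s \<Longrightarrow> (\<And>s'. Q s' \<Longrightarrow> Q' s') \<Longrightarrow> wp B c Q' s"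
  by (rule wp_agree_mono)

locale ola_input =
  fixes n :: nat and E :: "nat set set" and C :: "nat set" and k B :: nat
  assumes G: "simple_graph (n, E)" and C: "C \<subseteq> {..<n}" and nB: "n \<le> B"
begin

definition "enc = encode_ola ((n, E), C)"

definition "cl = sorted_list_of_set C"

definition "smaller v = sorted_list_of_set {u. u < v \<and> {u, v} \<in> E}"

definition "off v = 2 + card C + length (concat (map (\<lambda>v. encode_set {u. u < v \<and> {u, v} \<in> E}) [0..<v]))"

lemma finite_C: "finite C"
  using C by (rule finite_subset) simp

lemma cB: "card C \<le> B"
  using card_mono[OF _ C] nB by simp

lemma length_cl [simp]: "length cl = card C"
  by (simp add: cl_def)

lemma set_cl: "set cl = C"
  using finite_C by (simp add: cl_def)

lemma distinct_cl: "distinct cl"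
  by (simp add: cl_def)

lemma cl_less: "j < card C \<Longrightarrow> cl ! j < n"
  using C set_cl nth_mem[of j cl] by auto

lemma off_0: "off 0 = 2 + card C"
  by (simp add: off_def)

lemma off_Suc: "off (Suc v) = off v + 1 + length (smaller v)"
  by (simp add: off_def encode_set_def smaller_def)

lemma set_smaller: "set (smaller v) = {u. u < v \<and> {u, v} \<in> E}"
  by (simp add: smaller_def)

lemma smaller_le: "v < n \<Longrightarrow> length (smaller v) \<le> B"
proof -
  assume "v < n"
  have "card {u. u < v \<and> {u, v} \<in> E} \<le> card {..<v}" by (intro card_mono) auto
  with \<open>v < n\<close> nB show ?thesis by (simp add: smaller_def)
qed

lemma enc_0: "enc ! 0 = n" and enc_1: "enc ! 1 = card C"
  by (simp_all add: enc_def encode_ola_def encode_set_def)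

lemma enc_cl: "j < card C \<Longrightarrow> enc ! (j + 2) = cl ! j"
  by (simp add: enc_def encode_ola_def encode_set_def cl_def nth_append)

lemma enc_list:
  assumes "v < n"
  shows "\<exists>xs ys. enc = xs @ encode_set {u. u < v \<and> {u, v} \<in> E} @ ys \<and> length xs = off v"
proof -
  let ?f = "\<lambda>v. encode_set {u. u < v \<and> {u, v} \<in> E}"
  have "[0..<n] = [0..<v] @ v # [Suc v..<n]"
    using upt_add_eq_append[of 0 v "n - v"] upt_conv_Cons[of v n] assms by simp
  then have "enc = (n # encode_set C @ concat (map ?f [0..<v])) @ ?f v @ concat (map ?f [Suc v..<n])"
    by (simp add: enc_def encode_ola_def)
  moreover have "length (n # encode_set C @ concat (map ?f [0..<v])) = off v"
    by (simp add: off_def encode_set_def)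
  ultimately show ?thesis by blast
qed

lemma enc_len: assumes "v < n" shows "enc ! off v = length (smaller v)" "off v < length enc"
  using enc_list[OF assms] by (auto simp: encode_set_def smaller_def nth_append)

lemma enc_smaller:
  assumes "v < n" "i < length (smaller v)"
  shows "enc ! (off v + 1 + i) = smaller v ! i" "off v + 1 + i < length enc"
  using enc_list[OF assms(1)] assms(2) by (auto simp: encode_set_def smaller_def nth_append)

lemma length_enc_ge: "card C + 2 \<le> length enc"
  by (simp add: enc_def encode_ola_def encode_set_def)

definition "reads s \<longleftrightarrow> (\<forall>i<length enc. arr s 0 i = enc ! i) \<and> arr s 1 0 = k"

text \<open>The products \<open>u * n\<close> are tabulated by repeated addition, as addresses of
  matrix entries cannot be multiplied out.\<close>

definition "has_rows s \<longleftrightarrow> reg s 22 = n \<and> reg s 23 = card C \<and> (\<forall>u<n. arr s 5 u = u * n)"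

lemma reads_upd [simp]: "reads (s\<lparr>reg := r\<rparr>) \<longleftrightarrow> reads s"
  by (simp add: reads_def)

lemma reads_agree: "reads s \<Longrightarrow> agree c s s' \<Longrightarrow> {0, 1} \<inter> mod_arrs c = {} \<Longrightarrow> reads s'"
  by (simp add: reads_def agree_def)

lemma has_rows_upd [simp]:
  "x \<noteq> 22 \<Longrightarrow> x \<noteq> 23 \<Longrightarrow> has_rows (s\<lparr>reg := r(x := v)\<rparr>) \<longleftrightarrow> has_rows (s\<lparr>reg := r\<rparr>)"
  by (simp add: has_rows_def)

lemma has_rows_agree:
  "has_rows s \<Longrightarrow> agree c s s' \<Longrightarrow> {22, 23} \<inter> mod_regs c = {} \<Longrightarrow> 5 \<notin> mod_arrs c \<Longrightarrow> has_rows s'"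
  by (simp add: has_rows_def agree_def)

lemma wp_rows:
  assumes "reads s"
  shows "wp B prog_rows has_rows s"
proof -
  have e: "arr s 0 0 = n" "arr s 0 1 = card C"
  proof -
    have "0 < length enc" "1 < length enc" using length_enc_ge by linarith+
    with assms enc_0 enc_1 show "arr s 0 0 = n" "arr s 0 1 = card C"
      unfolding reads_def by metis+
  qed
  have *: "wp B (For 5 22 (Seq (Store 5 (Reg 5) (Reg 9)) (Assign 9 (Plus (Reg 9) (Reg 22)))))
    (\<lambda>s'. reg s' 22 = n \<and> reg s' 23 = card C \<and> reg s' 9 = n * n \<and> (\<forall>u<n. arr s' 5 u = u * n)) t"
    if t: "reg t 22 = n" "reg t 23 = card C" "reg t 9 = 0" for t
    by (rule wp_For[where Inv = "\<lambda>i s'. reg s' 22 = n \<and> reg s' 23 = card C \<and> reg s' 9 = i * n \<and> (\<forall>u<i. arr s' 5 u = u * n)"])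
      (use t nB in \<open>auto simp: less_Suc_eq\<close>)
  show ?thesis
    unfolding prog_rows_def wp.simps
    by (rule wp_mono, rule *) (use e in \<open>simp_all add: has_rows_def\<close>)
qed

definition "has_cover s \<longleftrightarrow> (\<forall>j<card C. arr s 6 j = cl ! j) \<and> (\<forall>j<card C. arr s 7 (cl ! j) = j) \<and>
  (\<forall>v. arr s 8 v = of_bool (v \<in> C))"

lemma has_cover_upd [simp]: "has_cover (s\<lparr>reg := r\<rparr>) \<longleftrightarrow> has_cover s"
  by (simp add: has_cover_def)

lemma has_cover_agree: "has_cover s \<Longrightarrow> agree c s s' \<Longrightarrow> {6, 7, 8} \<inter> mod_arrs c = {} \<Longrightarrow> has_cover s'"
  by (simp add: has_cover_def agree_def)

lemma wp_cover:
  assumes s: "reads s" "has_rows s" "arr s 8 = (\<lambda>_. 0)"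
  shows "wp B prog_cover has_cover s"
proof -
  let ?I = "\<lambda>i s'. (\<forall>j<i. arr s' 6 j = cl ! j) \<and> (\<forall>j<i. arr s' 7 (cl ! j) = j) \<and>
    (\<forall>v. arr s' 8 v = of_bool (v \<in> (!) cl ` {..<i}))"
  have "wp B prog_cover (?I (card C)) s"
    unfolding prog_cover_def
  proof (rule wp_For[where Inv = ?I])
    let ?c = "Seq (Assign 24 (Cell 0 (Plus (Reg 5) (Const 2))))
     (Seq (Store 6 (Reg 5) (Reg 24)) (Seq (Store 7 (Reg 24) (Reg 5)) (Store 8 (Reg 24) (Const 1))))"
    fix i s' assume i: "i < card C" and a: "agree (For 5 23 ?c) s s'"
      and r: "reg s' 5 = i" and I: "?I i s'"
    have "arr s' 0 (i + 2) = cl ! i"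
      using agree_arrD[OF a, of 0] s(1) i length_enc_ge enc_cl by (simp add: reads_def)
    moreover have "cl ! j \<noteq> cl ! i" if "j < i" for j
      using nth_eq_iff_index_eq[OF distinct_cl, of j i] i that by simp
    ultimately show "wp B ?c (\<lambda>s''. ?I (Suc i) (set_reg s'' 5 (Suc i))) s'"
      using I r by (auto simp: less_Suc_eq lessThan_Suc)
  qed (use s cB in \<open>auto simp: has_rows_def\<close>)
  moreover have "(!) cl ` {..<card C} = C"
    using set_cl by (auto simp: set_conv_nth)
  ultimately show ?thesis by (simp add: has_cover_def[abs_def])
qed

text \<open>\<open>F\<close> is the set of edges read so far, so the same predicate serves as loop
  invariant and, for \<open>F = E\<close>, as result. Register 10 has to include the test of
  \<open>card C \<le> k\<close>, since together they decide whether the cost is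
  -\<infinity>.\<close>

definition "stored F s \<longleftrightarrow> (\<forall>u<n. \<forall>w<n. arr s 9 (u * n + w) = of_bool ({u, w} \<in> F)) \<and>
  (\<forall>v. arr s 10 v = of_bool (v \<in> \<Union>F)) \<and>
  reg s 10 = of_bool (card C \<le> k \<and> (\<forall>e\<in>F. e \<inter> C \<noteq> {}))"

lemma stored_upd [simp]:
  "x \<noteq> 10 \<Longrightarrow> stored F (s\<lparr>reg := r(x := v)\<rparr>) \<longleftrightarrow> stored F (s\<lparr>reg := r\<rparr>)"
  by (simp add: stored_def)

lemma stored_agree:
  "stored F s \<Longrightarrow> agree c s s' \<Longrightarrow> 10 \<notin> mod_regs c \<Longrightarrow> {9, 10} \<inter> mod_arrs c = {} \<Longrightarrow> stored F s'"
  by (simp add: stored_def agree_def)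

lemma stored_empty:
  "arr s 9 = (\<lambda>_. 0) \<Longrightarrow> arr s 10 = (\<lambda>_. 0) \<Longrightarrow> reg s 10 = of_bool (card C \<le> k) \<Longrightarrow> stored {} s"
  by (simp add: stored_def)

lemma index_eq_iff:
  assumes "w < n" "y < n"
  shows "u * n + w = x * n + y \<longleftrightarrow> u = x \<and> w = y"
proof
  assume eq: "u * n + w = x * n + y"
  have "\<not> (u < x \<or> u = x \<and> w < y)" using lex_index_le[OF assms, of u x] eq less_irrefl[of "x * n + y"] by (metis (no_types))
  moreover have "\<not> (x < u \<or> x = u \<and> y < w)" using lex_index_le[OF assms(2,1), of x u] eq less_irrefl[of "x * n + y"] by (metis (no_types))
  ultimately show "u = x \<and> w = y" by (metis linorder_neqE_nat)
qed simp

lemma wp_edge: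
  assumes s: "reads s" "has_rows s" "has_cover s" "stored F s" and p: "p < length enc" "reg s 8 = p"
    and u: "enc ! p = u" "u < n" "reg s 5 = v" "v < n"
  shows "wp B prog_edge (\<lambda>s'. reg s' 8 = Suc p \<and> stored (insert {u, v} F) s') s"
proof -
  have c: "arr s 0 p = u" using s(1) p u by (simp add: reads_def)
  have row: "arr s 5 v = v * n" "arr s 5 u = u * n" using s(2) u by (simp_all add: has_rows_def)
  have inC: "arr s 8 x = of_bool (x \<in> C)" for x using s(3) by (simp add: has_cover_def)
  have M: "arr s 9 (x * n + y) = of_bool ({x, y} \<in> F)" if "x < n" "y < n" for x y
    using s(4) that by (simp add: stored_def)
  have H: "arr s 10 x = of_bool (x \<in> \<Union>F)" for x using s(4) by (simp add: stored_def)
  have R: "reg s 10 = of_bool (card C \<le> k \<and> (\<forall>e\<in>F. e \<inter> C \<noteq> {}))" using s(4) by (simp add: stored_def)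
  \<comment> \<open>Row-major addresses are injective for columns below \<open>n\<close>, so the two
    writes hit the entries of \<open>(v, u)\<close> and \<open>(u, v)\<close> only.\<close>
  have M': "((arr s 9)(v * n + u := 1, u * n + v := 1)) (x * n + y) = of_bool ({x, y} \<in> insert {u, v} F)"
    if "x < n" "y < n" for x y
  proof -
    have e: "x * n + y = v * n + u \<longleftrightarrow> x = v \<and> y = u" "x * n + y = u * n + v \<longleftrightarrow> x = u \<and> y = v"
      by (rule index_eq_iff[OF that(2) u(2)], rule index_eq_iff[OF that(2) u(4)])
    have "{x, y} = {u, v} \<longleftrightarrow> x = u \<and> y = v \<or> x = v \<and> y = u" by (rule doubleton_eq_iff)
    then have d: "{x, y} \<in> insert {u, v} F \<longleftrightarrow> (x = u \<and> y = v) \<or> (x = v \<and> y = u) \<or> {x, y} \<in> F"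
      by blast
    have b: "(if P then 1 else if Q then 1 else of_bool R) = (of_bool (P \<or> Q \<or> R) :: nat)" for P Q R
      by simp
    show ?thesis unfolding fun_upd_apply e M[OF that] d by (rule b)
  qed
  have H': "((arr s 10)(v := 1, u := 1)) x = of_bool (x \<in> \<Union>(insert {u, v} F))" for x
    by (simp add: H)
  have stored': "stored (insert {u, v} F) t"
    if "arr t 9 = (arr s 9)(v * n + u := 1, u * n + v := 1)" "arr t 10 = (arr s 10)(v := 1, u := 1)"
      "reg t 10 = (if v \<notin> C \<and> u \<notin> C then 0 else reg s 10)" for t
    unfolding stored_def that using M' H' by (simp add: R)
  show ?thesis
    unfolding prog_edge_def
    by (simp add: row inC c p u) (intro conjI impI stored'; simp add: inC)
qed

text \<open>Edges whose larger end is below \<open>v\<close>, which is the order in which the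
  encoding lists them.\<close>

definition "edges_below v = (\<Union>w<v. (\<lambda>u. {u, w}) ` set (smaller w))"

lemma edges_below_Suc: "edges_below (Suc v) = edges_below v \<union> (\<lambda>u. {u, v}) ` set (smaller v)"
  by (simp add: edges_below_def lessThan_Suc Un_commute)

lemma edges_below_n: "edges_below n = E"
proof (intro set_eqI iffI)
  fix e assume e: "e \<in> E"
  then have "card e = 2" using G by (auto simp: simple_graph_def)
  then obtain x y where xy: "e = {x, y}" "x \<noteq> y" by (auto simp: card_2_iff)
  have n: "x < n" "y < n" using simple_graphD[OF G, of x y] e xy by simp_all
  consider "x < y" | "y < x" using xy(2) by linarith
  then show "e \<in> edges_below n"
  proof cases
    case 1
    with e xy have "e \<in> (\<lambda>u. {u, y}) ` set (smaller y)" by (simp add: set_smaller)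
    with n show ?thesis unfolding edges_below_def by blast
  next
    case 2
    have "e = {y, x}" using xy(1) by (simp only: insert_commute)
    with e 2 have "e \<in> (\<lambda>u. {u, x}) ` set (smaller x)" by (simp add: set_smaller)
    with n show ?thesis unfolding edges_below_def by blast
  qed
qed (auto simp: edges_below_def set_smaller)

lemma wp_edges:
  assumes s: "reads s" "has_rows s" "has_cover s" "arr s 9 = (\<lambda>_. 0)" "arr s 10 = (\<lambda>_. 0)"
  shows "wp B prog_edges (stored E) s"
proof -
  let ?J = "\<lambda>v i s'. reg s' 8 = off v + 1 + i \<and> reg s' 5 = v \<and>
    stored (edges_below v \<union> (\<lambda>u. {u, v}) ` set (take i (smaller v))) s'"
  have inner: "wp B (For 6 9 prog_edge) (?J v (length (smaller v))) t"
    if v: "v < n" and t: "reads t" "has_rows t" "has_cover t" "stored (edges_below v) t"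
      "reg t 8 = off v + 1" "reg t 5 = v" "reg t 9 = length (smaller v)" for v t
  proof (rule wp_For[where Inv = "?J v"])
    fix i s' assume i: "i < length (smaller v)" and a: "agree (For 6 9 prog_edge) t s'"
      and r: "reg s' 6 = i" and J: "?J v i s'"
    have fr: "reads s'" "has_rows s'" "has_cover s'"
      using reads_agree[OF t(1) a] has_rows_agree[OF t(2) a] has_cover_agree[OF t(3) a]
      by (simp_all add: prog_edge_def)
    have u: "smaller v ! i < n" using nth_mem[OF i] set_smaller[of v] v by auto
    have "wp B prog_edge (\<lambda>s''. reg s'' 8 = Suc (off v + 1 + i) \<and> stored (insert {smaller v ! i, v}
      (edges_below v \<union> (\<lambda>u. {u, v}) ` set (take i (smaller v)))) s'') s'"
      by (rule wp_edge[OF fr]) (use J enc_smaller[OF v i] u v in simp_all)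
    then show "wp B prog_edge (\<lambda>s''. ?J v (Suc i) (set_reg s'' 6 (Suc i))) s'"
    proof (rule wp_agree_mono)
      fix s'' assume 1: "reg s'' 8 = Suc (off v + 1 + i) \<and> stored (insert {smaller v ! i, v}
        (edges_below v \<union> (\<lambda>u. {u, v}) ` set (take i (smaller v)))) s''" and b: "agree prog_edge s' s''"
      have "reg s'' 5 = v" using agree_regD[OF b, of 5] J by (simp add: prog_edge_def)
      moreover have "edges_below v \<union> (\<lambda>u. {u, v}) ` set (take (Suc i) (smaller v))
        = insert {smaller v ! i, v} (edges_below v \<union> (\<lambda>u. {u, v}) ` set (take i (smaller v)))"
        using i by (simp add: take_Suc_conv_app_nth)
      ultimately show "?J v (Suc i) (set_reg s'' 6 (Suc i))"
        using 1 by (simp only: stored_upd store.simps fun_upd_apply) simp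
    qed
  qed (use t smaller_le[OF v] in \<open>simp_all add: prog_edge_def\<close>)
  let ?c = "Seq (Assign 9 (Cell 0 (Reg 8))) (Seq (Assign 8 (Plus (Reg 8) (Const 1))) (For 6 9 prog_edge))"
  let ?I = "\<lambda>v s'. reg s' 8 = off v \<and> stored (edges_below v) s'"
  have outer: "wp B (For 5 22 ?c) (?I n) t"
    if t: "reads t" "has_rows t" "has_cover t" "reg t 8 = off 0" "stored {} t" for t
  proof (rule wp_For[where Inv = ?I])
    fix v s' assume v: "v < n" and a: "agree (For 5 22 ?c) t s'" and r: "reg s' 5 = v" and I: "?I v s'"
    have fr: "reads s'" "has_rows s'" "has_cover s'"
      using reads_agree[OF t(1) a] has_rows_agree[OF t(2) a] has_cover_agree[OF t(3) a]
      by (simp_all add: prog_edge_def)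
    have e: "arr s' 0 (off v) = length (smaller v)"
      using fr(1) enc_len[OF v] by (simp add: reads_def)
    let ?s = "s'\<lparr>reg := (reg s')(9 := length (smaller v), 8 := Suc (off v))\<rparr>"
    have "wp B (For 6 9 prog_edge) (?J v (length (smaller v))) ?s"
      by (rule inner[OF v])
        (use fr I r in simp_all)
    then have "wp B (For 6 9 prog_edge) (\<lambda>s''. ?I (Suc v) (set_reg s'' 5 (Suc v))) ?s"
      by (rule wp_mono) (simp add: off_Suc edges_below_Suc)
    then show "wp B ?c (\<lambda>s''. ?I (Suc v) (set_reg s'' 5 (Suc v))) s'"
      using I e by simp
  qed (use t nB in \<open>simp_all add: has_rows_def prog_edge_def edges_below_def\<close>)
  let ?s = "s\<lparr>reg := (reg s)(8 := off 0, 10 := of_bool (card C \<le> k))\<rparr>"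
  have "wp B (For 5 22 ?c) (?I n) ?s"
    by (rule outer) (use s in \<open>simp_all add: stored_empty\<close>)
  then have "wp B (For 5 22 ?c) (stored E) ?s"
    by (rule wp_mono) (simp add: edges_below_n)
  then show ?thesis
    using s unfolding prog_edges_def
    by (cases "card C \<le> k") (simp_all add: reads_def has_rows_def off_0 add.commute)
qed

lemma bval_is_outer:
  assumes "\<And>v. arr s 8 v = of_bool (v \<in> C)" "stored E s" "reg s x < n"
  shows "bval (is_outer x) s \<longleftrightarrow> reg s x \<in> outer n E C"
  using assms by (simp add: is_outer_def stored_def outer_def)

lemma wp_count:
  assumes s: "has_rows s" "has_cover s" "stored E s"
  shows "wp B prog_count (\<lambda>s'. reg s' 11 = card (outer n E C)) s"
proof -
  let ?I = "\<lambda>i s'. reg s' 11 = card {u \<in> outer n E C. u < i}"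
  let ?c = "If (is_outer 5) (Assign 11 (Plus (Reg 11) (Const 1))) Skip"
  have "wp B (For 5 22 ?c) (?I n) (set_reg s 11 0)"
  proof (rule wp_For[where Inv = ?I])
    fix i s' assume i: "i < n" and a: "agree (For 5 22 ?c) (set_reg s 11 0) s'"
      and r: "reg s' 5 = i" and I: "?I i s'"
    have "arr s' 8 v = of_bool (v \<in> C)" "stored E s'" for v
      using s a by (simp_all add: has_cover_def stored_def agree_def)
    from bval_is_outer[OF this, of 5] i r have b: "bval (is_outer 5) s' \<longleftrightarrow> i \<in> outer n E C" by simp
    have "{u \<in> outer n E C. u < Suc i}
      = (if i \<in> outer n E C then insert i {u \<in> outer n E C. u < i} else {u \<in> outer n E C. u < i})"
      by (auto simp: less_Suc_eq)
    then have "card {u \<in> outer n E C. u < Suc i}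
      = (if i \<in> outer n E C then Suc (card {u \<in> outer n E C. u < i}) else card {u \<in> outer n E C. u < i})"
      by simp
    then show "wp B ?c (\<lambda>s''. ?I (Suc i) (set_reg s'' 5 (Suc i))) s'"
      using I b by simp
  qed (use s nB in \<open>auto simp: has_rows_def\<close>)
  moreover have "{u \<in> outer n E C. u < n} = outer n E C" by (auto simp: outer_def)
  ultimately show ?thesis unfolding prog_count_def by simp
qed

end

section \<open>Programs: group size and grouping\<close>

text \<open>Register 14 becomes q = 64 D |C|^2 2^|C|, with the power obtained by doubling, and
  register 15 becomes a = A n', where n' is the count in register 11. For a nonempty cover, register
  16 receives the integer quotient a / q, or 1 if that is 0; register 17 holds the next multiple of
  q. The division has a rounds, so q may be exponential while all loops stay polynomial.\<close>

definition prog_arith :: "nat \<Rightarrow> nat \<Rightarrow> com" where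
  "prog_arith A D = Seq (Assign 12 (Const 0)) (Seq (For 5 23 (Assign 12 (Plus (Reg 12) (Reg 23))))
    (Seq (Assign 13 (Const (64 * D))) (Seq (For 5 23 (Assign 13 (Plus (Reg 13) (Reg 13))))
    (Seq (Assign 14 (Const 0)) (Seq (For 5 12 (Assign 14 (Plus (Reg 14) (Reg 13))))
    (Seq (Assign 15 (Const 0)) (Seq (For 5 11 (Assign 15 (Plus (Reg 15) (Const A))))
    (Seq (Assign 16 (Const 0)) (Seq (Assign 17 (Reg 14))
    (Seq (For 5 15 (If (Not (Less (Reg 15) (Reg 17)))
        (Seq (Assign 16 (Plus (Reg 16) (Const 1))) (Assign 17 (Plus (Reg 17) (Reg 14)))) Skip))
      (If (Equal (Reg 16) (Const 0)) (Assign 16 (Const 1)) Skip)))))))))))"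

definition prog_same :: com where
  "prog_same = Seq (Assign 20 (Const 1)) (For 7 22
     (If (Equal (Cell 9 (Plus (Cell 5 (Cell 6 (Reg 21))) (Reg 7))) (Cell 9 (Plus (Cell 5 (Reg 5)) (Reg 7))))
       Skip (Assign 20 (Const 0))))"

text \<open>Register 19 starts with the number of groups, an index not yet in use, which
  \<open>prog_insert\<close> understands as the request to open a new group. Full groups and groups
  of the cover are passed over.\<close>

definition prog_find :: com where
  "prog_find = Seq (Assign 19 (Reg 18)) (For 21 18
     (If (And (Not (Less (Reg 21) (Reg 23))) (Less (Cell 11 (Reg 21)) (Reg 16)))
       (Seq prog_same (If (Equal (Reg 20) (Const 1)) (Assign 19 (Reg 21)) Skip)) Skip))"

definition prog_insert :: com where
  "prog_insert = Seq (If (Equal (Reg 19) (Reg 18))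
       (Seq (Store 6 (Reg 18) (Reg 5)) (Assign 18 (Plus (Reg 18) (Const 1)))) Skip)
     (Seq (Store 7 (Reg 5) (Reg 19)) (Store 11 (Reg 19) (Plus (Cell 11 (Reg 19)) (Const 1))))"

definition prog_groups :: com where
  "prog_groups = Seq (Assign 18 (Reg 23))
     (For 5 22 (If (is_outer 5) (Seq prog_find prog_insert) Skip))"

definition prep :: "nat \<Rightarrow> nat \<Rightarrow> com" where
  "prep A D = Seq prog_rows (Seq prog_cover (Seq prog_edges (Seq prog_count
     (Seq (prog_arith A D) prog_groups))))"

text \<open>The approximation ratio is \<open>1 + A / D\<close>.\<close>

locale ola_input_eps = ola_input +
  fixes A D :: nat
  assumes D: "0 < D" and n2B: "2 * n \<le> B" and kkB: "(card C)\<^sup>2 \<le> B" and AnB: "A * n \<le> B"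
begin

text \<open>The first bound on register 16 keeps the error of the random layout small, the second
  one the number of groups. An empty cover is exempt: there the divisor is 0, and
  \<open>good_test\<close> leads to the empty instance.\<close>

definition "has_size s \<longleftrightarrow> reg s 12 = (card C)\<^sup>2 \<and> 0 < reg s 16 \<and> (0 < card C \<longrightarrow>
  (reg s 16 = 1 \<or> 64 * D * (card C)\<^sup>2 * 2 ^ card C * reg s 16 \<le> A * card (outer n E C)) \<and>
  A * card (outer n E C) \<le> 2 * (64 * D * (card C)\<^sup>2 * 2 ^ card C) * reg s 16)"

lemma wp_mult:
  assumes "reg s r = N" "N \<le> B" "x \<noteq> 5" "r \<noteq> 5" "r \<noteq> x" "reg s x = 0" "5 \<noteq> y" "x \<noteq> y" "reg s y = c"
  shows "wp B (For 5 r (Assign x (Plus (Reg x) (Reg y)))) (\<lambda>s'. reg s' x = N * c) s"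
proof (rule wp_For[where Inv = "\<lambda>i s'. reg s' x = i * c"])
  fix i s' assume "agree (For 5 r (Assign x (Plus (Reg x) (Reg y)))) s s'" "reg s' x = i * c"
  then show "wp B (Assign x (Plus (Reg x) (Reg y)))
    (\<lambda>s''. reg (set_reg s'' 5 (Suc i)) x = Suc i * c) s'"
    using assms agree_regD[of _ s s' y] by simp
qed (use assms in simp_all)

lemma card_outer_n: "card (outer n E C) \<le> n"
  using card_mono[of "{..<n}" "outer n E C"] by (auto simp: outer_def)

lemma wp_arith:
  assumes s: "has_rows s" "reg s 11 = card (outer n E C)"
  shows "wp B (prog_arith A D) has_size s"
proof -
  define k where "k = card C"
  define a where "a = A * card (outer n E C)"
  define q where "q = 64 * D * k\<^sup>2 * 2 ^ k"
  have B: "k \<le> B" "k\<^sup>2 \<le> B" "card (outer n E C) \<le> B" "a \<le> B"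
    using cB kkB card_outer_n nB order.trans[OF mult_le_mono2[OF card_outer_n, of A] AnB]
    by (simp_all add: k_def a_def)
  have 1: "wp B (For 5 23 (Assign 12 (Plus (Reg 12) (Reg 23)))) (\<lambda>t'. reg t' 12 = k\<^sup>2) t"
    if "reg t 23 = k" "reg t 12 = 0" for t
    using wp_mult[of t 23 k 12 23 k] that B by (simp add: power2_eq_square)
  have 2: "wp B (For 5 23 (Assign 13 (Plus (Reg 13) (Reg 13)))) (\<lambda>t'. reg t' 13 = 64 * D * 2 ^ k) t"
    if "reg t 23 = k" "reg t 13 = 64 * D" for t
    by (rule wp_For[where Inv = "\<lambda>i t'. reg t' 13 = 64 * D * 2 ^ i"]) (use that B in simp_all)
  have 3: "wp B (For 5 12 (Assign 14 (Plus (Reg 14) (Reg 13)))) (\<lambda>t'. reg t' 14 = q) t"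
    if "reg t 12 = k\<^sup>2" "reg t 14 = 0" "reg t 13 = 64 * D * 2 ^ k" for t
    using wp_mult[of t 12 "k\<^sup>2" 14 13 "64 * D * 2 ^ k"] that B by (simp add: q_def mult_ac)
  have 4: "wp B (For 5 11 (Assign 15 (Plus (Reg 15) (Const A)))) (\<lambda>t'. reg t' 15 = a) t"
    if "reg t 11 = card (outer n E C)" "reg t 15 = 0" for t
    using wp_For[where Inv = "\<lambda>i t'. reg t' 15 = A * i" and x = 5 and s = t and r = 11] that B
    by (simp add: a_def)
  let ?c = "If (Not (Less (Reg 15) (Reg 17)))
        (Seq (Assign 16 (Plus (Reg 16) (Const 1))) (Assign 17 (Plus (Reg 17) (Reg 14)))) Skip"
  let ?I = "\<lambda>i t. reg t 17 = q * Suc (reg t 16) \<and> q * reg t 16 \<le> a \<and> (reg t 16 = i \<or> a < q * Suc (reg t 16))"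
  have 5: "wp B (For 5 15 ?c) (?I a) t"
    if t: "reg t 15 = a" "reg t 16 = 0" "reg t 17 = q" "reg t 14 = q" for t
  proof (rule wp_For[where Inv = ?I])
    fix i t' assume ag: "agree (For 5 15 ?c) t t'" and I: "?I i t'"
    have "reg t' 15 = a" "reg t' 14 = q"
      using agree_regD[OF ag, of 15] agree_regD[OF ag, of 14] t by simp_all
    with I show "wp B ?c (\<lambda>t''. ?I (Suc i) (set_reg t'' 5 (Suc i))) t'"
      by (auto simp: not_less)
  qed (use t B in simp_all)
  have fin: "has_size t'" if "reg t' 12 = k\<^sup>2" and r16: "reg t' 16 = (if M = 0 then 1 else M)" and "q * M \<le> a"
    "M = a \<or> a < q * Suc M" for t' M
  proof -
    \<comment> \<open>\<open>M = a\<close> means that the loop used up its rounds while still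
      counting. As \<open>q\<close> is positive, the inequality holds then, too.\<close>
    have "a < q * Suc M" if "0 < k"
    proof -
      have "0 < q" using that D by (simp add: q_def)
      then have "Suc a \<le> q * Suc a" using mult_le_mono1[of 1 q "Suc a"] by simp
      then have "a < q * Suc a" by (rule Suc_le_lessD)
      with \<open>M = a \<or> a < q * Suc M\<close> show ?thesis by blast
    qed
    \<comment> \<open>Rounding down loses at most a factor 2: either the quotient is 0 and a < q, or
      it is at least 1 and M + 1 \<le> 2 M.\<close>
    then have "a \<le> 2 * q * reg t' 16" if "0 < k"
    proof (cases M)
      case 0
      with \<open>0 < k \<Longrightarrow> a < q * Suc M\<close>[OF that] r16 show ?thesis by simp
    next
      case (Suc M')
      then have "q * Suc M \<le> q * (2 * M)" by (intro mult_le_mono2) simp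
      with Suc \<open>0 < k \<Longrightarrow> a < q * Suc M\<close>[OF that] r16 show ?thesis by simp
    qed
    moreover have "0 < reg t' 16" "reg t' 16 = 1 \<or> q * reg t' 16 \<le> a" using that(2,3) by simp_all
    ultimately show ?thesis using that(1)
      unfolding has_size_def k_def[symmetric] a_def[symmetric] q_def[symmetric] by blast
  qed
  show ?thesis
    unfolding prog_arith_def wp.simps
    apply (rule wp_agree_mono, rule 1)
    subgoal using s by (simp add: has_rows_def k_def)
    subgoal by simp
    subgoal for t1
    apply (rule wp_agree_mono, rule 2)
    subgoal using s by (simp add: has_rows_def k_def agree_def)
    subgoal by simp
    subgoal for t2
    apply (rule wp_agree_mono, rule 3)
    subgoal by (simp add: agree_def)
    subgoal by simp
    subgoal by simp
    subgoal for t3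
    apply (rule wp_agree_mono, rule 4)
    subgoal using s by (simp add: agree_def)
    subgoal by simp
    subgoal for t4
    apply (rule wp_agree_mono, rule 5)
    subgoal by simp
    subgoal by simp
    subgoal by (simp add: agree_def)
    subgoal by (simp add: agree_def)
    subgoal for t5
      apply (simp only: wp.simps bval.simps aval.simps)
      apply (split if_split, intro conjI impI)
      subgoal by (rule fin[of _ "reg t5 16"]) (simp_all add: agree_def)
      subgoal by (rule fin[of _ "reg t5 16"]) (simp_all add: agree_def)
      done
    done done done done done
qed

section \<open>Distributing the vertices over groups\<close>

lemma wp_same:
  assumes s: "has_rows s" "stored E s" and r: "arr s 6 (reg s 21) = x" "x < n" "reg s 5 = v" "v < n"
  shows "wp B prog_same (\<lambda>s'. reg s' 20 = of_bool (nbs E x = nbs E v)) s"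
proof -
  let ?c = "If (Equal (Cell 9 (Plus (Cell 5 (Cell 6 (Reg 21))) (Reg 7))) (Cell 9 (Plus (Cell 5 (Reg 5)) (Reg 7))))
       Skip (Assign 20 (Const 0))"
  let ?I = "\<lambda>i s'. reg s' 20 = of_bool (\<forall>w<i. {x, w} \<in> E \<longleftrightarrow> {v, w} \<in> E)"
  let ?s = "set_reg s 20 1"
  have "wp B (For 7 22 ?c) (?I n) ?s"
  proof (rule wp_For[where Inv = ?I])
    fix i s' assume i: "i < n" and a: "agree (For 7 22 ?c) ?s s'" and r': "reg s' 7 = i" and I: "?I i s'"
    have regs: "reg s' 21 = reg s 21" "reg s' 5 = v" and arrs: "arr s' = arr s"
      using a r by (auto simp: agree_def)
    have b: "bval (Equal (Cell 9 (Plus (Cell 5 (Cell 6 (Reg 21))) (Reg 7))) (Cell 9 (Plus (Cell 5 (Reg 5)) (Reg 7)))) s'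
      \<longleftrightarrow> ({x, i} \<in> E \<longleftrightarrow> {v, i} \<in> E)"
      using s r i by (simp add: regs arrs r' has_rows_def stored_def)
    show "wp B ?c (\<lambda>s''. ?I (Suc i) (set_reg s'' 7 (Suc i))) s'"
      unfolding wp.simps b using I by (auto simp: less_Suc_eq)
  qed (use s nB in \<open>simp_all add: has_rows_def\<close>)
  moreover have "(\<forall>w<n. {x, w} \<in> E \<longleftrightarrow> {v, w} \<in> E) \<longleftrightarrow> nbs E x = nbs E v"
  proof
    assume *: "\<forall>w<n. {x, w} \<in> E \<longleftrightarrow> {v, w} \<in> E"
    have "{x, w} \<in> E \<longleftrightarrow> {v, w} \<in> E" for w
      using * simple_graphD(2)[OF G, of x w] simple_graphD(2)[OF G, of v w] by blast
    then show "nbs E x = nbs E v" by (simp add: nbs_def)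
  qed (auto simp: nbs_def set_eq_iff)
  ultimately show ?thesis by (simp add: prog_same_def)
qed

definition "matches s v h \<longleftrightarrow> card C \<le> h \<and> arr s 11 h < reg s 16 \<and> nbs E (arr s 6 h) = nbs E v"

lemma wp_find:
  assumes s: "has_rows s" "stored E s" and N: "reg s 18 = N" "N \<le> B"
    and rep: "\<And>h. h < N \<Longrightarrow> arr s 6 h < n" and v: "reg s 5 = v" "v < n"
  shows "wp B prog_find (\<lambda>s'. reg s' 19 = N \<and> (\<forall>h<N. \<not> matches s v h) \<or>
    reg s' 19 < N \<and> matches s v (reg s' 19)) s"
proof -
  let ?b = "And (Not (Less (Reg 21) (Reg 23))) (Less (Cell 11 (Reg 21)) (Reg 16))"
  let ?i = "If (Equal (Reg 20) (Const 1)) (Assign 19 (Reg 21)) Skip"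
  let ?c = "If ?b (Seq prog_same ?i) Skip"
  let ?I = "\<lambda>i s'. reg s' 19 = N \<and> (\<forall>h<i. \<not> matches s v h) \<or> reg s' 19 < N \<and> matches s v (reg s' 19)"
  let ?s = "set_reg s 19 N"
  have "wp B (For 21 18 ?c) (?I N) ?s"
  proof (rule wp_For[where Inv = ?I])
    fix i s' assume i: "i < N" and a: "agree (For 21 18 ?c) ?s s'" and r: "reg s' 21 = i" and I: "?I i s'"
    have arrs: "arr s' = arr s" and regs: "reg s' 5 = v" "reg s' 16 = reg s 16" "reg s' 23 = card C"
      using a v s(1) by (auto simp: agree_def prog_same_def has_rows_def)
    have st: "has_rows s'" "stored E s'"
      using has_rows_agree[OF _ a] stored_agree[OF _ a] s by (simp_all add: prog_same_def)
    show "wp B ?c (\<lambda>s''. ?I (Suc i) (set_reg s'' 21 (Suc i))) s'"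
    proof (cases "bval ?b s'")
      case False
      then have "\<not> matches s v i" by (auto simp: matches_def r regs arrs)
      then show ?thesis unfolding wp.simps if_not_P[OF False] using I by (auto simp: less_Suc_eq)
    next
      case True
      then have b: "card C \<le> i" "arr s 11 i < reg s 16" by (auto simp: r regs arrs)
      have "wp B prog_same (\<lambda>s'. reg s' 20 = of_bool (nbs E (arr s 6 i) = nbs E v)) s'"
        by (rule wp_same[OF st]) (simp_all add: r regs arrs rep i v)
      then have "wp B prog_same (wp B ?i (\<lambda>s''. ?I (Suc i) (set_reg s'' 21 (Suc i)))) s'"
      proof (rule wp_agree_mono)
        fix s'' assume e: "reg s'' 20 = of_bool (nbs E (arr s 6 i) = nbs E v)" and a': "agree prog_same s' s''"
        have g: "reg s'' 19 = reg s' 19" "reg s'' 21 = i"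
          using a' r by (auto simp: agree_def prog_same_def)
        have m: "matches s v i \<longleftrightarrow> nbs E (arr s 6 i) = nbs E v" using b by (simp add: matches_def)
        show "wp B ?i (\<lambda>s''. ?I (Suc i) (set_reg s'' 21 (Suc i))) s''"
        proof (cases "matches s v i")
          case True
          then show ?thesis using e m g i by simp
        next
          case False
          then show ?thesis using e m g I by (auto simp: less_Suc_eq)
        qed
      qed
      then show ?thesis unfolding wp.simps if_P[OF True] .
    qed
  qed (use N in \<open>simp_all add: prog_same_def\<close>)
  then show ?thesis using N by (simp add: prog_find_def)
qed

text \<open>The loop invariant: \<open>grouping\<close> restricted to vertices below
  \<open>v\<close>, with sizes tabulated in \<open>cnt\<close>. The bound
  \<open>N \<le> card C + v\<close> limits the search loop to \<open>2 * n\<close> rounds, and the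
  zero counters beyond \<open>N\<close> let a new group start empty. A predicate with a single rule
  bundles the clauses; \<open>groupsD\<close> takes them apart.\<close>

inductive groups :: "nat \<Rightarrow> nat \<Rightarrow> nat \<Rightarrow> (nat \<Rightarrow> nat) \<Rightarrow> (nat \<Rightarrow> nat) \<Rightarrow> (nat \<Rightarrow> nat) \<Rightarrow> bool"
  for m v N rep g cnt where
  groupsI: "card C \<le> N \<Longrightarrow> N \<le> card C + v \<Longrightarrow>
    (\<And>j. j < card C \<Longrightarrow> rep j = cl ! j \<and> g (cl ! j) = j) \<Longrightarrow>
    (\<And>u. u \<in> outer n E C \<Longrightarrow> u < v \<Longrightarrow> card C \<le> g u \<and> g u < N \<and> nbs E (rep (g u)) = nbs E u) \<Longrightarrow>
    (\<And>h. card C \<le> h \<Longrightarrow> h < N \<Longrightarrow> rep h \<in> outer n E C \<and> rep h < v \<and> g (rep h) = h \<and>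
      cnt h = card {u \<in> outer n E C. u < v \<and> g u = h} \<and> cnt h \<le> m) \<Longrightarrow>
    (\<And>h. N \<le> h \<Longrightarrow> cnt h = 0) \<Longrightarrow>
    (\<And>h h'. card C \<le> h \<Longrightarrow> h < N \<Longrightarrow> card C \<le> h' \<Longrightarrow> h' < N \<Longrightarrow> cnt h < m \<Longrightarrow> cnt h' < m \<Longrightarrow>
      nbs E (rep h) = nbs E (rep h') \<Longrightarrow> h = h') \<Longrightarrow> groups m v N rep g cnt"

lemma card_group_insert:
  fixes v :: nat
  assumes "v \<in> X" "finite X"
  shows "card {u \<in> X. u < Suc v \<and> (g(v := f)) u = h}
    = card {u \<in> X. u < v \<and> g u = h} + of_bool (h = f)"
proof (cases "h = f")
  case True
  then have "{u \<in> X. u < Suc v \<and> (g(v := f)) u = h} = insert v {u \<in> X. u < v \<and> g u = h}"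
    using assms(1) by auto
  with True assms(2) show ?thesis by simp
next
  case False
  then have "{u \<in> X. u < Suc v \<and> (g(v := f)) u = h} = {u \<in> X. u < v \<and> g u = h}"
    by auto
  with False show ?thesis by simp
qed

lemma groupsD:
  assumes "groups m v N rep g cnt"
  shows "card C \<le> N" "N \<le> card C + v"
    and "\<And>j. j < card C \<Longrightarrow> rep j = cl ! j \<and> g (cl ! j) = j"
    and "\<And>u. u \<in> outer n E C \<Longrightarrow> u < v \<Longrightarrow> card C \<le> g u \<and> g u < N \<and> nbs E (rep (g u)) = nbs E u"
    and "\<And>h. card C \<le> h \<Longrightarrow> h < N \<Longrightarrow> rep h \<in> outer n E C \<and> rep h < v \<and> g (rep h) = h \<and>
      cnt h = card {u \<in> outer n E C. u < v \<and> g u = h} \<and> cnt h \<le> m"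
    and "\<And>h. N \<le> h \<Longrightarrow> cnt h = 0"
    and "\<And>h h'. card C \<le> h \<Longrightarrow> h < N \<Longrightarrow> card C \<le> h' \<Longrightarrow> h' < N \<Longrightarrow> cnt h < m \<Longrightarrow> cnt h' < m \<Longrightarrow>
      nbs E (rep h) = nbs E (rep h') \<Longrightarrow> h = h'"
  by (rule groups.cases[OF assms], blast)+

lemma groups_skip:
  assumes gr: "groups m v N rep g cnt" and v: "v \<notin> outer n E C"
  shows "groups m (Suc v) N rep g cnt"
proof -
  note gr = groupsD[OF gr]
  have e: "u < v" if "u \<in> outer n E C" "u < Suc v" for u
    using that v by (cases "u = v") auto
  then have c: "{u \<in> outer n E C. u < Suc v \<and> g u = h} = {u \<in> outer n E C. u < v \<and> g u = h}" for h
    by (intro Collect_cong) (metis less_SucI)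
  show ?thesis
  proof (rule groupsI)
    show "N \<le> card C + Suc v" using gr(2) by simp
  next
    fix u assume u: "u \<in> outer n E C" "u < Suc v"
    show "card C \<le> g u \<and> g u < N \<and> nbs E (rep (g u)) = nbs E u" by (rule gr(4)[OF u(1) e[OF u]])
  next
    fix h assume "card C \<le> h" "h < N"
    from gr(5)[OF this] show "rep h \<in> outer n E C \<and> rep h < Suc v \<and> g (rep h) = h \<and>
      cnt h = card {u \<in> outer n E C. u < Suc v \<and> g u = h} \<and> cnt h \<le> m"
      unfolding c by simp
  qed (fact gr)+
qed

lemma finite_outer' [simp]: "finite (outer n E C)"
  by (simp add: outer_def)

lemma cl_not_outer: "v \<in> outer n E C \<Longrightarrow> j < card C \<Longrightarrow> cl ! j \<noteq> v"
  using set_cl nth_mem[of j cl] by (auto simp: outer_def)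

lemma groups_old:
  assumes gr: "groups m v N rep g cnt" and v: "v \<in> outer n E C"
    and f: "card C \<le> f" "f < N" "cnt f < m" "nbs E (rep f) = nbs E v"
  shows "groups m (Suc v) N rep (g(v := f)) (cnt(f := Suc (cnt f)))"
proof -
  note gr = groupsD[OF gr]
  show ?thesis
  proof (rule groupsI)
    show "card C \<le> N" "N \<le> card C + Suc v" using gr(1,2) by simp_all
  next
    fix j assume j: "j < card C"
    from gr(3)[OF j] cl_not_outer[OF v j] show "rep j = cl ! j \<and> (g(v := f)) (cl ! j) = j" by simp
  next
    fix u assume u: "u \<in> outer n E C" "u < Suc v"
    show "card C \<le> (g(v := f)) u \<and> (g(v := f)) u < N \<and> nbs E (rep ((g(v := f)) u)) = nbs E u"
    proof (cases "u = v")
      case False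
      with u(2) have "u < v" by simp
      with gr(4)[OF u(1) this] show ?thesis by simp
    qed (use f in simp)
  next
    fix h assume "card C \<le> h" "h < N"
    from gr(5)[OF this] f(3) show "rep h \<in> outer n E C \<and> rep h < Suc v \<and> (g(v := f)) (rep h) = h \<and>
      (cnt(f := Suc (cnt f))) h = card {u \<in> outer n E C. u < Suc v \<and> (g(v := f)) u = h} \<and>
      (cnt(f := Suc (cnt f))) h \<le> m"
      unfolding card_group_insert[OF v finite_outer'] by (cases "h = f") simp_all
  next
    fix h assume "N \<le> h"
    with gr(6)[of h] f(2) show "(cnt(f := Suc (cnt f))) h = 0" by simp
  next
    fix h h' assume h: "card C \<le> h" "h < N" "card C \<le> h'" "h' < N"
      and c: "(cnt(f := Suc (cnt f))) h < m" "(cnt(f := Suc (cnt f))) h' < m"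
      and e: "nbs E (rep h) = nbs E (rep h')"
    have "cnt h < m" "cnt h' < m" using c by (simp_all split: if_splits)
    from gr(7)[OF h this e] show "h = h'" .
  qed
qed

text \<open>A new group is opened only if all groups with this neighbourhood are full, so it is the
  only one among them that may be non-full.\<close>

lemma groups_new:
  assumes gr: "groups m v N rep g cnt" and v: "v \<in> outer n E C" and m: "0 < m"
    and no: "\<And>h. card C \<le> h \<Longrightarrow> h < N \<Longrightarrow> cnt h < m \<Longrightarrow> nbs E (rep h) \<noteq> nbs E v"
  shows "groups m (Suc v) (Suc N) (rep(N := v)) (g(v := N)) (cnt(N := Suc (cnt N)))"
proof -
  note gr = groupsD[OF gr]
  have "{u \<in> outer n E C. u < v \<and> g u = N} = {}"
  proof (rule equals0I)
    fix u assume "u \<in> {u \<in> outer n E C. u < v \<and> g u = N}"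
    with gr(4)[of u] show False by simp
  qed
  then have none: "card {u \<in> outer n E C. u < v \<and> g u = N} = 0" by (simp only: card.empty)
  have c0: "cnt N = 0" by (rule gr(6)) simp
  show ?thesis
  proof (rule groupsI)
    show "card C \<le> Suc N" "Suc N \<le> card C + Suc v" using gr(1,2) by simp_all
  next
    fix j assume j: "j < card C"
    then have "j \<noteq> N" using gr(1) by simp
    with gr(3)[OF j] cl_not_outer[OF v j] show "(rep(N := v)) j = cl ! j \<and> (g(v := N)) (cl ! j) = j" by simp
  next
    fix u assume u: "u \<in> outer n E C" "u < Suc v"
    show "card C \<le> (g(v := N)) u \<and> (g(v := N)) u < Suc N \<and> nbs E ((rep(N := v)) ((g(v := N)) u)) = nbs E u"
    proof (cases "u = v")
      case False
      with u(2) have "u < v" by simp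
      with gr(4)[OF u(1) this] False show ?thesis by simp
    qed (use gr(1) in simp)
  next
    fix h assume h: "card C \<le> h" "h < Suc N"
    show "(rep(N := v)) h \<in> outer n E C \<and> (rep(N := v)) h < Suc v \<and> (g(v := N)) ((rep(N := v)) h) = h \<and>
      (cnt(N := Suc (cnt N))) h = card {u \<in> outer n E C. u < Suc v \<and> (g(v := N)) u = h} \<and>
      (cnt(N := Suc (cnt N))) h \<le> m"
    proof (cases "h = N")
      case True
      then show ?thesis unfolding card_group_insert[OF v finite_outer'] using v m none c0 by simp
    next
      case False
      with h(2) have "h < N" by simp
      from gr(5)[OF h(1) this] False show ?thesis
        unfolding card_group_insert[OF v finite_outer'] by simp
    qed
  next
    fix h assume "Suc N \<le> h"
    with gr(6)[of h] show "(cnt(N := Suc (cnt N))) h = 0" by simp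
  next
    fix h h' assume h: "card C \<le> h" "h < Suc N" "card C \<le> h'" "h' < Suc N"
      and c: "(cnt(N := Suc (cnt N))) h < m" "(cnt(N := Suc (cnt N))) h' < m"
      and e: "nbs E ((rep(N := v)) h) = nbs E ((rep(N := v)) h')"
    consider "h = N" "h' = N" | "h = N" "h' < N" | "h < N" "h' = N" | "h < N" "h' < N"
      using h by linarith
    then show "h = h'"
    proof cases
      case 1
      then show ?thesis by simp
    next
      case 2
      with no[OF h(3)] c e show ?thesis by simp
    next
      case 3
      with no[OF h(1)] c e show ?thesis by simp
    next
      case 4
      then have "h \<noteq> N" "h' \<noteq> N" by simp_all
      with gr(7)[OF h(1) 4(1) h(3) 4(2)] c e show ?thesis by simp
    qed
  qed
qed

definition "has_groups m v s \<longleftrightarrow> groups m v (reg s 18) (arr s 6) (arr s 7) (arr s 11)"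

lemma has_groups_upd [simp]: "x \<noteq> 18 \<Longrightarrow> has_groups m v (s\<lparr>reg := r(x := y)\<rparr>) \<longleftrightarrow> has_groups m v (s\<lparr>reg := r\<rparr>)"
  by (simp add: has_groups_def)

lemma outer_less: "v \<in> outer n E C \<Longrightarrow> v < n"
  by (simp add: outer_def)

lemma has_groups_bounds:
  assumes "has_groups m v s" "v \<le> n"
  shows "reg s 18 \<le> B" "\<And>h. h < reg s 18 \<Longrightarrow> arr s 6 h < n"
proof -
  note gr = groupsD[OF assms(1)[unfolded has_groups_def]]
  have "card C \<le> n" using card_mono[OF _ C] by simp
  with gr(2) assms(2) n2B show "reg s 18 \<le> B" by linarith
  fix h assume h: "h < reg s 18"
  show "arr s 6 h < n"
  proof (cases "h < card C")
    case True
    then show ?thesis using gr(3)[OF True] cl_less[OF True] by simp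
  next
    case False
    then show ?thesis using gr(5)[of h] h outer_less by simp
  qed
qed

lemma wp_insert:
  assumes s: "has_groups m v s" "reg s 5 = v" "v \<in> outer n E C" "reg s 16 = m" "0 < m"
    and f: "reg s 19 = reg s 18 \<and> (\<forall>h<reg s 18. \<not> matches s v h) \<or>
      reg s 19 < reg s 18 \<and> matches s v (reg s 19)"
  shows "wp B prog_insert (has_groups m (Suc v)) s"
  using f
proof (elim disjE conjE)
  assume e: "reg s 19 = reg s 18" and no: "\<forall>h<reg s 18. \<not> matches s v h"
  have "groups m (Suc v) (Suc (reg s 18)) ((arr s 6)(reg s 18 := v)) ((arr s 7)(v := reg s 18))
    ((arr s 11)(reg s 18 := Suc (arr s 11 (reg s 18))))"
  proof (rule groups_new[OF s(1)[unfolded has_groups_def] s(3,5)])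
    fix h assume "card C \<le> h" "h < reg s 18" "arr s 11 h < m"
    with no s(4) show "nbs E (arr s 6 h) \<noteq> nbs E v" by (simp add: matches_def)
  qed
  then show ?thesis unfolding prog_insert_def using e s(2) by (simp add: has_groups_def)
next
  assume lt: "reg s 19 < reg s 18" and mt: "matches s v (reg s 19)"
  have "groups m (Suc v) (reg s 18) (arr s 6) ((arr s 7)(v := reg s 19))
    ((arr s 11)(reg s 19 := Suc (arr s 11 (reg s 19))))"
    by (rule groups_old[OF s(1)[unfolded has_groups_def] s(3)]) (use mt lt s(4) in \<open>simp_all add: matches_def\<close>)
  then show ?thesis unfolding prog_insert_def using lt s(2) by (simp add: has_groups_def)
qed

lemma groups_0:
  assumes s: "has_rows s" "has_cover s" "arr s 11 = (\<lambda>_. 0)"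
  shows "has_groups m 0 (set_reg s 18 (card C))"
  unfolding has_groups_def by (rule groupsI) (use s in \<open>simp_all add: has_cover_def\<close>)

lemma wp_groups:
  assumes s: "has_rows s" "has_cover s" "stored E s" "arr s 11 = (\<lambda>_. 0)" "reg s 16 = m" "0 < m"
  shows "wp B prog_groups (has_groups m n) s"
proof -
  let ?c = "If (is_outer 5) (Seq prog_find prog_insert) Skip"
  let ?s = "set_reg s 18 (card C)"
  have "wp B (For 5 22 ?c) (has_groups m n) ?s"
  proof (rule wp_For[where Inv = "has_groups m"])
    fix v s' assume v: "v < n" and a: "agree (For 5 22 ?c) ?s s'" and r: "reg s' 5 = v"
      and I: "has_groups m v s'"
    have st: "has_rows s'" "stored E s'" and m: "reg s' 16 = m"
      using has_rows_agree[OF _ a] stored_agree[OF _ a] agree_regD[OF a, of 16] s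
      by (simp_all add: prog_find_def prog_same_def prog_insert_def)
    have "arr s' 8 = arr s 8"
      using agree_arrD[OF a, of 8] by (simp add: prog_find_def prog_same_def prog_insert_def)
    then have "arr s' 8 u = of_bool (u \<in> C)" for u using s(2) by (simp add: has_cover_def)
    from bval_is_outer[OF this st(2), of 5] r v
    have b: "bval (is_outer 5) s' \<longleftrightarrow> v \<in> outer n E C" by simp
    show "wp B ?c (\<lambda>s''. has_groups m (Suc v) (set_reg s'' 5 (Suc v))) s'"
    proof (cases "v \<in> outer n E C")
      case True
      have "wp B prog_find (\<lambda>s''. reg s'' 19 = reg s' 18 \<and> (\<forall>h<reg s' 18. \<not> matches s' v h) \<or>
        reg s'' 19 < reg s' 18 \<and> matches s' v (reg s'' 19)) s'"
        by (rule wp_find[OF st refl]) (use has_groups_bounds[OF I] v r in simp_all)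
      then have "wp B prog_find (wp B prog_insert (\<lambda>s''. has_groups m (Suc v) (set_reg s'' 5 (Suc v)))) s'"
      proof (rule wp_agree_mono)
        fix t assume f: "reg t 19 = reg s' 18 \<and> (\<forall>h<reg s' 18. \<not> matches s' v h) \<or>
          reg t 19 < reg s' 18 \<and> matches s' v (reg t 19)" and b: "agree prog_find s' t"
        have t: "arr t = arr s'" "reg t 18 = reg s' 18" "reg t 16 = m" "reg t 5 = v"
          using b m r by (auto simp: agree_def prog_find_def prog_same_def)
        have "matches t = matches s'" by (intro ext) (simp add: matches_def t m)
        then have "wp B prog_insert (has_groups m (Suc v)) t"
          using I f True s(6) t by (intro wp_insert) (simp_all add: has_groups_def)
        then show "wp B prog_insert (\<lambda>s''. has_groups m (Suc v) (set_reg s'' 5 (Suc v))) t"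
          by (rule wp_mono) simp
      qed
      then show ?thesis using b True by simp
    next
      case False
      then have "has_groups m (Suc v) s'" using groups_skip I by (simp add: has_groups_def)
      then show ?thesis using b False by simp
    qed
  next
    show "has_groups m 0 (set_reg ?s 5 0)" using groups_0[OF s(1,2,4)] by simp
  qed (use s nB in \<open>simp_all add: has_rows_def prog_find_def prog_same_def prog_insert_def\<close>)
  then show ?thesis using s(1) by (simp add: prog_groups_def has_rows_def)
qed

definition "prepped s \<longleftrightarrow> has_rows s \<and> (\<forall>v. arr s 8 v = of_bool (v \<in> C)) \<and> stored E s \<and> has_size s \<and> has_groups (reg s 16) n s"

text \<open>Arrays 8 to 11 are read at places that were never written, so the default 0 has to mean
  non-membership, non-adjacency, isolation and an empty group.\<close>

lemma wp_prep:
  assumes s: "reads s" "\<And>a. a \<in> {8, 9, 10, 11} \<Longrightarrow> arr s a = (\<lambda>_. 0)"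
  shows "wp B (prep A D) prepped s"
  unfolding prep_def wp.simps
  apply (rule wp_agree_mono, rule wp_rows[OF s(1)])
  subgoal premises p1 for s1
  proof -
    note a1 = p1(2)
    have r1: "reads s1" using reads_agree[OF s(1) a1] by (simp add: prog_rows_def)
    have z1: "arr s1 a = (\<lambda>_. 0)" if "a \<in> {8, 9, 10, 11}" for a
      using agree_arrD[OF a1, of a] s(2)[OF that] that by (auto simp: prog_rows_def)
    show ?thesis
    proof (rule wp_agree_mono, rule wp_cover[OF r1 p1(1)])
      show "arr s1 8 = (\<lambda>_. 0)" by (rule z1) simp
      fix s2 assume s2: "has_cover s2" and a2: "agree prog_cover s1 s2"
      have r2: "reads s2" using reads_agree[OF r1 a2] by (simp add: prog_cover_def)
      have st1_2: "has_rows s2" using has_rows_agree[OF p1(1) a2] by (simp add: prog_cover_def)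
      have z2: "arr s2 9 = (\<lambda>_. 0)" "arr s2 10 = (\<lambda>_. 0)" "arr s2 11 = (\<lambda>_. 0)"
        using z1[of 9] z1[of 10] z1[of 11] a2 by (simp_all add: agree_def prog_cover_def)
      show "wp B prog_edges (wp B prog_count (wp B (prog_arith A D) (wp B prog_groups prepped))) s2"
      proof (rule wp_agree_mono, rule wp_edges[OF r2 st1_2 s2 z2(1,2)])
        fix s3 assume s3: "stored E s3" and a3: "agree prog_edges s2 s3"
        have st1_3: "has_rows s3" using has_rows_agree[OF st1_2 a3] by (simp add: prog_edges_def prog_edge_def)
        have st2_3: "has_cover s3" using has_cover_agree[OF s2 a3] by (simp add: prog_edges_def prog_edge_def)
        have z3: "arr s3 11 = (\<lambda>_. 0)"
          using agree_arrD[OF a3, of 11] z2(3) by (simp add: prog_edges_def prog_edge_def)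
        show "wp B prog_count (wp B (prog_arith A D) (wp B prog_groups prepped)) s3"
        proof (rule wp_agree_mono, rule wp_count[OF st1_3 st2_3 s3])
          fix s4 assume s4: "reg s4 11 = card (outer n E C)" and a4: "agree prog_count s3 s4"
          have st1_4: "has_rows s4" using has_rows_agree[OF st1_3 a4] by (simp add: prog_count_def)
          have st2_4: "has_cover s4" using has_cover_agree[OF st2_3 a4] by (simp add: prog_count_def)
          have st3_4: "stored E s4" using stored_agree[OF s3 a4] by (simp add: prog_count_def)
          have z4: "arr s4 11 = (\<lambda>_. 0)"
            using agree_arrD[OF a4, of 11] z3 by (simp add: prog_count_def)
          show "wp B (prog_arith A D) (wp B prog_groups prepped) s4"
          proof (rule wp_agree_mono, rule wp_arith[OF st1_4 s4])
            fix s5 assume s5: "has_size s5" and a5: "agree (prog_arith A D) s4 s5"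
            have st1_5: "has_rows s5" using has_rows_agree[OF st1_4 a5] by (simp add: prog_arith_def)
            have st2_5: "has_cover s5" using has_cover_agree[OF st2_4 a5] by (simp add: prog_arith_def)
            have st3_5: "stored E s5" using stored_agree[OF st3_4 a5] by (simp add: prog_arith_def)
            have z5: "arr s5 11 = (\<lambda>_. 0)"
              using agree_arrD[OF a5, of 11] z4 by (simp add: prog_arith_def)
            have m5: "0 < reg s5 16" using s5 by (simp add: has_size_def)
            show "wp B prog_groups prepped s5"
            proof (rule wp_agree_mono, rule wp_groups[OF st1_5 st2_5 st3_5 z5 refl m5])
              fix s6 assume s6: "has_groups (reg s5 16) n s6" and a6: "agree prog_groups s5 s6"
              note mod = prog_groups_def prog_find_def prog_same_def prog_insert_def
              have "has_rows s6" using has_rows_agree[OF st1_5 a6] by (simp add: mod)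
              moreover have "stored E s6" using stored_agree[OF st3_5 a6] by (simp add: mod)
              moreover have "arr s6 8 = arr s5 8" using agree_arrD[OF a6, of 8] by (simp add: mod)
              moreover have "reg s6 12 = reg s5 12" "reg s6 16 = reg s5 16"
                using agree_regD[OF a6, of 12] agree_regD[OF a6, of 16] by (simp_all add: mod)
              ultimately show "prepped s6" using s6 s5 st2_5 by (simp add: prepped_def has_size_def has_cover_def)
            qed
          qed
        qed
      qed
    qed
  qed
  done

lemma grouping_prepped:
  assumes p: "prepped s" and cover: "vertex_cover (n, E) C"
  shows "grouping n E C (reg s 16) (reg s 18) (arr s 6) (arr s 7)"
proof -
  note gr = groupsD[OF p[unfolded prepped_def has_groups_def, THEN conjunct2, THEN conjunct2, THEN conjunct2, THEN conjunct2]]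
  have e: "{u \<in> outer n E C. u < n \<and> arr s 7 u = h} = {u \<in> outer n E C. arr s 7 u = h}" for h
    using outer_less by blast
  show ?thesis
  proof (rule grouping.intro[OF G cover])
    show "0 < reg s 16" using p by (simp add: prepped_def has_size_def)
    show "card C \<le> reg s 18" by (rule gr(1))
    have "bij_betw ((!) cl) {..<length cl} (set cl)" by (rule bij_betw_nth[OF distinct_cl]) simp_all
    then have "bij_betw ((!) cl) {..<card C} C" by (simp add: set_cl)
    moreover have "bij_betw (arr s 6) {..<card C} C \<longleftrightarrow> bij_betw ((!) cl) {..<card C} C"
      by (rule bij_betw_cong) (use gr(3) in simp)
    ultimately show "bij_betw (arr s 6) {..<card C} C" by simp
  next
    fix j assume "j < card C"
    from gr(3)[OF this] show "arr s 7 (arr s 6 j) = j" by simp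
  next
    fix u assume "u \<in> outer n E C"
    from gr(4)[OF this outer_less[OF this]]
    show "card C \<le> arr s 7 u \<and> arr s 7 u < reg s 18 \<and> nbs E (arr s 6 (arr s 7 u)) = nbs E u" .
  next
    fix h assume "card C \<le> h" "h < reg s 18"
    from gr(5)[OF this]
    show "arr s 6 h \<in> outer n E C \<and> arr s 7 (arr s 6 h) = h"
      "card {u \<in> outer n E C. arr s 7 u = h} \<le> reg s 16" by (simp_all add: e)
  next
    fix h h' assume h: "card C \<le> h" "h < reg s 18" "card C \<le> h'" "h' < reg s 18"
      and c: "card {u \<in> outer n E C. arr s 7 u = h} < reg s 16" "card {u \<in> outer n E C. arr s 7 u = h'} < reg s 16"
      and eq: "nbs E (arr s 6 h) = nbs E (arr s 6 h')"
    have "arr s 11 h < reg s 16" "arr s 11 h' < reg s 16"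
      using gr(5)[OF h(1,2)] gr(5)[OF h(3,4)] c by (simp_all add: e)
    from gr(7)[OF h this eq] show "h = h'" .
  qed
qed

end

section \<open>Programs: output and lifting\<close>

text \<open>Decides A < 16 D |C|^2 without multiplying at run time: the quotient is a constant of
  the program, and register 12 holds |C|^2.\<close>

definition good_test :: "nat \<Rightarrow> nat \<Rightarrow> bexp" where
  "good_test A D = And (Equal (Reg 10) (Const 1)) (Less (Const (A div (16 * D))) (Reg 12))"

definition prog_push :: "aexp \<Rightarrow> com" where
  "prog_push e = Seq (Store 0 (Reg 8) e) (Assign 8 (Plus (Reg 8) (Const 1)))"

text \<open>A list is preceded by its length, which is known only afterwards. Its cell is skipped,
  remembered in register 9 and filled in at the end.\<close>

definition prog_list :: com where
  "prog_list = Seq (Assign 9 (Reg 8)) (Seq (Assign 8 (Plus (Reg 8) (Const 1)))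
     (Seq (For 6 5 (If (Equal (Cell 9 (Plus (Cell 5 (Cell 6 (Reg 6))) (Cell 6 (Reg 5)))) (Const 1))
         (prog_push (Reg 6)) Skip))
       (Store 0 (Reg 9) (Minus (Reg 8) (Plus (Reg 9) (Const 1))))))"

definition prog_output :: com where
  "prog_output = Seq (Assign 8 (Const 0)) (Seq (prog_push (Reg 18)) (Seq (prog_push (Reg 23))
     (Seq (For 5 23 (prog_push (Reg 5))) (Seq (For 5 18 prog_list)
     (Seq (Assign 0 (Reg 8)) (Seq (Store 1 (Const 0) (Reg 23)) (Assign 1 (Const 1))))))))"

definition prog_empty :: com where
  "prog_empty = Seq (Store 0 (Const 0) (Const 0)) (Seq (Store 0 (Const 1) (Const 0))
     (Seq (Assign 0 (Const 2)) (Seq (Store 1 (Const 0) (Const 0)) (Assign 1 (Const 1)))))"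

definition reduction :: "nat \<Rightarrow> nat \<Rightarrow> com" where
  "reduction A D = Seq (prep A D) (If (good_test A D) prog_output prog_empty)"

text \<open>The keys are those of \<open>lift_pos\<close> if the contracted graph was output, and
  those of the fallback layout otherwise, so that one ranking program serves both cases.\<close>

definition prog_keys :: "nat \<Rightarrow> nat \<Rightarrow> com" where
  "prog_keys A D = For 5 22 (If (And (Equal (Cell 8 (Reg 5)) (Const 0)) (Equal (Cell 10 (Reg 5)) (Const 0)))
     (Store 12 (Reg 5) (Plus (Reg 18) (Const 1)))
     (If (good_test A D) (Store 12 (Reg 5) (Cell 4 (Cell 7 (Reg 5)))) (Store 12 (Reg 5) (Const 0))))"

text \<open>Keys and vertices are compared componentwise, which has the effect of comparing
  \<open>key * n + u\<close> without forming the product.\<close>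

definition prog_ranks :: com where
  "prog_ranks = For 5 22 (Seq (Assign 9 (Const 0))
     (Seq (For 6 22 (If (And (Not (Less (Cell 12 (Reg 5)) (Cell 12 (Reg 6))))
           (Not (And (Equal (Cell 12 (Reg 5)) (Cell 12 (Reg 6))) (Less (Reg 5) (Reg 6)))))
         (Assign 9 (Plus (Reg 9) (Const 1))) Skip))
       (Store 0 (Reg 5) (Reg 9))))"

definition lifting :: "nat \<Rightarrow> nat \<Rightarrow> com" where
  "lifting A D = Seq (prep A D) (Seq (prog_keys A D) (Seq prog_ranks (Assign 0 (Reg 22))))"

definition written :: "word \<Rightarrow> store \<Rightarrow> bool" where
  "written w s \<longleftrightarrow> reg s 8 = length w \<and> (\<forall>i<length w. arr s 0 i = w ! i)"

lemma written_upd [simp]: "x \<noteq> 8 \<Longrightarrow> written w (s\<lparr>reg := r(x := y)\<rparr>) \<longleftrightarrow> written w (s\<lparr>reg := r\<rparr>)"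
  by (simp add: written_def)

lemma wp_push:
  assumes "written w s" "aval e s = x"
  shows "wp B (prog_push e) (\<lambda>s'. written (w @ [x]) s') s"
  using assms by (simp add: prog_push_def written_def nth_append less_Suc_eq)

lemma written_map: "written w s \<Longrightarrow> map (arr s 0) [0..<reg s 8] = w"
  by (rule nth_equalityI) (simp_all add: written_def)

lemma wp_push_eq: "wp B (prog_push e) Q s \<longleftrightarrow>
    Q (s\<lparr>arr := (arr s)(0 := (arr s 0)(reg s 8 := aval e s)), reg := (reg s)(8 := Suc (reg s 8))\<rparr>)"
  by (simp add: prog_push_def)

text \<open>A skipped cell counts as written with whatever it contains, a placeholder until the
  length is known.\<close>

lemma written_junk:
  "written w s \<Longrightarrow>
    written (w @ [arr s 0 (length w)]) (s\<lparr>reg := (reg s)(9 := y, 8 := Suc (reg s 8))\<rparr>)"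
  by (simp add: written_def nth_append less_Suc_eq)

lemma written_store:
  "written w s \<Longrightarrow> p < length w \<Longrightarrow>
    written (w[p := x]) (s\<lparr>arr := (arr s)(0 := (arr s 0)(p := x))\<rparr>)"
  by (simp add: written_def nth_list_update)

lemma encode_set_lessThan: "encode_set {..<k} = k # [0..<k]"
  by (simp add: encode_set_def lessThan_atLeast0)

lemma sorted_list_filter: "sorted_list_of_set {u. u < h \<and> P u} = filter P [0..<h]"
proof -
  have "{u. u < h \<and> P u} = set (filter P [0..<h])" by auto
  also have "sorted_list_of_set \<dots> = filter P [0..<h]"
    by (rule sorted_list_of_set.idem_if_sorted_distinct) (simp_all add: sorted_wrt_filter)
  finally show ?thesis .
qed

context ola_input_eps
begin

lemma bval_good_test:
  assumes "prepped s"
  shows "bval (good_test A D) s \<longleftrightarrow> vertex_cover (n, E) C \<and> card C \<le> k \<and> A < 16 * D * (card C)\<^sup>2"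
proof -
  have "A div (16 * D) < (card C)\<^sup>2 \<longleftrightarrow> A < (card C)\<^sup>2 * (16 * D)"
    using D by (intro div_less_iff_less_mult) simp
  then show ?thesis using assms C
    by (auto simp: good_test_def prepped_def stored_def has_size_def vertex_cover_def mult.commute)
qed

text \<open>The counterpart of \<open>E'\<close> outside \<open>grouping\<close>, which is available
  only if \<open>C\<close> is a vertex cover, whereas the output program is verified without that
  assumption.\<close>

definition "E_red s = {{h, h'} | h h'. h < reg s 18 \<and> h' < reg s 18 \<and> {arr s 6 h, arr s 6 h'} \<in> E}"

lemma E_red_iff: "{h, h'} \<in> E_red s \<longleftrightarrow> h < reg s 18 \<and> h' < reg s 18 \<and> {arr s 6 h, arr s 6 h'} \<in> E"
  by (auto simp: E_red_def doubleton_eq_iff insert_commute)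

definition "same_data s t \<longleftrightarrow> reg t 18 = reg s 18 \<and> reg t 23 = reg s 23 \<and>
  arr t 5 = arr s 5 \<and> arr t 6 = arr s 6 \<and> arr t 9 = arr s 9"

lemma same_data_agree:
  "same_data s t \<Longrightarrow> agree c t t' \<Longrightarrow> {18, 23} \<inter> mod_regs c = {} \<Longrightarrow> {5, 6, 9} \<inter> mod_arrs c = {} \<Longrightarrow>
    same_data s t'"
  by (simp add: same_data_def agree_def)

lemma same_data_upd [simp]:
  "x \<noteq> 18 \<Longrightarrow> x \<noteq> 23 \<Longrightarrow> same_data s (t\<lparr>reg := r(x := y)\<rparr>) \<longleftrightarrow> same_data s (t\<lparr>reg := r\<rparr>)"
  by (simp add: same_data_def)

lemma adjacency:
  assumes p: "prepped s" and t: "same_data s t" and h: "h < reg s 18" "h' < reg s 18"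
  shows "arr t 9 (arr t 5 (arr t 6 h) + arr t 6 h') = of_bool ({h, h'} \<in> E_red s)"
proof -
  have "arr s 6 h < n" "arr s 6 h' < n"
    using has_groups_bounds(2)[of "reg s 16" n s] p h by (simp_all add: prepped_def)
  moreover have "has_rows s" "stored E s" using p by (simp_all add: prepped_def)
  ultimately show ?thesis using t h by (simp add: same_data_def has_rows_def stored_def E_red_iff)
qed

lemma wp_list:
  assumes p: "prepped s" and t: "same_data s t" "reg t 5 = h" "h < reg s 18" "written w t"
  shows "wp B prog_list (written (w @ encode_set {u. u < h \<and> {u, h} \<in> E_red s})) t"
proof -
  let ?b = "Equal (Cell 9 (Plus (Cell 5 (Cell 6 (Reg 6))) (Cell 6 (Reg 5)))) (Const 1)"
  let ?c = "If ?b (prog_push (Reg 6)) Skip"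
  let ?P = "\<lambda>u. {u, h} \<in> E_red s"
  let ?x = "arr t 0 (length w)"
  let ?t = "t\<lparr>reg := (reg t)(9 := reg t 8, 8 := Suc (reg t 8))\<rparr>"
  let ?I = "\<lambda>i t'. written ((w @ [?x]) @ filter ?P [0..<i]) t'"
  have N: "reg s 18 \<le> B" using has_groups_bounds(1)[of "reg s 16" n s] p by (simp add: prepped_def)
  have "wp B (For 6 5 ?c) (?I h) ?t"
  proof (rule wp_For[where Inv = ?I])
    fix i t' assume i: "i < h" and a: "agree (For 6 5 ?c) ?t t'" and r: "reg t' 6 = i" and I: "?I i t'"
    have sd: "same_data s t'"
      by (rule same_data_agree[OF _ a]) (use t(1) in \<open>simp_all add: prog_push_def\<close>)
    have r5: "reg t' 5 = h" using agree_regD[OF a, of 5] t(2) by (simp add: prog_push_def)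
    have b: "bval ?b t' \<longleftrightarrow> ?P i"
      using adjacency[OF p sd less_trans[OF i t(3)] t(3)] by (simp add: r r5)
    show "wp B ?c (\<lambda>t''. ?I (Suc i) (set_reg t'' 6 (Suc i))) t'"
    proof (cases "?P i")
      case True
      have "wp B (prog_push (Reg 6)) (written (((w @ [?x]) @ filter ?P [0..<i]) @ [i])) t'"
        by (rule wp_push[OF I]) (simp add: r)
      then have "wp B (prog_push (Reg 6)) (\<lambda>t''. ?I (Suc i) (set_reg t'' 6 (Suc i))) t'"
        by (rule wp_mono) (use True in simp)
      with b True show ?thesis by simp
    next
      case False
      with b I show ?thesis by simp
    qed
  next
    have "written (w @ [?x]) ?t" by (rule written_junk[OF t(4)])
    then show "?I 0 (set_reg ?t 6 0)" by simp
  qed (use t(2,3) N in \<open>simp_all add: prog_push_def\<close>)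
  then have "wp B (For 6 5 ?c) (wp B (Store 0 (Reg 9) (Minus (Reg 8) (Plus (Reg 9) (Const 1))))
      (written (w @ encode_set {u. u < h \<and> {u, h} \<in> E_red s}))) ?t"
  proof (rule wp_agree_mono)
    fix t' assume w: "?I h t'" and a: "agree (For 6 5 ?c) ?t t'"
    have r9: "reg t' 9 = length w"
      using agree_regD[OF a, of 9] t(4) by (simp add: prog_push_def written_def)
    have r8: "reg t' 8 = length w + 1 + length (filter ?P [0..<h])" using w by (simp add: written_def)
    have "written (((w @ [?x]) @ filter ?P [0..<h])[length w := length (filter ?P [0..<h])])
      (t'\<lparr>arr := (arr t')(0 := (arr t' 0)(length w := length (filter ?P [0..<h])))\<rparr>)"
      by (rule written_store[OF w]) simp
    moreover have "((w @ [?x]) @ filter ?P [0..<h])[length w := length (filter ?P [0..<h])]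
      = w @ encode_set {u. u < h \<and> ?P u}"
      using sorted_list_filter[of h ?P] length_sorted_list_of_set[of "{u. u < h \<and> ?P u}"]
      by (simp add: encode_set_def list_update_append)
    ultimately show "wp B (Store 0 (Reg 9) (Minus (Reg 8) (Plus (Reg 9) (Const 1))))
      (written (w @ encode_set {u. u < h \<and> {u, h} \<in> E_red s})) t'"
      by (simp add: r8 r9)
  qed
  then show ?thesis unfolding prog_list_def by simp
qed

lemma wp_output:
  assumes p: "prepped s"
  shows "wp B prog_output (\<lambda>s'. output_word s' 0 = encode_ola ((reg s 18, E_red s), {..<card C}) \<and>
    output_word s' 1 = [card C]) s"
proof -
  let ?N = "reg s 18" and ?k = "card C"
  let ?f = "\<lambda>h. encode_set {u. u < h \<and> {u, h} \<in> E_red s}"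
  have N: "?N \<le> B" using has_groups_bounds(1)[of "reg s 16" n s] p by (simp add: prepped_def)
  have rk: "reg s 23 = ?k" using p by (simp add: prepped_def has_rows_def)
  let ?I = "\<lambda>i t. written ([?N, ?k] @ [0..<i]) t \<and> same_data s t"
  have cover: "wp B (For 5 23 (prog_push (Reg 5))) (?I ?k) t"
    if t: "written [?N, ?k] t" "same_data s t" for t
  proof (rule wp_For[where Inv = ?I])
    fix i t' assume a: "agree (For 5 23 (prog_push (Reg 5))) t t'" and r: "reg t' 5 = i"
      and I: "?I i t'"
    have "wp B (prog_push (Reg 5)) (written (([?N, ?k] @ [0..<i]) @ [i])) t'"
      by (rule wp_push) (use I r in simp_all)
    then show "wp B (prog_push (Reg 5)) (\<lambda>t''. ?I (Suc i) (set_reg t'' 5 (Suc i))) t'"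
    proof (rule wp_agree_mono)
      fix t'' assume w: "written (([?N, ?k] @ [0..<i]) @ [i]) t''" and b: "agree (prog_push (Reg 5)) t' t''"
      have "same_data s t''" using same_data_agree[OF I[THEN conjunct2] b] by (simp add: prog_push_def)
      with w show "?I (Suc i) (set_reg t'' 5 (Suc i))" by simp
    qed
  qed (use t cB rk in \<open>simp_all add: prog_push_def same_data_def\<close>)
  let ?W = "\<lambda>h. ([?N, ?k] @ [0..<?k]) @ concat (map ?f [0..<h])"
  let ?J = "\<lambda>h t. written (?W h) t \<and> same_data s t"
  have lists: "wp B (For 5 18 prog_list) (?J ?N) t"
    if t: "written ([?N, ?k] @ [0..<?k]) t" "same_data s t" for t
  proof (rule wp_For[where Inv = ?J])
    fix h t' assume h: "h < ?N" and r: "reg t' 5 = h" and I: "?J h t'"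
    have "wp B prog_list (written (?W h @ ?f h)) t'"
      by (rule wp_list[OF p _ r h]) (use I in simp_all)
    then show "wp B prog_list (\<lambda>t''. ?J (Suc h) (set_reg t'' 5 (Suc h))) t'"
    proof (rule wp_agree_mono)
      fix t'' assume w: "written (?W h @ ?f h) t''" and b: "agree prog_list t' t''"
      have "same_data s t''" using same_data_agree[OF I[THEN conjunct2] b]
        by (simp add: prog_list_def prog_push_def)
      with w show "?J (Suc h) (set_reg t'' 5 (Suc h))" by simp
    qed
  qed (use t N in \<open>simp_all add: prog_list_def prog_push_def same_data_def\<close>)
  have enc: "encode_ola ((?N, E_red s), {..<?k}) = ?W ?N"
    by (simp add: encode_ola_def encode_set_lessThan)
  let ?rest = "Seq (Assign 0 (Reg 8)) (Seq (Store 1 (Const 0) (Reg 23)) (Assign 1 (Const 1)))"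
  let ?Q = "\<lambda>s'. output_word s' 0 = encode_ola ((?N, E_red s), {..<?k}) \<and> output_word s' 1 = [?k]"
  have final: "wp B ?rest ?Q t"
    if t: "written (?W ?N) t" "same_data s t" for t
  proof -
    note m = written_map[OF t(1)]
    have "reg t 23 = ?k" using t(2) rk by (simp add: same_data_def)
    then show ?thesis unfolding enc wp.simps output_word_def by (simp add: m)
  qed
  let ?t = "s\<lparr>arr := (arr s)(0 := (arr s 0)(0 := ?N, 1 := ?k)), reg := (reg s)(8 := 2)\<rparr>"
  have "wp B (For 5 23 (prog_push (Reg 5))) (wp B (Seq (For 5 18 prog_list) ?rest) ?Q) ?t"
  proof (rule wp_mono, rule cover)
    show "written [?N, ?k] ?t" by (simp add: written_def nth_Cons' less_Suc_eq)
    show "same_data s ?t" by (simp add: same_data_def)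
    fix t assume "?I ?k t"
    then have "wp B (For 5 18 prog_list) (?J ?N) t"
      by (intro lists) simp_all
    then have "wp B (For 5 18 prog_list) (wp B ?rest ?Q) t"
      by (rule wp_mono) (use final in blast)
    then show "wp B (Seq (For 5 18 prog_list) ?rest) ?Q t" by (simp only: wp.simps)
  qed
  then show ?thesis unfolding prog_output_def by (simp add: wp_push_eq rk numeral_2_eq_2)
qed

lemma wp_empty:
  "wp B prog_empty (\<lambda>s'. output_word s' 0 = encode_ola ((0, {}), {}) \<and> output_word s' 1 = [0]) s"
  by (simp add: prog_empty_def output_word_def encode_ola_def encode_set_def numeral_2_eq_2)

end

section \<open>Keys and ranks of the lifted layout\<close>

lemma rank_cong: "(\<And>u. u < n \<Longrightarrow> f u = g u) \<Longrightarrow> v < n \<Longrightarrow> rank n f v = rank n g v"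
  unfolding rank_def by (intro arg_cong[where f = card] Collect_cong) auto

context ola_input_eps
begin

definition "key s u = (if u \<in> C \<union> outer n E C
  then if bval (good_test A D) s then arr s 4 (arr s 7 u) else 0 else Suc (reg s 18))"

lemma wp_keys:
  assumes p: "prepped s"
  shows "wp B (prog_keys A D) (\<lambda>s'. \<forall>u<n. arr s' 12 u = key s u) s"
proof -
  let ?c = "If (And (Equal (Cell 8 (Reg 5)) (Const 0)) (Equal (Cell 10 (Reg 5)) (Const 0)))
     (Store 12 (Reg 5) (Plus (Reg 18) (Const 1)))
     (If (good_test A D) (Store 12 (Reg 5) (Cell 4 (Cell 7 (Reg 5)))) (Store 12 (Reg 5) (Const 0)))"
  let ?I = "\<lambda>i s'. \<forall>u<i. arr s' 12 u = key s u"
  have "wp B (For 5 22 ?c) (?I n) s"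
  proof (rule wp_For[where Inv = ?I])
    fix v s' assume v: "v < n" and a: "agree (For 5 22 ?c) s s'" and r: "reg s' 5 = v" and I: "?I v s'"
    have g: "bval (good_test A D) s' \<longleftrightarrow> bval (good_test A D) s" and r18: "reg s' 18 = reg s 18"
      using a by (simp_all add: agree_def good_test_def)
    have arrs: "arr s' 8 v = of_bool (v \<in> C)" "arr s' 10 v = of_bool (v \<in> \<Union>E)"
      "arr s' 4 = arr s 4" "arr s' 7 = arr s 7"
      using a p by (simp_all add: agree_def prepped_def stored_def)
    have b: "bval (And (Equal (Cell 8 (Reg 5)) (Const 0)) (Equal (Cell 10 (Reg 5)) (Const 0))) s'
      \<longleftrightarrow> v \<notin> C \<union> outer n E C"
      using v by (auto simp: r arrs outer_def)
    have "wp B ?c (\<lambda>s''. arr s'' 12 v = key s v \<and> (\<forall>u. u \<noteq> v \<longrightarrow> arr s'' 12 u = arr s' 12 u)) s'"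
      unfolding wp.simps b g by (simp add: key_def r r18 arrs)
    then show "wp B ?c (\<lambda>s''. ?I (Suc v) (set_reg s'' 5 (Suc v))) s'"
      by (rule wp_mono) (use I in \<open>simp add: less_Suc_eq\<close>)
  qed (use p nB in \<open>simp_all add: prepped_def has_rows_def\<close>)
  then show ?thesis by (simp add: prog_keys_def)
qed

lemma wp_ranks:
  assumes n: "reg s 22 = n" and key: "\<And>u. u < n \<Longrightarrow> arr s 12 u = f u"
  shows "wp B prog_ranks (\<lambda>s'. \<forall>v<n. arr s' 0 v = rank n (\<lambda>u. f u * n + u) v) s"
proof -
  let ?b = "And (Not (Less (Cell 12 (Reg 5)) (Cell 12 (Reg 6))))
    (Not (And (Equal (Cell 12 (Reg 5)) (Cell 12 (Reg 6))) (Less (Reg 5) (Reg 6))))"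
  let ?d = "If ?b (Assign 9 (Plus (Reg 9) (Const 1))) Skip"
  let ?c = "Seq (Assign 9 (Const 0)) (Seq (For 6 22 ?d) (Store 0 (Reg 5) (Reg 9)))"
  let ?f = "\<lambda>u. f u * n + u"
  let ?J = "\<lambda>v i s'. reg s' 9 = card {u \<in> {..<i}. ?f u \<le> ?f v}"
  have inner: "wp B (For 6 22 ?d) (?J v n) t"
    if v: "v < n" and t: "reg t 22 = n" "arr t 12 = arr s 12" "reg t 5 = v" "reg t 9 = 0" for v t
  proof (rule wp_For[where Inv = "?J v"])
    fix i t' assume i: "i < n" and a: "agree (For 6 22 ?d) t t'" and r: "reg t' 6 = i" and J: "?J v i t'"
    have "arr t' 12 = arr s 12" "reg t' 5 = v" using a t by (simp_all add: agree_def)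
    then have "bval ?b t' \<longleftrightarrow> \<not> (f v < f i \<or> f v = f i \<and> v < i)"
      using key[OF i] key[OF v] r by simp
    also have "\<dots> \<longleftrightarrow> ?f i \<le> ?f v"
      unfolding lex_index_le[OF v i, symmetric] by (rule not_less)
    finally have b: "bval ?b t' \<longleftrightarrow> ?f i \<le> ?f v" .
    have "{u \<in> {..<Suc i}. ?f u \<le> ?f v} = (if ?f i \<le> ?f v
        then insert i {u \<in> {..<i}. ?f u \<le> ?f v} else {u \<in> {..<i}. ?f u \<le> ?f v})"
      by (auto simp: less_Suc_eq)
    then have "card {u \<in> {..<Suc i}. ?f u \<le> ?f v} = (if ?f i \<le> ?f v
        then Suc (card {u \<in> {..<i}. ?f u \<le> ?f v}) else card {u \<in> {..<i}. ?f u \<le> ?f v})"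
      by (simp del: lessThan_iff add: card_insert_if) (simp add: lessThan_iff)
    then show "wp B ?d (\<lambda>t''. ?J v (Suc i) (set_reg t'' 6 (Suc i))) t'"
      unfolding wp.simps b using J by simp
  qed (use t nB in simp_all)
  let ?I = "\<lambda>i s'. \<forall>v<i. arr s' 0 v = rank n ?f v"
  have "wp B (For 5 22 ?c) (?I n) s"
  proof (rule wp_For[where Inv = ?I])
    fix v s' assume v: "v < n" and a: "agree (For 5 22 ?c) s s'" and r: "reg s' 5 = v" and I: "?I v s'"
    have s': "reg s' 22 = n" "arr s' 12 = arr s 12" using a n by (simp_all add: agree_def)
    let ?t = "set_reg s' 9 0"
    have "wp B (For 6 22 ?d) (?J v n) ?t" by (rule inner[OF v]) (use s' r in simp_all)
    then have "wp B (For 6 22 ?d) (wp B (Store 0 (Reg 5) (Reg 9))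
      (\<lambda>s''. ?I (Suc v) (set_reg s'' 5 (Suc v)))) ?t"
    proof (rule wp_agree_mono)
      fix t assume J: "?J v n t" and b: "agree (For 6 22 ?d) ?t t"
      have "reg t 5 = v" "arr t 0 = arr s' 0" using b r by (simp_all add: agree_def)
      moreover have "reg t 9 = rank n ?f v" unfolding rank_def by (rule J)
      ultimately show "wp B (Store 0 (Reg 5) (Reg 9))
        (\<lambda>s''. ?I (Suc v) (set_reg s'' 5 (Suc v))) t"
        using I by (simp add: less_Suc_eq)
    qed
    then show "wp B ?c (\<lambda>s''. ?I (Suc v) (set_reg s'' 5 (Suc v))) s'"
      by (simp only: wp.simps aval.simps)
  qed (use n nB in simp_all)
  then show ?thesis by (simp add: prog_ranks_def)
qed

lemma wp_reduction_tail:
  assumes t: "prepped t"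
  shows "wp B (If (good_test A D) prog_output prog_empty) (\<lambda>s'. map (output_word s') [0..<2] =
    (if bval (good_test A D) t then [encode_ola ((reg t 18, E_red t), {..<card C}), [card C]]
      else [encode_ola ((0, {}), {}), [0]])) t"
proof (cases "bval (good_test A D) t")
  case True
  have "wp B prog_output (\<lambda>s'. map (output_word s') [0..<2] =
    [encode_ola ((reg t 18, E_red t), {..<card C}), [card C]]) t"
    by (rule wp_mono[OF wp_output[OF t]]) (simp add: upt_rec)
  with True show ?thesis by simp
next
  case False
  have "wp B prog_empty (\<lambda>s'. map (output_word s') [0..<2] = [encode_ola ((0, {}), {}), [0]]) t"
    by (rule wp_mono[OF wp_empty]) (simp add: upt_rec)
  with False show ?thesis by simp
qed

lemma wp_lifting_tail:
  assumes t: "prepped t"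
  shows "wp B (Seq (prog_keys A D) (Seq prog_ranks (Assign 0 (Reg 22))))
    (\<lambda>s'. output_word s' 0 = map (rank n (\<lambda>u. key t u * n + u)) [0..<n]) t"
  unfolding wp.simps(4)
proof (rule wp_agree_mono[OF wp_keys[OF t]])
  let ?Q = "\<lambda>s'. output_word s' 0 = map (rank n (\<lambda>u. key t u * n + u)) [0..<n]"
  fix t1 assume k: "\<forall>u<n. arr t1 12 u = key t u" and a1: "agree (prog_keys A D) t t1"
  have n1: "reg t1 22 = n"
    using agree_regD[OF a1, of 22] t by (simp add: prog_keys_def prepped_def has_rows_def)
  show "wp B prog_ranks (wp B (Assign 0 (Reg 22)) ?Q) t1"
  proof (rule wp_agree_mono, rule wp_ranks[OF n1])
    show "arr t1 12 u = key t u" if "u < n" for u using k that by simp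
    fix t2 assume r: "\<forall>v<n. arr t2 0 v = rank n (\<lambda>u. key t u * n + u) v" and a2: "agree prog_ranks t1 t2"
    have "reg t2 22 = n" using agree_regD[OF a2, of 22] n1 by (simp add: prog_ranks_def)
    then show "wp B (Assign 0 (Reg 22)) ?Q t2" using r by (simp add: output_word_def)
  qed
qed

end

section \<open>The approximate kernel\<close>

lemma avoids_prep: "avoids {2, 3, 4} (prep A D)"
  by (simp add: prep_def prog_rows_def prog_cover_def prog_edges_def prog_edge_def prog_count_def is_outer_def
    prog_arith_def prog_groups_def prog_find_def prog_same_def prog_insert_def)

text \<open>The first half is given as an execution and not by \<open>wp\<close>, because its final
  store has to be a particular one, related to that of the other program.\<close>

lemma exec_Seq_steps:
  assumes "exec P s t s'" "t \<le> steps B P" "wp B Q R s'"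
  shows "\<exists>t' s''. exec (Seq P Q) s t' s'' \<and> t' \<le> steps B (Seq P Q) \<and> R s''"
proof -
  obtain r s'' where "exec Q s' r s''" "r \<le> steps B Q" "R s''" using wp_sound[OF assms(3)] by blast
  then show ?thesis using exec.Seq[OF assms(1)] assms(2) by (intro exI[of _ "1 + t + r"] exI[of _ s'']) simp
qed

context ola_input_eps
begin

lemma E_red_eq: "E_red s = grouping.E' E (reg s 18) (arr s 6)"
  if "grouping n E C (reg s 16) (reg s 18) (arr s 6) (arr s 7)" for s :: store
  using grouping.E'_def[OF that] by (simp add: E_red_def)

lemma reads_init: "reads (init_store (enc # [k] # ws))"
  by (simp add: reads_def init_store_def)

lemma init_zero: "length ws \<le> 5 \<Longrightarrow> a \<in> {8, 9, 10, 11} \<Longrightarrow> arr (init_store ws) a = (\<lambda>_. 0)"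
  by (auto simp: init_store_def)

text \<open>There are three cases: without a valid cover every string will do; for large
  \<open>A\<close> the keys give the fallback layout; otherwise they give
  \<open>lift\<close>.\<close>

lemma approx_solution_key:
  fixes s :: store
  assumes p: "prepped s" and s4: "\<And>i. i < length \<sigma> \<Longrightarrow> arr s 4 i = \<sigma> ! i" and c: "1 \<le> c"
    and ap: "if bval (good_test A D) s then approx_solution OLA c ((reg s 18, E_red s), {..<card C}) (card C) \<sigma>
      else approx_solution OLA c ((0, {}), {}) 0 \<sigma>"
  shows "approx_solution OLA (c * (1 + real A / real D)) ((n, E), C) k
    (map (rank n (\<lambda>u. key s u * n + u)) [0..<n])"
proof (cases "vertex_cover (n, E) C \<and> card C \<le> k")
  case False
  have "1 * 1 \<le> c * (1 + real A / real D)" using c by (intro mult_mono) auto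
  then have "0 < c * (1 + real A / real D)" by simp
  with False show ?thesis by (rule approx_solution_OLA_no_cover)
next
  case True
  then have cover: "vertex_cover (n, E) C" "card C \<le> k" by simp_all
  show ?thesis
  proof (cases "A < 16 * D * (card C)\<^sup>2")
    case False
    then have "key s = (\<lambda>u. if u \<in> C \<union> outer n E C then 0 else Suc (reg s 18))"
      using bval_good_test[OF p] by (intro ext) (simp add: key_def)
    then show ?thesis
      using approx_solution_OLA_trivial[OF G cover _ D c, of A "reg s 18"] False by simp
  next
    case True
    note k = cover(2)
    from True cover have good: "bval (good_test A D) s" using bval_good_test[OF p] by simp
    interpret grouping n E C "reg s 16" "reg s 18" "arr s 6" "arr s 7"
      by (rule grouping_prepped[OF p cover(1)])
    have k0: "0 < card C" using True by (cases "card C") simp_all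
    have ap': "approx_solution OLA c ((reg s 18, E'), {..<card C}) (card C) \<sigma>"
      using ap good E_red_eq[OF grouping_axioms] by simp
    \<comment> \<open>The existence of some layout forces \<open>\<sigma>\<close> to be one. In
      particular it has the right length, so array 4 is read only where it holds
      \<open>\<sigma>\<close>.\<close>
    obtain \<tau> where "linear_layout (reg s 18, E') \<tau>"
      using linear_layout_rank[of id "reg s 18" E'] by auto
    from approx_solution_OLA_D[OF ap' c vertex_cover' _ this]
    have len: "length \<sigma> = reg s 18" by (simp add: linear_layout_def)
    have "rank n (\<lambda>u. key s u * n + u) v = rank n (lift_pos \<sigma>) v" if "v < n" for v
    proof (rule rank_cong[OF _ that])
      fix u assume "u < n"
      show "key s u * n + u = lift_pos \<sigma> u"
        using good g_less[of u] s4 by (simp add: key_def lift_pos_def placed_def[symmetric] len)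
    qed
    then have "map (rank n (\<lambda>u. key s u * n + u)) [0..<n] = lift \<sigma>"
      by (simp add: lift_def)
    moreover have "reg s 16 = 1 \<or> 64 * D * (card C)\<^sup>2 * 2 ^ card C * reg s 16 \<le> A * card (outer n E C)"
      using p k0 by (simp add: prepped_def has_size_def)
    ultimately show ?thesis
      using approx_solution_lift[OF k0 k less_imp_le[OF True] D _ c ap'] by simp
  qed
qed

lemma reduced_size:
  fixes s :: store
  assumes p: "prepped s" and good: "bval (good_test A D) s" and A: "0 < A"
  shows "real (word_size (encode_ola ((reg s 18, E_red s), {..<card C})) + card C)
    \<le> 1440 * (real D / real A * 2 ^ k * real k ^ 4)"
proof -
  have cover: "vertex_cover (n, E) C" and k: "card C \<le> k" and lt: "A < 16 * D * (card C)\<^sup>2"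
    using good bval_good_test[OF p] by simp_all
  interpret grouping n E C "reg s 16" "reg s 18" "arr s 6" "arr s 7"
    by (rule grouping_prepped[OF p cover])
  let ?S = "word_size (encode_ola ((reg s 18, E'), {..<card C})) + card C"
  have k0: "0 < card C" using lt by (cases "card C") simp_all
  have "A * card (outer n E C) \<le> 2 * (64 * D * (card C)\<^sup>2 * 2 ^ card C) * reg s 16"
    using p k0 by (simp add: prepped_def has_size_def)
  then have "A * ?S \<le> 1440 * (D * 2 ^ card C * card C ^ 4)"
    by (rule reduced_bound[OF k0 less_imp_le[OF lt]])
  also have "\<dots> \<le> 1440 * (D * 2 ^ k * k ^ 4)"
    using k by (intro mult_le_mono2 mult_le_mono power_increasing power_mono) simp_all
  finally have "real (A * ?S) \<le> real (1440 * (D * 2 ^ k * k ^ 4))" by (simp only: of_nat_le_iff)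
  then have "real A * real ?S \<le> 1440 * (real D * 2 ^ k * real k ^ 4)" by simp
  then have "real ?S \<le> 1440 * (real D * 2 ^ k * real k ^ 4) / real A"
    using A by (simp add: pos_le_divide_eq mult.commute)
  also have "\<dots> = 1440 * (real D / real A * 2 ^ k * real k ^ 4)" by simp
  finally show ?thesis unfolding E_red_eq[OF grouping_axioms] .
qed

lemma kernel_correct:
  assumes A: "0 < A"
  shows "\<exists>I'\<in>instances OLA. \<exists>k'.
    computes_within (reduction A D) [enc, [k]] [encode OLA I', [k']] (steps B (reduction A D)) \<and>
    real (inst_size OLA I' + k') \<le> 1440 * max 1 (real D / real A * 2 ^ k * real k ^ 4) \<and>
    (\<forall>s'. \<exists>s. computes_within (lifting A D) [enc, [k], encode OLA I', [k'], s'] [s] (steps B (lifting A D)) \<and>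
      (\<forall>c\<ge>1. approx_solution OLA c I' k' s' \<longrightarrow>
        approx_solution OLA (c * (1 + real A / real D)) ((n, E), C) k s))"
proof -
  let ?R = "init_store [enc, [k]]"
  have "wp B (prep A D) prepped ?R"
    by (rule wp_prep[OF reads_init]) (rule init_zero, simp_all)
  then obtain T r where r: "exec (prep A D) ?R T r" "T \<le> steps B (prep A D)" "prepped r"
    using wp_sound by blast
  define good where "good \<longleftrightarrow> bval (good_test A D) r"
  define I' where "I' = (if good then ((reg r 18, E_red r), {..<card C}) else ((0, {}), {}))"
  define k' where "k' = (if good then card C else 0)"
  have enc': "encode OLA = encode_ola" by (simp add: OLA_def)
  have "wp B (If (good_test A D) prog_output prog_empty) (\<lambda>s'. map (output_word s') [0..<2] =
    [encode OLA I', [k']]) r"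
    by (rule wp_mono[OF wp_reduction_tail[OF r(3)]]) (auto simp: enc' I'_def k'_def good_def)
  from exec_Seq_steps[OF r(1,2) this]
  have "computes_within (reduction A D) [enc, [k]] [encode OLA I', [k']] (steps B (reduction A D))"
    unfolding reduction_def[symmetric] by (auto simp: computes_within_def numeral_2_eq_2)
  moreover have "I' \<in> instances OLA"
  proof (cases good)
    case True
    then have cover: "vertex_cover (n, E) C" using bval_good_test[OF r(3)] by (simp add: good_def)
    interpret grouping n E C "reg r 16" "reg r 18" "arr r 6" "arr r 7"
      by (rule grouping_prepped[OF r(3) cover])
    show ?thesis
      using simple_graph' k_le True by (auto simp: I'_def OLA_def E_red_eq[OF grouping_axioms])
  qed (simp add: I'_def OLA_def simple_graph_def)
  moreover have "real (inst_size OLA I' + k') \<le> 1440 * max 1 (real D / real A * 2 ^ k * real k ^ 4)"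
  proof (cases good)
    case True
    then have "real (inst_size OLA I' + k') \<le> 1440 * (real D / real A * 2 ^ k * real k ^ 4)"
      using reduced_size[OF r(3) _ A] by (simp add: good_def I'_def k'_def enc')
    also have "\<dots> \<le> 1440 * max 1 (real D / real A * 2 ^ k * real k ^ 4)" by simp
    finally show ?thesis .
  next
    case False
    \<comment> \<open>The empty instance is written as two zeros, each of bit length 0 plus a
      terminating symbol. The \<open>max 1\<close> in the size bound covers this case.\<close>
    then have "inst_size OLA I' + k' = 2"
      by (simp add: I'_def k'_def enc' encode_ola_def encode_set_def floorlog_def)
    then show ?thesis by simp
  qed
  moreover have "\<exists>s. computes_within (lifting A D) [enc, [k], encode OLA I', [k'], s'] [s] (steps B (lifting A D)) \<and>
      (\<forall>c\<ge>1. approx_solution OLA c I' k' s' \<longrightarrow>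
        approx_solution OLA (c * (1 + real A / real D)) ((n, E), C) k s)" for s'
  proof -
    let ?ws = "[enc, [k], encode OLA I', [k'], s']"
    let ?L = "init_store ?ws"
    have "eq_off {2, 3, 4} ?R ?L"
      by (auto simp: eq_off_def init_store_def less_Suc_eq nth_Cons')
    from exec_eq_off[OF r(1) this avoids_prep] obtain l where
      l: "exec (prep A D) ?L T l" "eq_off {2, 3, 4} r l" by blast
    \<comment> \<open>Two descriptions of one run are merged by determinism: independence of inputs
      2 to 4 relates its result to that of the reduction, and \<open>wp\<close> shows that it is
      \<open>prepped\<close> and that array 4 is intact.\<close>
    have "wp B (prep A D) (\<lambda>t. prepped t \<and> agree (prep A D) ?L t) ?L"
      by (rule wp_agree_mono[OF wp_prep[OF reads_init]]) (rule init_zero, simp_all)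
    then obtain T' l' where l': "exec (prep A D) ?L T' l'" "prepped l' \<and> agree (prep A D) ?L l'"
      using wp_sound by blast
    have pl: "prepped l" and al: "agree (prep A D) ?L l"
      using exec_deterministic[OF l(1) l'(1)] l'(2) by simp_all
    let ?s = "map (rank n (\<lambda>u. key l u * n + u)) [0..<n]"
    from exec_Seq_steps[OF l(1) r(2) wp_lifting_tail[OF pl]]
    have "computes_within (lifting A D) ?ws [?s] (steps B (lifting A D))"
      unfolding lifting_def[symmetric] by (auto simp: computes_within_def)
    moreover have "approx_solution OLA (c * (1 + real A / real D)) ((n, E), C) k ?s"
      if "1 \<le> c" "approx_solution OLA c I' k' s'" for c
    proof (rule approx_solution_key[OF pl _ that(1)])
      have "arr l 4 = arr ?L 4"
        by (rule agree_arrD[OF al]) (simp add: prep_def prog_rows_def prog_cover_def prog_edges_def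
          prog_edge_def prog_count_def prog_arith_def prog_groups_def prog_find_def prog_same_def prog_insert_def)
      then show "arr l 4 i = s' ! i" if "i < length s'" for i using that by (simp add: init_store_def)
      have "good \<longleftrightarrow> bval (good_test A D) l" "reg l 18 = reg r 18" "E_red l = E_red r"
        using l(2) by (simp_all add: good_def good_test_def eq_off_def E_red_def)
      then show "if bval (good_test A D) l then approx_solution OLA c ((reg l 18, E_red l), {..<card C}) (card C) s'
        else approx_solution OLA c ((0, {}), {}) 0 s'"
        using that(2) by (simp add: I'_def k'_def split: if_splits)
    qed
    ultimately show ?thesis by blast
  qed
  ultimately show ?thesis by blast
qed

end

section \<open>Monotonicity and polynomial time bounds\<close>

lemma word_size_ge_length: "length w \<le> word_size w"
  by (induction w) simp_all

lemma steps_mono: "B \<le> B' \<Longrightarrow> steps B c \<le> steps B' c"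
  by (induction c) (auto intro!: add_mono mult_le_mono)

lemma computes_within_mono: "computes_within P ws vs T \<Longrightarrow> T \<le> T' \<Longrightarrow> computes_within P ws vs T'"
  unfolding computes_within_def using le_trans by blast

text \<open>A larger ratio helps only because the optimum is nonnegative; where it is not, the cover
  is invalid and every string qualifies.\<close>

lemma approx_solution_OLA_mono:
  assumes ap: "approx_solution OLA r ((n, E), C) k s" and r: "0 < r" "r \<le> r'"
  shows "approx_solution OLA r' ((n, E), C) k s"
proof (cases "vertex_cover (n, E) C \<and> card C \<le> k")
  case True
  then have "0 \<le> opt OLA ((n, E), C) k"
    unfolding opt_def by (intro INF_greatest) (simp add: OLA_def ola_cost_def layout_val_nonneg)
  then have "ereal r * opt OLA ((n, E), C) k \<le> ereal r' * opt OLA ((n, E), C) k"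
    using r(2) by (intro ereal_mult_right_mono) simp_all
  with ap show ?thesis unfolding approx_solution_def by (rule order.trans)
qed (use r in \<open>simp add: approx_solution_OLA_no_cover\<close>)

lemma inst_size_OLA: "n + 2 \<le> inst_size OLA ((n, E), C)"
proof -
  have "n \<le> length (concat (map (\<lambda>v. encode_set {u. u < v \<and> {u, v} \<in> E}) [0..<n]))"
    by (induction n) (simp_all add: encode_set_def)
  then have "n + 2 \<le> length (encode_ola ((n, E), C))" by (simp add: encode_ola_def encode_set_def)
  then show ?thesis using word_size_ge_length[of "encode_ola ((n, E), C)"] by (simp add: OLA_def)
qed

lemma approx_kernel_rational:
  assumes A: "0 < A" and D: "0 < D" and \<epsilon>: "real A / real D \<le> \<epsilon>"
  shows "approx_kernel OLA (1 + \<epsilon>)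
    (\<lambda>k. 1440 * max 1 (real D / real A * 2 ^ k * real k ^ 4)) (reduction A D) (lifting A D)"
proof -
  \<comment> \<open>One bound for all loops: it dominates \<open>2 * n\<close> for the groups,
    \<open>(card C)\<^sup>2\<close> and \<open>A * n\<close> for the computation of the group size,
    when \<open>x\<close> is the input size plus \<open>k\<close>.\<close>
  define b where "b x = (A + 2) * x + x * x" for x :: nat
  have mono: "b x \<le> b y" if "x \<le> y" for x y using that unfolding b_def by (intro add_mono mult_le_mono) auto
  obtain p0 where p0: "\<forall>B. steps B (reduction A D) = poly p0 B" using steps_poly[of "reduction A D"] by blast
  obtain q0 where q0: "\<forall>B. steps B (lifting A D) = poly q0 B" using steps_poly[of "lifting A D"] by blast
  let ?b = "[:0, A + 2, 1:]"
  have b: "poly ?b x = b x" for x by (simp add: b_def algebra_simps)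
  define p where "p = pcompose p0 ?b"
  define q where "q = pcompose q0 ?b"
  have p: "poly p x = steps (b x) (reduction A D)" and q: "poly q x = steps (b x) (lifting A D)" for x
    unfolding p_def q_def poly_pcompose b using p0 q0 by simp_all
  show ?thesis
    unfolding approx_kernel_def
  proof (rule exI[of _ p], rule exI[of _ q], intro ballI allI)
    fix I k assume "I \<in> instances OLA"
    then obtain n E C where I: "I = ((n, E), C)" and G: "simple_graph (n, E)" and C: "C \<subseteq> {..<n}"
      by (auto simp: OLA_def)
    define x where "x = inst_size OLA I + k"
    have cn: "card C \<le> n" using card_mono[OF _ C] by simp
    have n: "n \<le> x" using inst_size_OLA[of n E C] by (simp add: x_def I)
    have kk: "(card C)\<^sup>2 \<le> b x"
    proof -
      have "(card C)\<^sup>2 \<le> x * x" unfolding power2_eq_square using cn n by (intro mult_le_mono) auto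
      then show ?thesis by (simp add: b_def)
    qed
    have "A * n \<le> A * x" by (rule mult_le_mono2[OF n])
    also have "\<dots> \<le> b x" by (simp add: b_def)
    finally have An: "A * n \<le> b x" .
    interpret ola_input_eps n E C k "b x" A D
      by unfold_locales (use G C D kk An n in \<open>simp_all add: b_def\<close>)
    have enc: "enc = encode OLA I" by (simp add: enc_def OLA_def I)
    obtain I' k' where I': "I' \<in> instances OLA"
      and R: "computes_within (reduction A D) [encode OLA I, [k]] [encode OLA I', [k']] (steps (b x) (reduction A D))"
      and size: "real (inst_size OLA I' + k') \<le> 1440 * max 1 (real D / real A * 2 ^ k * real k ^ 4)"
      and L: "\<And>s'. \<exists>s. computes_within (lifting A D) [encode OLA I, [k], encode OLA I', [k'], s'] [s]
          (steps (b x) (lifting A D)) \<and>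
        (\<forall>c\<ge>1. approx_solution OLA c I' k' s' \<longrightarrow> approx_solution OLA (c * (1 + real A / real D)) ((n, E), C) k s)"
      using kernel_correct[OF A] unfolding enc by blast
    show "\<exists>I'\<in>instances OLA. \<exists>k'.
        computes_within (reduction A D) [encode OLA I, [k]] [encode OLA I', [k']] (poly p (inst_size OLA I + k)) \<and>
        real (inst_size OLA I' + k') \<le> 1440 * max 1 (real D / real A * 2 ^ k * real k ^ 4) \<and>
        (\<forall>s'. \<exists>s. computes_within (lifting A D) [encode OLA I, [k], encode OLA I', [k'], s'] [s]
             (poly q (inst_size OLA I + k + inst_size OLA I' + k' + word_size s')) \<and>
           (\<forall>c\<ge>1. approx_solution OLA c I' k' s' \<longrightarrow> approx_solution OLA (c * (1 + \<epsilon>)) I k s))"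
    proof (intro bexI[OF _ I'] exI[of _ k'] conjI allI size)
      show "computes_within (reduction A D) [encode OLA I, [k]] [encode OLA I', [k']] (poly p (inst_size OLA I + k))"
        unfolding p x_def[symmetric] by (rule R)
      fix s'
      obtain s where s: "computes_within (lifting A D) [encode OLA I, [k], encode OLA I', [k'], s'] [s]
          (steps (b x) (lifting A D))"
        "\<And>c. 1 \<le> c \<Longrightarrow> approx_solution OLA c I' k' s' \<Longrightarrow>
          approx_solution OLA (c * (1 + real A / real D)) ((n, E), C) k s"
        using L[of s'] by blast
      have "computes_within (lifting A D) [encode OLA I, [k], encode OLA I', [k'], s'] [s]
          (poly q (inst_size OLA I + k + inst_size OLA I' + k' + word_size s'))"
        unfolding q by (rule computes_within_mono[OF s(1)], intro steps_mono mono) (simp add: x_def)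
      moreover have "approx_solution OLA (c * (1 + \<epsilon>)) I k s"
        if c: "1 \<le> c" and ap: "approx_solution OLA c I' k' s'" for c
        unfolding I
      proof (rule approx_solution_OLA_mono[OF s(2)[OF c ap]])
        have "0 < 1 + real A / real D" by (simp add: add_pos_nonneg)
        then show "0 < c * (1 + real A / real D)" using c by simp
        show "c * (1 + real A / real D) \<le> c * (1 + \<epsilon>)" using c \<epsilon> by simp
      qed
      ultimately show "\<exists>s. computes_within (lifting A D) [encode OLA I, [k], encode OLA I', [k'], s'] [s]
             (poly q (inst_size OLA I + k + inst_size OLA I' + k' + word_size s')) \<and>
           (\<forall>c\<ge>1. approx_solution OLA c I' k' s' \<longrightarrow> approx_solution OLA (c * (1 + \<epsilon>)) I k s)"
        by blast
    qed
  qed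
qed

lemma approx_kernel_size_mono:
  assumes "approx_kernel P \<alpha> g R L" "\<And>k. g k \<le> g' k"
  shows "approx_kernel P \<alpha> g' R L"
  using assms unfolding approx_kernel_def by (meson order.trans)

theorem theorem6p8:
  shows "\<exists>c::real. \<forall>\<epsilon>::real. \<epsilon> > 0 \<longrightarrow>
    has_approx_kernel OLA (1 + \<epsilon>) (\<lambda>k. c * max 1 (1 / \<epsilon> * 2 ^ k * real k ^ 4))"
proof (intro exI[of _ 2880] allI impI)
  fix \<epsilon> :: real assume \<epsilon>: "\<epsilon> > 0"
  \<comment> \<open>The rational must lie below \<epsilon> for the ratio, and above \<epsilon> / 2
    so that its inverse is at most doubled: 2880 = 2 * 1440.\<close>
  obtain r where r: "r \<in> \<rat>" "\<epsilon> / 2 < r" "r < \<epsilon>"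
    using Rats_dense_in_real[of "\<epsilon> / 2" \<epsilon>] \<epsilon> by auto
  obtain A D :: nat where AD: "D \<noteq> 0" "\<bar>r\<bar> = real A / real D"
    using r(1) by (rule Rats_abs_nat_div_natE)
  have r': "r = real A / real D" using AD(2) r(2) \<epsilon> by simp
  have A: "0 < A" using r' r(2) \<epsilon> by (cases "A = 0") simp_all
  have DA: "real D / real A \<le> 2 * (1 / \<epsilon>)"
    using r(2) \<epsilon> A AD(1) unfolding r' by (simp add: field_simps)
  have "approx_kernel OLA (1 + \<epsilon>) (\<lambda>k. 1440 * max 1 (real D / real A * 2 ^ k * real k ^ 4))
    (reduction A D) (lifting A D)"
    by (rule approx_kernel_rational) (use A AD(1) r(3) r' in simp_all)
  then have "approx_kernel OLA (1 + \<epsilon>) (\<lambda>k. 2880 * max 1 (1 / \<epsilon> * 2 ^ k * real k ^ 4))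
    (reduction A D) (lifting A D)"
  proof (rule approx_kernel_size_mono)
    fix k :: nat
    have "real D / real A * 2 ^ k * real k ^ 4 \<le> 2 * (1 / \<epsilon>) * 2 ^ k * real k ^ 4"
      using DA by (intro mult_right_mono) simp_all
    also have "\<dots> = 2 * (1 / \<epsilon> * 2 ^ k * real k ^ 4)" by simp
    finally show "1440 * max 1 (real D / real A * 2 ^ k * real k ^ 4)
      \<le> 2880 * max 1 (1 / \<epsilon> * 2 ^ k * real k ^ 4)" by (simp add: max_def)
  qed
  then show "has_approx_kernel OLA (1 + \<epsilon>) (\<lambda>k. 2880 * max 1 (1 / \<epsilon> * 2 ^ k * real k ^ 4))"
    unfolding has_approx_kernel_def by blast
qed

end
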